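(* Let $\mathcal{C}$ be a pseudounitary modular category and let $$\mathcal{C}=\mathcal{C}^{(0)}\supseteq\mathcal{C}^{(1)}\supseteq\cdots\supseteq\mathcal{C}^{(n)}\supseteq\cdots,\qquad \mathrm{Vec}=\mathcal{C}_{(0)}\subseteq\mathcal{C}_{(1)}\subseteq\cdots\subseteq\mathcal{C}_{(n)}\subseteq\cdots$$ be the upper and lower central series of $\mathcal{C}$. Then $(\mathcal{C}^{(n)})'=\mathcal{C}_{(n)}$ for all $n\ge0$.
   Context: $k$ is an algebraically closed field of characteristic $0$. A fusion category is a $k$-linear semisimple rigid tensor category with finitely many isomorphism classes of simple objects, finite-dimensional morphism spaces, and simple unit object; a fusion subcategory is a full tensor subcategory. $\mathrm{Vec}$ is the fusion subcategory generated by the unit object. $\mathrm{FPdim}$ of objects is given by the unique ring homomorphism $K_0(\mathcal{C})\to\mathbb{R}$ positive on simple objects, and $\mathrm{FPdim}(\mathcal{C})$ is the sum of squares of dimensions of the simple objects. $\mathcal{C}$ is pseudounitary if its categorical dimension equals $\mathrm{FPdim}(\mathcal{C})$. A modular category is a ribbon fusion category with simple objects $X_i$, $i\in\mathcal{I}$, braiding $c$, and non-degenerate $S$-matrix $s_{ij}=\mathrm{tr}_q(c_{X_i,X_j}\circ c_{X_j,X_i})$ (whose entries lie in a cyclotomic field and are regarded as complex numbers); $d_i$ is the categorical dimension of $X_i$. A pseudounitary modular category is always equipped with its canonical spherical structure, for which $d_i=\mathrm{FPdim}(X_i)$. For a fusion category $\mathcal{D}$, $\mathcal{D}_{ad}$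 is the full tensor subcategory generated by all subobjects of $X\otimes X^*$, $X$ simple in $\mathcal{D}$. Upper central series: $\mathcal{C}^{(0)}=\mathcal{C}$, $\mathcal{C}^{(n)}=(\mathcal{C}^{(n-1)})_{ad}$ for $n\ge1$. For a fusion subcategory $\mathcal{K}\subseteq\mathcal{C}$, the commutator $\mathcal{K}^{co}$ is the fusion subcategory of $\mathcal{C}$ generated by all simple $Y$ with $Y\otimes Y^*\in\mathcal{K}$. Lower central series: $\mathcal{C}_{(0)}=\mathrm{Vec}$, $\mathcal{C}_{(1)}=\mathcal{C}_{pt}$ (the subcategory generated by invertible objects), $\mathcal{C}_{(n)}=(\mathcal{C}_{(n-1)})^{co}$ for $n\ge1$. The (Müger) centralizer $\mathcal{K}'$ of a fusion subcategory $\mathcal{K}$ of a pseudounitary modular category $\mathcal{C}$ is the fusion subcategory generated by all simple $X_i$ such that $s_{ij}=d_id_j$ for all simple $X_j\in\mathcal{K}$. *)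

theory Defs
  imports Complex_Main "HOL-Computational_Algebra.Polynomial" "HOL-Algebra.Ring"
begin

(* All morphisms live in one ambient k-vector space 'm, of which the sets Hom X Y are subspaces that
   need not be disjoint. This is no restriction: take for 'm the direct sum of all the Hom spaces of
   a small k-linear category. Composition and tensor product of morphisms are then total operations
   on 'm, and axioms are only imposed on morphisms of the appropriate types. *)

record ('o, 'm, 'k) linear_cat =
  Ob :: "'o set"
  Hom :: "'o \<Rightarrow> 'o \<Rightarrow> 'm set"
  Id :: "'o \<Rightarrow> 'm"
  Comp :: "'m \<Rightarrow> 'm \<Rightarrow> 'm" (infixr "\<cdot>\<index>" 70)
  scal :: "'k \<Rightarrow> 'm \<Rightarrow> 'm"

record ('o, 'm, 'k) monoidal_cat = "('o, 'm, 'k) linear_cat" +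
  Unit :: 'o
  tensor_ob :: "'o \<Rightarrow> 'o \<Rightarrow> 'o" (infixr "\<boxtimes>\<index>" 75)
  tensor_mor :: "'m \<Rightarrow> 'm \<Rightarrow> 'm" (infixr "\<boxdot>\<index>" 75)
  associator :: "'o \<Rightarrow> 'o \<Rightarrow> 'o \<Rightarrow> 'm"
  lunitor :: "'o \<Rightarrow> 'm"
  runitor :: "'o \<Rightarrow> 'm"

record ('o, 'm, 'k) rigid_cat = "('o, 'm, 'k) monoidal_cat" +
  dual :: "'o \<Rightarrow> 'o"
  ev :: "'o \<Rightarrow> 'm"
  coev :: "'o \<Rightarrow> 'm"

record ('o, 'm, 'k) ribbon_cat = "('o, 'm, 'k) rigid_cat" +
  braiding :: "'o \<Rightarrow> 'o \<Rightarrow> 'm"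
  twist :: "'o \<Rightarrow> 'm"


section \<open>Linear and abelian categories\<close>

context
  fixes C :: "('o, 'm::ab_group_add, 'k::field, 'x) linear_cat_scheme" (structure)
begin

definition is_iso :: "'o \<Rightarrow> 'o \<Rightarrow> 'm \<Rightarrow> bool" where
  "is_iso X Y f \<longleftrightarrow> f \<in> Hom C X Y \<and> (\<exists>g\<in>Hom C Y X. g \<cdot> f = Id C X \<and> f \<cdot> g = Id C Y)"

definition inverse_mor :: "'o \<Rightarrow> 'o \<Rightarrow> 'm \<Rightarrow> 'm" where
  "inverse_mor X Y f = (THE g. g \<in> Hom C Y X \<and> g \<cdot> f = Id C X \<and> f \<cdot> g = Id C Y)"

definition isomorphic :: "'o \<Rightarrow> 'o \<Rightarrow> bool" where
  "isomorphic X Y \<longleftrightarrow> (\<exists>f. is_iso X Y f)"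

definition is_mono :: "'o \<Rightarrow> 'o \<Rightarrow> 'm \<Rightarrow> bool" where
  "is_mono X Y f \<longleftrightarrow> f \<in> Hom C X Y \<and>
     (\<forall>W\<in>Ob C. \<forall>g\<in>Hom C W X. \<forall>h\<in>Hom C W X. f \<cdot> g = f \<cdot> h \<longrightarrow> g = h)"

definition is_epi :: "'o \<Rightarrow> 'o \<Rightarrow> 'm \<Rightarrow> bool" where
  "is_epi X Y f \<longleftrightarrow> f \<in> Hom C X Y \<and>
     (\<forall>W\<in>Ob C. \<forall>g\<in>Hom C Y W. \<forall>h\<in>Hom C Y W. g \<cdot> f = h \<cdot> f \<longrightarrow> g = h)"

definition subobject :: "'o \<Rightarrow> 'o \<Rightarrow> bool" where
  "subobject Z X \<longleftrightarrow> Z \<in> Ob C \<and> (\<exists>m. is_mono Z X m)"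

(* k : K -> X is a kernel of f : X -> Y *)
definition is_kernel :: "'o \<Rightarrow> 'o \<Rightarrow> 'm \<Rightarrow> 'o \<Rightarrow> 'm \<Rightarrow> bool" where
  "is_kernel X Y f K k \<longleftrightarrow> K \<in> Ob C \<and> k \<in> Hom C K X \<and> f \<cdot> k = 0 \<and>
     (\<forall>W\<in>Ob C. \<forall>g\<in>Hom C W X. f \<cdot> g = 0 \<longrightarrow> (\<exists>!h. h \<in> Hom C W K \<and> k \<cdot> h = g))"

(* q : Y -> Q is a cokernel of f : X -> Y *)
definition is_cokernel :: "'o \<Rightarrow> 'o \<Rightarrow> 'm \<Rightarrow> 'o \<Rightarrow> 'm \<Rightarrow> bool" where
  "is_cokernel X Y f Q q \<longleftrightarrow> Q \<in> Ob C \<and> q \<in> Hom C Y Q \<and> q \<cdot> f = 0 \<and>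
     (\<forall>W\<in>Ob C. \<forall>g\<in>Hom C Y W. g \<cdot> f = 0 \<longrightarrow> (\<exists>!h. h \<in> Hom C Q W \<and> h \<cdot> q = g))"

(* X is the direct sum of S 0, ..., S (n - 1); for n = 0 this says that X is a zero object *)
definition is_direct_sum :: "nat \<Rightarrow> (nat \<Rightarrow> 'o) \<Rightarrow> 'o \<Rightarrow> bool" where
  "is_direct_sum n S X \<longleftrightarrow> X \<in> Ob C \<and> (\<forall>i<n. S i \<in> Ob C) \<and>
     (\<exists>inj prj. (\<forall>i<n. inj i \<in> Hom C (S i) X \<and> prj i \<in> Hom C X (S i)) \<and>
        (\<forall>i<n. \<forall>j<n. prj i \<cdot> inj j = (if i = j then Id C (S i) else 0)) \<and>
        (\<Sum>i<n. inj i \<cdot> prj i) = Id C X)"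

definition simple_ob :: "'o \<Rightarrow> bool" where
  "simple_ob X \<longleftrightarrow> X \<in> Ob C \<and> Id C X \<noteq> 0 \<and>
     (\<forall>Y\<in>Ob C. \<forall>m. is_mono Y X m \<longrightarrow> Id C Y = 0 \<or> is_iso Y X m)"

(* a chosen set of representatives of the isomorphism classes of simple objects, i.e. the
   family of the X_i for i in the index set *)
definition Irr :: "'o set" where
  "Irr = (SOME I. I \<subseteq> Collect simple_ob \<and>
     (\<forall>X. simple_ob X \<longrightarrow> (\<exists>!Y. Y \<in> I \<and> isomorphic X Y)))"

(* the multiplicity [Y : X] of the simple object X in Y *)
definition multiplicity :: "'o \<Rightarrow> 'o \<Rightarrow> nat" where
  "multiplicity X Y = vector_space.dim (scal C) (Hom C X Y)"

end

locale linear_category =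
  fixes C :: "('o, 'm::ab_group_add, 'k::field, 'x) linear_cat_scheme" (structure)
  assumes vector_space_scal: "vector_space (scal C)"
    and subspace_Hom: "\<lbrakk>X \<in> Ob C; Y \<in> Ob C\<rbrakk> \<Longrightarrow> module.subspace (scal C) (Hom C X Y)"
    and Id_Hom: "X \<in> Ob C \<Longrightarrow> Id C X \<in> Hom C X X"
    and Comp_Hom: "\<lbrakk>X \<in> Ob C; Y \<in> Ob C; Z \<in> Ob C; f \<in> Hom C X Y; g \<in> Hom C Y Z\<rbrakk>
      \<Longrightarrow> g \<cdot> f \<in> Hom C X Z"
    and Comp_Id: "\<lbrakk>X \<in> Ob C; Y \<in> Ob C; f \<in> Hom C X Y\<rbrakk> \<Longrightarrow> f \<cdot> Id C X = f"
    and Id_Comp: "\<lbrakk>X \<in> Ob C; Y \<in> Ob C; f \<in> Hom C X Y\<rbrakk> \<Longrightarrow> Id C Y \<cdot> f = f"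
    and Comp_assoc: "\<lbrakk>W \<in> Ob C; X \<in> Ob C; Y \<in> Ob C; Z \<in> Ob C;
        f \<in> Hom C W X; g \<in> Hom C X Y; h \<in> Hom C Y Z\<rbrakk> \<Longrightarrow> (h \<cdot> g) \<cdot> f = h \<cdot> (g \<cdot> f)"
    and Comp_add_left: "\<lbrakk>X \<in> Ob C; Y \<in> Ob C; Z \<in> Ob C;
        f \<in> Hom C X Y; g \<in> Hom C Y Z; g' \<in> Hom C Y Z\<rbrakk> \<Longrightarrow> (g + g') \<cdot> f = g \<cdot> f + g' \<cdot> f"
    and Comp_add_right: "\<lbrakk>X \<in> Ob C; Y \<in> Ob C; Z \<in> Ob C;
        f \<in> Hom C X Y; f' \<in> Hom C X Y; g \<in> Hom C Y Z\<rbrakk> \<Longrightarrow> g \<cdot> (f + f') = g \<cdot> f + g \<cdot> f'"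
    and Comp_scal_left: "\<lbrakk>X \<in> Ob C; Y \<in> Ob C; Z \<in> Ob C; f \<in> Hom C X Y; g \<in> Hom C Y Z\<rbrakk>
      \<Longrightarrow> scal C a g \<cdot> f = scal C a (g \<cdot> f)"
    and Comp_scal_right: "\<lbrakk>X \<in> Ob C; Y \<in> Ob C; Z \<in> Ob C; f \<in> Hom C X Y; g \<in> Hom C Y Z\<rbrakk>
      \<Longrightarrow> g \<cdot> scal C a f = scal C a (g \<cdot> f)"

locale abelian_category = linear_category +
  assumes direct_sum_exists: "(\<forall>i<n. S i \<in> Ob C) \<Longrightarrow> \<exists>X. is_direct_sum C n S X"
    and kernel_exists: "\<lbrakk>X \<in> Ob C; Y \<in> Ob C; f \<in> Hom C X Y\<rbrakk> \<Longrightarrow> \<exists>K k. is_kernel C X Y f K k"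
    and cokernel_exists: "\<lbrakk>X \<in> Ob C; Y \<in> Ob C; f \<in> Hom C X Y\<rbrakk> \<Longrightarrow> \<exists>Q q. is_cokernel C X Y f Q q"
    and mono_normal: "\<lbrakk>K \<in> Ob C; X \<in> Ob C; is_mono C K X k\<rbrakk>
      \<Longrightarrow> \<exists>Y\<in>Ob C. \<exists>f\<in>Hom C X Y. is_kernel C X Y f K k"
    and epi_normal: "\<lbrakk>Y \<in> Ob C; Q \<in> Ob C; is_epi C Y Q q\<rbrakk>
      \<Longrightarrow> \<exists>X\<in>Ob C. \<exists>f\<in>Hom C X Y. is_cokernel C X Y f Q q"

locale semisimple_category = abelian_category +
  assumes semisimple: "X \<in> Ob C \<Longrightarrow> \<exists>n S. (\<forall>i<n. simple_ob C (S i)) \<and> is_direct_sum C n S X"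


section \<open>Rigid monoidal categories\<close>

locale linear_monoidal_category = linear_category C
  for C :: "('o, 'm::ab_group_add, 'k::field, 'x) monoidal_cat_scheme" (structure) +
  assumes Unit_Ob: "Unit C \<in> Ob C"
    and tensor_Ob: "\<lbrakk>X \<in> Ob C; Y \<in> Ob C\<rbrakk> \<Longrightarrow> X \<boxtimes> Y \<in> Ob C"
    and tensor_Hom: "\<lbrakk>X \<in> Ob C; X' \<in> Ob C; Y \<in> Ob C; Y' \<in> Ob C; f \<in> Hom C X X'; g \<in> Hom C Y Y'\<rbrakk>
      \<Longrightarrow> f \<boxdot> g \<in> Hom C (X \<boxtimes> Y) (X' \<boxtimes> Y')"
    and tensor_Id: "\<lbrakk>X \<in> Ob C; Y \<in> Ob C\<rbrakk> \<Longrightarrow> Id C X \<boxdot> Id C Y = Id C (X \<boxtimes> Y)"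
    and tensor_Comp: "\<lbrakk>X \<in> Ob C; X' \<in> Ob C; X'' \<in> Ob C; Y \<in> Ob C; Y' \<in> Ob C; Y'' \<in> Ob C;
        f \<in> Hom C X X'; f' \<in> Hom C X' X''; g \<in> Hom C Y Y'; g' \<in> Hom C Y' Y''\<rbrakk>
      \<Longrightarrow> (f' \<cdot> f) \<boxdot> (g' \<cdot> g) = (f' \<boxdot> g') \<cdot> (f \<boxdot> g)"
    and tensor_add_left: "\<lbrakk>X \<in> Ob C; X' \<in> Ob C; Y \<in> Ob C; Y' \<in> Ob C;
        f \<in> Hom C X X'; f' \<in> Hom C X X'; g \<in> Hom C Y Y'\<rbrakk> \<Longrightarrow> (f + f') \<boxdot> g = f \<boxdot> g + f' \<boxdot> g"
    and tensor_add_right: "\<lbrakk>X \<in> Ob C; X' \<in> Ob C; Y \<in> Ob C; Y' \<in> Ob C;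
        f \<in> Hom C X X'; g \<in> Hom C Y Y'; g' \<in> Hom C Y Y'\<rbrakk> \<Longrightarrow> f \<boxdot> (g + g') = f \<boxdot> g + f \<boxdot> g'"
    and tensor_scal_left: "\<lbrakk>X \<in> Ob C; X' \<in> Ob C; Y \<in> Ob C; Y' \<in> Ob C;
        f \<in> Hom C X X'; g \<in> Hom C Y Y'\<rbrakk> \<Longrightarrow> scal C a f \<boxdot> g = scal C a (f \<boxdot> g)"
    and tensor_scal_right: "\<lbrakk>X \<in> Ob C; X' \<in> Ob C; Y \<in> Ob C; Y' \<in> Ob C;
        f \<in> Hom C X X'; g \<in> Hom C Y Y'\<rbrakk> \<Longrightarrow> f \<boxdot> scal C a g = scal C a (f \<boxdot> g)"
    and associator_iso: "\<lbrakk>X \<in> Ob C; Y \<in> Ob C; Z \<in> Ob C\<rbrakk>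
      \<Longrightarrow> is_iso C ((X \<boxtimes> Y) \<boxtimes> Z) (X \<boxtimes> (Y \<boxtimes> Z)) (associator C X Y Z)"
    and associator_natural: "\<lbrakk>X \<in> Ob C; X' \<in> Ob C; Y \<in> Ob C; Y' \<in> Ob C; Z \<in> Ob C; Z' \<in> Ob C;
        f \<in> Hom C X X'; g \<in> Hom C Y Y'; h \<in> Hom C Z Z'\<rbrakk>
      \<Longrightarrow> associator C X' Y' Z' \<cdot> ((f \<boxdot> g) \<boxdot> h) = (f \<boxdot> (g \<boxdot> h)) \<cdot> associator C X Y Z"
    and lunitor_iso: "X \<in> Ob C \<Longrightarrow> is_iso C (Unit C \<boxtimes> X) X (lunitor C X)"
    and lunitor_natural: "\<lbrakk>X \<in> Ob C; Y \<in> Ob C; f \<in> Hom C X Y\<rbrakk>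
      \<Longrightarrow> lunitor C Y \<cdot> (Id C (Unit C) \<boxdot> f) = f \<cdot> lunitor C X"
    and runitor_iso: "X \<in> Ob C \<Longrightarrow> is_iso C (X \<boxtimes> Unit C) X (runitor C X)"
    and runitor_natural: "\<lbrakk>X \<in> Ob C; Y \<in> Ob C; f \<in> Hom C X Y\<rbrakk>
      \<Longrightarrow> runitor C Y \<cdot> (f \<boxdot> Id C (Unit C)) = f \<cdot> runitor C X"
    and pentagon: "\<lbrakk>W \<in> Ob C; X \<in> Ob C; Y \<in> Ob C; Z \<in> Ob C\<rbrakk>
      \<Longrightarrow> (Id C W \<boxdot> associator C X Y Z) \<cdot> associator C W (X \<boxtimes> Y) Z \<cdot> (associator C W X Y \<boxdot> Id C Z)
        = associator C W X (Y \<boxtimes> Z) \<cdot> associator C (W \<boxtimes> X) Y Z"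
    and triangle: "\<lbrakk>X \<in> Ob C; Y \<in> Ob C\<rbrakk>
      \<Longrightarrow> (Id C X \<boxdot> lunitor C Y) \<cdot> associator C X (Unit C) Y = runitor C X \<boxdot> Id C Y"

definition inv_associator ::
  "('o, 'm::ab_group_add, 'k::field, 'x) monoidal_cat_scheme \<Rightarrow> 'o \<Rightarrow> 'o \<Rightarrow> 'o \<Rightarrow> 'm" where
  "inv_associator C X Y Z =
     inverse_mor C ((X \<boxtimes>\<^bsub>C\<^esub> Y) \<boxtimes>\<^bsub>C\<^esub> Z) (X \<boxtimes>\<^bsub>C\<^esub> (Y \<boxtimes>\<^bsub>C\<^esub> Z)) (associator C X Y Z)"

(* D is a left dual of X with e : D (x) X -> 1 and c : 1 -> X (x) D; equivalently, X is a
   right dual of D *)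
definition is_left_dual ::
  "('o, 'm::ab_group_add, 'k::field, 'x) monoidal_cat_scheme \<Rightarrow> 'o \<Rightarrow> 'o \<Rightarrow> 'm \<Rightarrow> 'm \<Rightarrow> bool" where
  "is_left_dual C X D e c \<longleftrightarrow> D \<in> Ob C \<and>
     e \<in> Hom C (D \<boxtimes>\<^bsub>C\<^esub> X) (Unit C) \<and> c \<in> Hom C (Unit C) (X \<boxtimes>\<^bsub>C\<^esub> D) \<and>
     runitor C X \<cdot>\<^bsub>C\<^esub> (Id C X \<boxdot>\<^bsub>C\<^esub> e) \<cdot>\<^bsub>C\<^esub> associator C X D X \<cdot>\<^bsub>C\<^esub> (c \<boxdot>\<^bsub>C\<^esub> Id C X) = lunitor C X \<and>
     lunitor C D \<cdot>\<^bsub>C\<^esub> (e \<boxdot>\<^bsub>C\<^esub> Id C D) \<cdot>\<^bsub>C\<^esub> inv_associator C D X D \<cdot>\<^bsub>C\<^esub> (Id C D \<boxdot>\<^bsub>C\<^esub> c) = runitor C D"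

locale rigid_monoidal_category = linear_monoidal_category C
  for C :: "('o, 'm::ab_group_add, 'k::field, 'x) rigid_cat_scheme" (structure) +
  assumes left_dual: "X \<in> Ob C \<Longrightarrow> is_left_dual C X (dual C X) (ev C X) (coev C X)"
    and right_dual_exists: "X \<in> Ob C \<Longrightarrow> \<exists>D\<in>Ob C. \<exists>e c. is_left_dual C D X e c"

locale fusion_category = rigid_monoidal_category C + semisimple_category C
  for C :: "('o, 'm::ab_group_add, 'k::{alg_closed_field,field_char_0}, 'x) rigid_cat_scheme"
    (structure) +
  assumes finite_Irr: "finite (Irr C)"
    and Hom_finite_dim: "\<lbrakk>X \<in> Ob C; Y \<in> Ob C\<rbrakk>
      \<Longrightarrow> \<exists>B. finite B \<and> Hom C X Y = module.span (scal C) B"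
    and Unit_simple: "simple_ob C (Unit C)"


section \<open>The Grothendieck ring and Frobenius-Perron dimensions\<close>

(* An element is given by its coordinates in the basis of the classes of the simple objects; the
   structure constants are the multiplicities of Z in X (x) Y. *)
definition K0 :: "('o, 'm::ab_group_add, 'k::field, 'x) monoidal_cat_scheme \<Rightarrow> ('o \<Rightarrow> int) ring" where
  "K0 C = \<lparr> carrier = {a. \<forall>Z. Z \<notin> Irr C \<longrightarrow> a Z = 0},
     monoid.mult = (\<lambda>a b Z. if Z \<in> Irr C
       then \<Sum>X\<in>Irr C. \<Sum>Y\<in>Irr C. a X * b Y * int (multiplicity C Z (X \<boxtimes>\<^bsub>C\<^esub> Y)) else 0),
     one = (\<lambda>Z. if Z \<in> Irr C then int (multiplicity C Z (Unit C)) else 0),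
     zero = (\<lambda>_. 0),
     add = (\<lambda>a b Z. a Z + b Z) \<rparr>"

definition K0_class :: "('o, 'm::ab_group_add, 'k::field, 'x) monoidal_cat_scheme \<Rightarrow> 'o \<Rightarrow> 'o \<Rightarrow> int" where
  "K0_class C X = (\<lambda>Z. if Z \<in> Irr C then int (multiplicity C Z X) else 0)"

definition real_ring :: "real ring" where
  "real_ring = \<lparr> carrier = UNIV, monoid.mult = (*), one = 1, zero = 0, add = (+) \<rparr>"

definition FPdim :: "('o, 'm::ab_group_add, 'k::field, 'x) monoidal_cat_scheme \<Rightarrow> 'o \<Rightarrow> real" where
  "FPdim C X = (THE r. \<exists>\<phi>\<in>ring_hom (K0 C) real_ring.
     (\<forall>Y. simple_ob C Y \<longrightarrow> \<phi> (K0_class C Y) > 0) \<and> r = \<phi> (K0_class C X))"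

definition FPdim_cat :: "('o, 'm::ab_group_add, 'k::field, 'x) monoidal_cat_scheme \<Rightarrow> real" where
  "FPdim_cat C = (\<Sum>X\<in>Irr C. (FPdim C X)\<^sup>2)"


section \<open>Fusion subcategories and central series\<close>

(* Full subcategories are given by their sets of objects. Since they are closed under
   subobjects, they are replete. *)

context
  fixes C :: "('o, 'm::ab_group_add, 'k::field, 'x) rigid_cat_scheme" (structure)
begin

definition fusion_subcategory :: "'o set \<Rightarrow> bool" where
  "fusion_subcategory K \<longleftrightarrow> K \<subseteq> Ob C \<and> Unit C \<in> K \<and>
     (\<forall>X\<in>K. \<forall>Y\<in>K. X \<boxtimes> Y \<in> K) \<and>
     (\<forall>X\<in>K. dual C X \<in> K) \<and>
     (\<forall>n S X. (\<forall>i<n. S i \<in> K) \<and> is_direct_sum C n S X \<longrightarrow> X \<in> K) \<and>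
     (\<forall>X\<in>K. \<forall>Z. subobject C Z X \<longrightarrow> Z \<in> K)"

definition generated_subcategory :: "'o set \<Rightarrow> 'o set" where
  "generated_subcategory S = \<Inter> {K. fusion_subcategory K \<and> S \<subseteq> K}"

definition Vec_subcategory :: "'o set" where
  "Vec_subcategory = generated_subcategory {Unit C}"

definition invertible_ob :: "'o \<Rightarrow> bool" where
  "invertible_ob X \<longleftrightarrow> X \<in> Ob C \<and>
     (\<exists>Y\<in>Ob C. isomorphic C (X \<boxtimes> Y) (Unit C) \<and> isomorphic C (Y \<boxtimes> X) (Unit C))"

definition pointed_subcategory :: "'o set" where
  "pointed_subcategory = generated_subcategory {X. invertible_ob X}"

definition adjoint_subcategory :: "'o set \<Rightarrow> 'o set" where
  "adjoint_subcategory K = generated_subcategory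
     {Z. \<exists>X\<in>K. simple_ob C X \<and> subobject C Z (X \<boxtimes> dual C X)}"

definition commutator_subcategory :: "'o set \<Rightarrow> 'o set" where
  "commutator_subcategory K = generated_subcategory {Y. simple_ob C Y \<and> Y \<boxtimes> dual C Y \<in> K}"

fun upper_central_series :: "nat \<Rightarrow> 'o set" where
  "upper_central_series 0 = Ob C"
| "upper_central_series (Suc n) = adjoint_subcategory (upper_central_series n)"

fun lower_central_series :: "nat \<Rightarrow> 'o set" where
  "lower_central_series 0 = Vec_subcategory"
| "lower_central_series (Suc 0) = pointed_subcategory"
| "lower_central_series (Suc (Suc n)) = commutator_subcategory (lower_central_series (Suc n))"

(* the transpose Y* -> X* of f : X -> Y *)
definition dual_mor :: "'o \<Rightarrow> 'o \<Rightarrow> 'm \<Rightarrow> 'm" where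
  "dual_mor X Y f = lunitor C (dual C X) \<cdot> (ev C Y \<boxdot> Id C (dual C X))
     \<cdot> ((Id C (dual C Y) \<boxdot> f) \<boxdot> Id C (dual C X)) \<cdot> inv_associator C (dual C Y) X (dual C X)
     \<cdot> (Id C (dual C Y) \<boxdot> coev C X)
     \<cdot> inverse_mor C (dual C Y \<boxtimes> Unit C) (dual C Y) (runitor C (dual C Y))"

end


section \<open>Modular categories\<close>

locale braided_fusion_category = fusion_category C
  for C :: "('o, 'm::ab_group_add, 'k::{alg_closed_field,field_char_0}, 'x) ribbon_cat_scheme"
    (structure) +
  assumes braiding_iso: "\<lbrakk>X \<in> Ob C; Y \<in> Ob C\<rbrakk> \<Longrightarrow> is_iso C (X \<boxtimes> Y) (Y \<boxtimes> X) (braiding C X Y)"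
    and braiding_natural: "\<lbrakk>X \<in> Ob C; X' \<in> Ob C; Y \<in> Ob C; Y' \<in> Ob C;
        f \<in> Hom C X X'; g \<in> Hom C Y Y'\<rbrakk>
      \<Longrightarrow> braiding C X' Y' \<cdot> (f \<boxdot> g) = (g \<boxdot> f) \<cdot> braiding C X Y"
    and hexagon1: "\<lbrakk>X \<in> Ob C; Y \<in> Ob C; Z \<in> Ob C\<rbrakk>
      \<Longrightarrow> associator C Y Z X \<cdot> braiding C X (Y \<boxtimes> Z) \<cdot> associator C X Y Z
        = (Id C Y \<boxdot> braiding C X Z) \<cdot> associator C Y X Z \<cdot> (braiding C X Y \<boxdot> Id C Z)"
    and hexagon2: "\<lbrakk>X \<in> Ob C; Y \<in> Ob C; Z \<in> Ob C\<rbrakk>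
      \<Longrightarrow> inv_associator C Z X Y \<cdot> braiding C (X \<boxtimes> Y) Z \<cdot> inv_associator C X Y Z
        = (braiding C X Z \<boxdot> Id C Y) \<cdot> inv_associator C X Z Y \<cdot> (Id C X \<boxdot> braiding C Y Z)"

locale ribbon_fusion_category = braided_fusion_category +
  assumes twist_iso: "X \<in> Ob C \<Longrightarrow> is_iso C X X (twist C X)"
    and twist_natural: "\<lbrakk>X \<in> Ob C; Y \<in> Ob C; f \<in> Hom C X Y\<rbrakk> \<Longrightarrow> twist C Y \<cdot> f = f \<cdot> twist C X"
    and balancing: "\<lbrakk>X \<in> Ob C; Y \<in> Ob C\<rbrakk>
      \<Longrightarrow> twist C (X \<boxtimes> Y) = (twist C X \<boxdot> twist C Y) \<cdot> braiding C Y X \<cdot> braiding C X Y"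
    and twist_dual: "X \<in> Ob C \<Longrightarrow> twist C (dual C X) = dual_mor C X X (twist C X)"

context
  fixes C :: "('o, 'm::ab_group_add, 'k::field, 'x) ribbon_cat_scheme" (structure)
begin

(* The spherical structure of a ribbon category is the composition of the twist with the Drinfeld
   isomorphism X -> X**; expressing the latter by the braiding, the quantum trace of f : X -> X is
     1 -> X (x) X* -> X (x) X* -> X* (x) X -> 1,
   an endomorphism of 1, which is identified with a scalar. *)
definition quantum_trace :: "'o \<Rightarrow> 'm \<Rightarrow> 'k" where
  "quantum_trace X f = (THE a. scal C a (Id C (Unit C)) =
     ev C X \<cdot> braiding C X (dual C X) \<cdot> ((twist C X \<cdot> f) \<boxdot> Id C (dual C X)) \<cdot> coev C X)"

definition cat_dim :: "'o \<Rightarrow> 'k" where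
  "cat_dim X = quantum_trace X (Id C X)"

definition S_entry :: "'o \<Rightarrow> 'o \<Rightarrow> 'k" where
  "S_entry X Y = quantum_trace (Y \<boxtimes> X) (braiding C X Y \<cdot> braiding C Y X)"

definition global_dim :: 'k where
  "global_dim = (\<Sum>X\<in>Irr C. (cat_dim X)\<^sup>2)"

definition centralizer :: "'o set \<Rightarrow> 'o set" where
  "centralizer K = generated_subcategory C {X. simple_ob C X \<and>
     (\<forall>Y\<in>K. simple_ob C Y \<longrightarrow> S_entry X Y = cat_dim X * cat_dim Y)}"

end

(* Non-degeneracy of the S-matrix: it has an inverse matrix T (both are square matrices indexed
   by the finite set Irr C). *)
locale modular_category = ribbon_fusion_category +
  assumes S_nondegenerate: "\<exists>T. \<forall>X\<in>Irr C. \<forall>Y\<in>Irr C.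
     (\<Sum>Z\<in>Irr C. S_entry C X Z * T Z Y) = (if X = Y then 1 else 0)"

(* Numbers attached to C are algebraic over the rationals and are regarded as complex numbers by
   means of an embedding of the field of algebraic elements of k. Values of \<iota> at other elements
   are irrelevant. Every embedding of a cyclotomic subfield of k extends to such an \<iota>. *)
definition algebraic_embedding :: "('k::field_char_0 \<Rightarrow> complex) \<Rightarrow> bool" where
  "algebraic_embedding \<iota> \<longleftrightarrow> \<iota> 1 = 1 \<and>
     (\<forall>x y. algebraic x \<and> algebraic y \<longrightarrow> \<iota> (x + y) = \<iota> x + \<iota> y \<and> \<iota> (x * y) = \<iota> x * \<iota> y)"

(* Pseudounitarity and the canonical spherical structure both refer to \<iota>: Galois conjugates of
   a pseudounitary category need not be pseudounitary. *)
locale pseudounitary_modular_category = modular_category C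
  for C :: "('o, 'm::ab_group_add, 'k::{alg_closed_field,field_char_0}, 'x) ribbon_cat_scheme"
    (structure)
    and \<iota> :: "'k \<Rightarrow> complex" +
  assumes embedding: "algebraic_embedding \<iota>"
    and pseudounitary: "\<iota> (global_dim C) = of_real (FPdim_cat C)"
    and canonical_spherical: "simple_ob C X \<Longrightarrow> \<iota> (cat_dim C X) = of_real (FPdim C X)"

end

(* The arrows of C are studied through the endofunctors A (x) -, where A is a product of a list of
   objects: composition of endofunctors is strictly associative, so the natural transformations
   between them that commute with tensoring from the right form a strict braided category in which
   the graphical calculus can be carried out by rewriting. There one proves that the partial trace
   over X (x) Z is the partial trace over X followed by the one over Z. Encircling a simple object Y
   by X gives a scalar chi_Y(X) = s_XY / d_Y, which is therefore additive and multiplicative in X.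

   The values of the characters chi_Y and d are algebraic, and after applying the embedding they
   satisfy |chi_Y(X)| <= d_X (Perron-Frobenius) and chi_Y(X* ) = cnj (chi_Y(X)) (Frobenius
   reciprocity). Hence Y centralizes X (x) X* iff |s_XY| = d_X d_Y. This condition is symmetric in X
   and Y, which gives (K_ad)' = (K')^co for every K; nondegeneracy of S gives C' = Vec, and the
   theorem follows by induction. *)

theory Submission
  imports Defs "HOL-Library.FuncSet"
begin

section \<open>Arrows with source and target\<close>

text \<open>Two obstacles shape the argument. Since \<open>k\<close> is an abstract field, absolute
  values, conjugation and positivity exist only after applying \<open>\<iota>\<close>, and
  \<open>\<iota>\<close> is controlled on algebraic elements only. Every number to be compared is
  therefore exhibited as a value of a character of the Grothendieck ring. Such values are algebraic,
  because the finitely many values on simple objects span a finite-dimensional rational space stable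
  under multiplication by them. The other obstacle is that the chosen dual of
  \<open>X \<boxtimes> Z\<close> is unrelated to the reversed product of the chosen duals.
  Multiplicativity of traces thus means comparing one loop with two nested ones, and here balancing
  of the twist is essential. The induction also has to bridge a seam: the lower series starts afresh
  at index 1 with the pointed subcategory, which must be identified with the commutator of Vec. Both
  inclusions are about invertibility: one counts unit summands by Frobenius reciprocity, the other
  is the equality case of the bound on characters.\<close>

definition src :: "'o \<times> 'm \<times> 'o \<Rightarrow> 'o" where "src p = fst p"
definition mid :: "'o \<times> 'm \<times> 'o \<Rightarrow> 'm" where "mid p = fst (snd p)"
definition tgt :: "'o \<times> 'm \<times> 'o \<Rightarrow> 'o" where "tgt p = snd (snd p)"

lemma src_mid_tgt [simp]: "src (A, f, B) = A" "mid (A, f, B) = f" "tgt (A, f, B) = B"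
  by (simp_all add: src_def mid_def tgt_def)

lemma src_mid_tgt_eqI: "\<lbrakk>src p = src q; mid p = mid q; tgt p = tgt q\<rbrakk> \<Longrightarrow> p = q"
  by (cases p; cases q) simp

context linear_category
begin

sublocale V: vector_space "scal C"
  by (rule vector_space_scal)

lemma inverse_mor_eq:
  assumes "A \<in> Ob C" "B \<in> Ob C" "f \<in> Hom C A B" "g \<in> Hom C B A" "g \<cdot> f = Id C A" "f \<cdot> g = Id C B"
  shows "inverse_mor C A B f = g"
  unfolding inverse_mor_def
proof (rule the_equality)
  fix h assume h: "h \<in> Hom C B A \<and> h \<cdot> f = Id C A \<and> f \<cdot> h = Id C B"
  have "h = (h \<cdot> f) \<cdot> g"
    using Comp_assoc[of B A B A g f h] Comp_Id[of B A h] assms h by simp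
  then show "h = g" using h Id_Comp[of B A g] assms by simp
qed (use assms in auto)

lemma inverse_mor_props:
  assumes "A \<in> Ob C" "B \<in> Ob C" "is_iso C A B f"
  shows "inverse_mor C A B f \<in> Hom C B A" "inverse_mor C A B f \<cdot> f = Id C A"
    "f \<cdot> inverse_mor C A B f = Id C B"
proof -
  obtain g where "f \<in> Hom C A B" "g \<in> Hom C B A" "g \<cdot> f = Id C A" "f \<cdot> g = Id C B"
    using assms(3) unfolding is_iso_def by auto
  moreover from this have "inverse_mor C A B f = g"
    by (intro inverse_mor_eq assms)
  ultimately show "inverse_mor C A B f \<in> Hom C B A" "inverse_mor C A B f \<cdot> f = Id C A"
    "f \<cdot> inverse_mor C A B f = Id C B" by auto
qed

text \<open>An element of \<open>'m\<close> does not determine its type, as Hom sets may overlap.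
  Carrying both ends along turns composability into an equation between objects, which
  \<open>simp\<close> can decide.\<close>

definition isarr :: "'o \<times> 'm \<times> 'o \<Rightarrow> bool" where
  "isarr p \<longleftrightarrow> src p \<in> Ob C \<and> tgt p \<in> Ob C \<and> mid p \<in> Hom C (src p) (tgt p)"

definition ident :: "'o \<Rightarrow> 'o \<times> 'm \<times> 'o" where
  "ident A = (A, Id C A, A)"

definition cmp :: "'o \<times> 'm \<times> 'o \<Rightarrow> 'o \<times> 'm \<times> 'o \<Rightarrow> 'o \<times> 'm \<times> 'o" (infixr "\<star>" 70) where
  "q \<star> p = (src p, mid q \<cdot> mid p, tgt q)"

definition smul :: "'k \<Rightarrow> 'o \<times> 'm \<times> 'o \<Rightarrow> 'o \<times> 'm \<times> 'o" where
  "smul a p = (src p, scal C a (mid p), tgt p)"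

lemma isarr_Ob [simp]: "isarr p \<Longrightarrow> src p \<in> Ob C" "isarr p \<Longrightarrow> tgt p \<in> Ob C"
  by (simp_all add: isarr_def)

lemma isarr_triple: "isarr (A, f, B) \<longleftrightarrow> A \<in> Ob C \<and> B \<in> Ob C \<and> f \<in> Hom C A B"
  by (simp add: isarr_def del: isarr_Ob)

lemma ident_simps [simp]:
  "src (ident A) = A" "tgt (ident A) = A" "mid (ident A) = Id C A" "isarr (ident A) \<longleftrightarrow> A \<in> Ob C"
  using Id_Hom by (auto simp: ident_def isarr_triple)

lemma cmp_simps [simp]:
  "src (q \<star> p) = src p" "tgt (q \<star> p) = tgt q" "mid (q \<star> p) = mid q \<cdot> mid p"
  by (simp_all add: cmp_def)

lemma isarr_cmp [simp]: "\<lbrakk>isarr p; isarr q; src q = tgt p\<rbrakk> \<Longrightarrow> isarr (q \<star> p)"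
  using Comp_Hom[of "src p" "tgt p" "tgt q" "mid p" "mid q"] by (simp add: isarr_def del: isarr_Ob)

lemma cmp_assoc [simp]:
  "\<lbrakk>isarr p; isarr q; isarr r; src q = tgt p; src r = tgt q\<rbrakk> \<Longrightarrow> (r \<star> q) \<star> p = r \<star> (q \<star> p)"
  using Comp_assoc[of "src p" "tgt p" "tgt q" "tgt r" "mid p" "mid q" "mid r"]
  by (intro src_mid_tgt_eqI) (simp_all add: isarr_def del: isarr_Ob)

text \<open>Composites are normalized by bracketing to the right, where the left side of
  \<open>q \<star> p = s\<close> need not be a subterm; with a tail \<open>r\<close> attached it
  is.\<close>

lemma cmp_reassoc:
  "\<lbrakk>q \<star> p = s; isarr p; isarr q; isarr r; src p = tgt r; src q = tgt p\<rbrakk> \<Longrightarrow> q \<star> (p \<star> r) = s \<star> r"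
  using cmp_assoc by metis

lemma cmp_ident [simp]:
  "\<lbrakk>isarr p; src p = A\<rbrakk> \<Longrightarrow> p \<star> ident A = p" "\<lbrakk>isarr p; tgt p = A\<rbrakk> \<Longrightarrow> ident A \<star> p = p"
  using Comp_Id[of "src p" "tgt p" "mid p"] Id_Comp[of "src p" "tgt p" "mid p"]
  by (auto intro!: src_mid_tgt_eqI simp: isarr_def simp del: isarr_Ob)

lemma smul_simps [simp]:
  "src (smul a p) = src p" "tgt (smul a p) = tgt p" "mid (smul a p) = scal C a (mid p)"
  by (simp_all add: smul_def)

lemma scal_Hom: "\<lbrakk>A \<in> Ob C; B \<in> Ob C; f \<in> Hom C A B\<rbrakk> \<Longrightarrow> scal C a f \<in> Hom C A B"
  using subspace_Hom[of A B] V.subspace_scale by blast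

lemma isarr_smul [simp]: "isarr p \<Longrightarrow> isarr (smul a p)"
  using scal_Hom by (simp add: isarr_def del: isarr_Ob)

lemma smul_cmp [simp]:
  "\<lbrakk>isarr p; isarr q; src q = tgt p\<rbrakk> \<Longrightarrow> smul a q \<star> p = smul a (q \<star> p)"
  "\<lbrakk>isarr p; isarr q; src q = tgt p\<rbrakk> \<Longrightarrow> q \<star> smul a p = smul a (q \<star> p)"
  using Comp_scal_left[of "src p" "tgt p" "tgt q" "mid p" "mid q"]
    Comp_scal_right[of "src p" "tgt p" "tgt q" "mid p" "mid q"]
  by (auto intro!: src_mid_tgt_eqI simp: isarr_def simp del: isarr_Ob)

text \<open>A split epimorphism \<open>r\<close> with section \<open>s\<close> can be cancelled; in
  its uses \<open>r\<close> is built from invertible constraints.\<close>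

lemma cmp_cancel_right:
  assumes "isarr p" "isarr q" "isarr s" "isarr r" "src r = tgt s" "r \<star> s = ident A" "tgt r = A"
    "src p = A" "src q = A" "p \<star> r = q \<star> r"
  shows "p = q"
proof -
  have "p = p \<star> (r \<star> s)" using assms by simp
  also have "\<dots> = (p \<star> r) \<star> s" using assms(1-5,7-9) by simp
  also have "\<dots> = (q \<star> r) \<star> s" using assms by simp
  also have "\<dots> = q \<star> (r \<star> s)" using assms(1-5,7-9) by simp
  also have "\<dots> = q" using assms by simp
  finally show ?thesis .
qed

end

section \<open>Structure isomorphisms as arrows, and a derived unit identity\<close>

context linear_monoidal_category
begin

definition tens :: "'o \<times> 'm \<times> 'o \<Rightarrow> 'o \<times> 'm \<times> 'o \<Rightarrow> 'o \<times> 'm \<times> 'o" (infixr "\<bowtie>" 75) where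
  "p \<bowtie> q = (src p \<boxtimes> src q, mid p \<boxdot> mid q, tgt p \<boxtimes> tgt q)"

definition asso :: "'o \<Rightarrow> 'o \<Rightarrow> 'o \<Rightarrow> 'o \<times> 'm \<times> 'o" where
  "asso X Y Z = ((X \<boxtimes> Y) \<boxtimes> Z, associator C X Y Z, X \<boxtimes> (Y \<boxtimes> Z))"
definition asso_inv :: "'o \<Rightarrow> 'o \<Rightarrow> 'o \<Rightarrow> 'o \<times> 'm \<times> 'o" where
  "asso_inv X Y Z = (X \<boxtimes> (Y \<boxtimes> Z), inv_associator C X Y Z, (X \<boxtimes> Y) \<boxtimes> Z)"
definition lun :: "'o \<Rightarrow> 'o \<times> 'm \<times> 'o" where
  "lun X = (Unit C \<boxtimes> X, lunitor C X, X)"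
definition lun_inv :: "'o \<Rightarrow> 'o \<times> 'm \<times> 'o" where
  "lun_inv X = (X, inverse_mor C (Unit C \<boxtimes> X) X (lunitor C X), Unit C \<boxtimes> X)"
definition run :: "'o \<Rightarrow> 'o \<times> 'm \<times> 'o" where
  "run X = (X \<boxtimes> Unit C, runitor C X, X)"
definition run_inv :: "'o \<Rightarrow> 'o \<times> 'm \<times> 'o" where
  "run_inv X = (X, inverse_mor C (X \<boxtimes> Unit C) X (runitor C X), X \<boxtimes> Unit C)"

declare Unit_Ob [simp] tensor_Ob [simp]

lemma structure_simps [simp]:
  "src (p \<bowtie> q) = src p \<boxtimes> src q" "tgt (p \<bowtie> q) = tgt p \<boxtimes> tgt q" "mid (p \<bowtie> q) = mid p \<boxdot> mid q"
  "src (asso X Y Z) = (X \<boxtimes> Y) \<boxtimes> Z" "tgt (asso X Y Z) = X \<boxtimes> (Y \<boxtimes> Z)" "mid (asso X Y Z) = associator C X Y Z"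
  "src (asso_inv X Y Z) = X \<boxtimes> (Y \<boxtimes> Z)" "tgt (asso_inv X Y Z) = (X \<boxtimes> Y) \<boxtimes> Z"
    "mid (asso_inv X Y Z) = inv_associator C X Y Z"
  "src (lun X) = Unit C \<boxtimes> X" "tgt (lun X) = X" "mid (lun X) = lunitor C X"
  "src (lun_inv X) = X" "tgt (lun_inv X) = Unit C \<boxtimes> X"
  "src (run X) = X \<boxtimes> Unit C" "tgt (run X) = X" "mid (run X) = runitor C X"
  "src (run_inv X) = X" "tgt (run_inv X) = X \<boxtimes> Unit C"
  by (simp_all add: tens_def asso_def asso_inv_def lun_def lun_inv_def run_def run_inv_def)

lemma isarr_structure [simp]:
  "\<lbrakk>isarr p; isarr q\<rbrakk> \<Longrightarrow> isarr (p \<bowtie> q)"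
  "\<lbrakk>X \<in> Ob C; Y \<in> Ob C; Z \<in> Ob C\<rbrakk> \<Longrightarrow> isarr (asso X Y Z)"
  "\<lbrakk>X \<in> Ob C; Y \<in> Ob C; Z \<in> Ob C\<rbrakk> \<Longrightarrow> isarr (asso_inv X Y Z)"
  "X \<in> Ob C \<Longrightarrow> isarr (lun X)" "X \<in> Ob C \<Longrightarrow> isarr (lun_inv X)"
  "X \<in> Ob C \<Longrightarrow> isarr (run X)" "X \<in> Ob C \<Longrightarrow> isarr (run_inv X)"
  using associator_iso[of X Y Z] lunitor_iso[of X] runitor_iso[of X]
    inverse_mor_props(1)[OF _ _ associator_iso[of X Y Z]]
    inverse_mor_props(1)[OF _ _ lunitor_iso[of X]] inverse_mor_props(1)[OF _ _ runitor_iso[of X]]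
  by (auto simp del: isarr_Ob simp: isarr_def tensor_Hom is_iso_def inv_associator_def lun_inv_def run_inv_def simp del: isarr_Ob)

lemma structure_inv [simp]:
  "\<lbrakk>X \<in> Ob C; Y \<in> Ob C; Z \<in> Ob C\<rbrakk> \<Longrightarrow> asso_inv X Y Z \<star> asso X Y Z = ident ((X \<boxtimes> Y) \<boxtimes> Z)"
  "\<lbrakk>X \<in> Ob C; Y \<in> Ob C; Z \<in> Ob C\<rbrakk> \<Longrightarrow> asso X Y Z \<star> asso_inv X Y Z = ident (X \<boxtimes> (Y \<boxtimes> Z))"
  "X \<in> Ob C \<Longrightarrow> lun_inv X \<star> lun X = ident (Unit C \<boxtimes> X)" "X \<in> Ob C \<Longrightarrow> lun X \<star> lun_inv X = ident X"
  "X \<in> Ob C \<Longrightarrow> run_inv X \<star> run X = ident (X \<boxtimes> Unit C)" "X \<in> Ob C \<Longrightarrow> run X \<star> run_inv X = ident X"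
  using inverse_mor_props(2,3)[OF _ _ associator_iso[of X Y Z]]
    inverse_mor_props(2,3)[OF _ _ lunitor_iso[of X]] inverse_mor_props(2,3)[OF _ _ runitor_iso[of X]]
  by (auto intro!: src_mid_tgt_eqI simp: inv_associator_def lun_inv_def run_inv_def simp del: isarr_Ob)

lemma tens_cmp:
  "\<lbrakk>isarr p; isarr q; src q = tgt p; isarr p'; isarr q'; src q' = tgt p'\<rbrakk>
    \<Longrightarrow> (q \<bowtie> q') \<star> (p \<bowtie> p') = (q \<star> p) \<bowtie> (q' \<star> p')"
  using tensor_Comp[of "src p" "tgt p" "tgt q" "src p'" "tgt p'" "tgt q'" "mid p" "mid q" "mid p'" "mid q'"]
  by (auto intro!: src_mid_tgt_eqI simp: isarr_def simp del: isarr_Ob)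

lemma tens_ident [simp]: "\<lbrakk>A \<in> Ob C; B \<in> Ob C\<rbrakk> \<Longrightarrow> ident A \<bowtie> ident B = ident (A \<boxtimes> B)"
  using tensor_Id[of A B] by (auto intro!: src_mid_tgt_eqI)

lemma tens_cmp_ident:
  "\<lbrakk>X \<in> Ob C; isarr p; isarr q; src q = tgt p\<rbrakk> \<Longrightarrow> ident X \<bowtie> (q \<star> p) = (ident X \<bowtie> q) \<star> (ident X \<bowtie> p)"
  "\<lbrakk>X \<in> Ob C; isarr p; isarr q; src q = tgt p\<rbrakk> \<Longrightarrow> (q \<star> p) \<bowtie> ident X = (q \<bowtie> ident X) \<star> (p \<bowtie> ident X)"
  by (simp_all add: tens_cmp)

lemma tens_smul [simp]:
  "\<lbrakk>isarr p; isarr q\<rbrakk> \<Longrightarrow> smul a p \<bowtie> q = smul a (p \<bowtie> q)"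
  "\<lbrakk>isarr p; isarr q\<rbrakk> \<Longrightarrow> p \<bowtie> smul a q = smul a (p \<bowtie> q)"
  using tensor_scal_left[of "src p" "tgt p" "src q" "tgt q" "mid p" "mid q"]
    tensor_scal_right[of "src p" "tgt p" "src q" "tgt q" "mid p" "mid q"]
  by (auto intro!: src_mid_tgt_eqI simp: isarr_def simp del: isarr_Ob)

lemma asso_nat:
  "\<lbrakk>isarr p; isarr q; isarr r; src p = A; src q = B; src r = D; tgt p = A'; tgt q = B'; tgt r = D'\<rbrakk>
    \<Longrightarrow> asso A' B' D' \<star> ((p \<bowtie> q) \<bowtie> r) = (p \<bowtie> (q \<bowtie> r)) \<star> asso A B D"
  using associator_natural[of A A' B B' D D' "mid p" "mid q" "mid r"]
  by (auto intro!: src_mid_tgt_eqI simp: isarr_def simp del: isarr_Ob)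

lemma lun_nat: "\<lbrakk>isarr p; src p = A; tgt p = B\<rbrakk> \<Longrightarrow> lun B \<star> (ident (Unit C) \<bowtie> p) = p \<star> lun A"
  using lunitor_natural[of A B "mid p"] by (auto intro!: src_mid_tgt_eqI simp: isarr_def simp del: isarr_Ob)

lemma pentagon_arr:
  "\<lbrakk>W \<in> Ob C; X \<in> Ob C; Y \<in> Ob C; Z \<in> Ob C\<rbrakk> \<Longrightarrow>
    (ident W \<bowtie> asso X Y Z) \<star> asso W (X \<boxtimes> Y) Z \<star> (asso W X Y \<bowtie> ident Z)
      = asso W X (Y \<boxtimes> Z) \<star> asso (W \<boxtimes> X) Y Z"
  using pentagon[of W X Y Z] by (auto intro!: src_mid_tgt_eqI)

lemma triangle_arr:
  "\<lbrakk>X \<in> Ob C; Y \<in> Ob C\<rbrakk> \<Longrightarrow> (ident X \<bowtie> lun Y) \<star> asso X (Unit C) Y = run X \<bowtie> ident Y"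
  using triangle[of X Y] by (auto intro!: src_mid_tgt_eqI)

text \<open>Kelly's redundancy of this unit axiom: tensored with an arbitrary object on the left it follows
  from the pentagon and the triangle, and tensoring with the unit object is faithful.\<close>

lemma lun_tens:
  assumes A: "A \<in> Ob C" and V: "V \<in> Ob C"
  shows "lun (A \<boxtimes> V) \<star> asso (Unit C) A V = lun A \<bowtie> ident V"
proof -
  let ?I = "Unit C"
  note [simp] = A V
  \<comment> \<open>\<open>?b\<close> consists of the first two arrows on the long side of the
    pentagon for \<open>?I\<close>, \<open>?I\<close>, \<open>A\<close>, \<open>V\<close>. Both
    sides of the claim, tensored with the unit object, are compared after precomposition with it;
    its inverse \<open>?b'\<close> then allows cancelling it.\<close>
  let ?b = "asso ?I (?I \<boxtimes> A) V \<star> (asso ?I ?I A \<bowtie> ident V)"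
  let ?b' = "(asso_inv ?I ?I A \<bowtie> ident V) \<star> asso_inv ?I (?I \<boxtimes> A) V"
  have "(ident ?I \<bowtie> (lun (A \<boxtimes> V) \<star> asso ?I A V)) \<star> ?b
      = (ident ?I \<bowtie> lun (A \<boxtimes> V)) \<star> (ident ?I \<bowtie> asso ?I A V) \<star> ?b"
    by (subst cmp_assoc[symmetric]) (simp_all add: tens_cmp)
  also have "\<dots> = (ident ?I \<bowtie> lun (A \<boxtimes> V)) \<star> asso ?I ?I (A \<boxtimes> V) \<star> asso (?I \<boxtimes> ?I) A V"
    using pentagon_arr[of ?I ?I A V] by simp
  also have "\<dots> = (run ?I \<bowtie> ident (A \<boxtimes> V)) \<star> asso (?I \<boxtimes> ?I) A V"
    by (subst cmp_assoc[symmetric]) (simp_all add: triangle_arr del: cmp_assoc)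
  also have "\<dots> = asso ?I A V \<star> ((run ?I \<bowtie> ident A) \<bowtie> ident V)"
    by (subst asso_nat) simp_all
  also have "\<dots> = asso ?I A V \<star> ((ident ?I \<bowtie> lun A) \<bowtie> ident V) \<star> (asso ?I ?I A \<bowtie> ident V)"
    by (simp add: tens_cmp triangle_arr)
  also have "\<dots> = (ident ?I \<bowtie> lun A \<bowtie> ident V) \<star> ?b"
    by (subst cmp_reassoc[OF asso_nat[of "ident ?I" "lun A" "ident V" ?I "?I \<boxtimes> A" V ?I A V]]) simp_all
  finally have *: "(ident ?I \<bowtie> (lun (A \<boxtimes> V) \<star> asso ?I A V)) \<star> ?b = (ident ?I \<bowtie> lun A \<bowtie> ident V) \<star> ?b" .
  have inv: "?b \<star> ?b' = ident (?I \<boxtimes> ((?I \<boxtimes> A) \<boxtimes> V))"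
  proof -
    have "?b \<star> ?b' = asso ?I (?I \<boxtimes> A) V \<star> ((asso ?I ?I A \<bowtie> ident V) \<star> (asso_inv ?I ?I A \<bowtie> ident V)) \<star> asso_inv ?I (?I \<boxtimes> A) V"
      by simp
    also have "\<dots> = ident (?I \<boxtimes> ((?I \<boxtimes> A) \<boxtimes> V))"
      by (simp add: tens_cmp)
    finally show ?thesis .
  qed
  have I: "ident ?I \<bowtie> (lun (A \<boxtimes> V) \<star> asso ?I A V) = ident ?I \<bowtie> lun A \<bowtie> ident V"
    by (rule cmp_cancel_right[OF _ _ _ _ _ inv _ _ _ *]) simp_all
  let ?p = "lun (A \<boxtimes> V) \<star> asso ?I A V" and ?q = "lun A \<bowtie> ident V" and ?D = "(?I \<boxtimes> A) \<boxtimes> V"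
  \<comment> \<open>Naturality of the left unit constraint strips off the extra unit factor.\<close>
  have "?p \<star> lun ?D = ?q \<star> lun ?D"
    using lun_nat[of ?p ?D "A \<boxtimes> V"] lun_nat[of ?q ?D "A \<boxtimes> V"] I by simp
  then show ?thesis
    by (intro cmp_cancel_right[of ?p ?q "lun_inv ?D" "lun ?D" ?D]) simp_all
qed

end

section \<open>The strict category of left actions\<close>

type_synonym ('o, 'm) nat_family = "('o list \<times> ('o \<Rightarrow> 'o \<times> 'm \<times> 'o) \<times> 'o list) option"

context linear_monoidal_category
begin

definition act :: "'o list \<Rightarrow> 'o \<Rightarrow> 'o" where
  "act L V = foldr (tensor_ob C) L V"

definition act_arr :: "'o list \<Rightarrow> 'o \<times> 'm \<times> 'o \<Rightarrow> 'o \<times> 'm \<times> 'o" where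
  "act_arr L p = foldr (\<lambda>X q. ident X \<bowtie> q) L p"

text \<open>The structure of a functor of right module categories on \<open>act L\<close>: the
  canonical isomorphism that absorbs a right factor \<open>Z\<close> into the argument.\<close>

fun act_asso :: "'o list \<Rightarrow> 'o \<Rightarrow> 'o \<Rightarrow> 'o \<times> 'm \<times> 'o" where
  "act_asso [] V Z = ident (V \<boxtimes> Z)"
| "act_asso (X # L) V Z = (ident X \<bowtie> act_asso L V Z) \<star> asso X (act L V) Z"

lemma act_simps [simp]:
  "act [] V = V" "act (X # L) V = X \<boxtimes> act L V" "act (L @ N) V = act L (act N V)"
  by (simp_all add: act_def)

lemma act_Ob [simp]: "\<lbrakk>set L \<subseteq> Ob C; V \<in> Ob C\<rbrakk> \<Longrightarrow> act L V \<in> Ob C"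
  by (induction L) auto

lemma act_arr_simps [simp]:
  "act_arr [] p = p" "act_arr (X # L) p = ident X \<bowtie> act_arr L p"
  "act_arr (L @ N) p = act_arr L (act_arr N p)"
  by (simp_all add: act_arr_def)

lemma act_arr_typing [simp]:
  "src (act_arr L p) = act L (src p)" "tgt (act_arr L p) = act L (tgt p)"
  "\<lbrakk>set L \<subseteq> Ob C; isarr p\<rbrakk> \<Longrightarrow> isarr (act_arr L p)"
  by (induction L) auto

lemma act_arr_cmp:
  "\<lbrakk>set L \<subseteq> Ob C; isarr p; isarr q; src q = tgt p\<rbrakk> \<Longrightarrow> act_arr L (q \<star> p) = act_arr L q \<star> act_arr L p"
  by (induction L) (auto simp: tens_cmp)

lemma act_arr_ident [simp]: "\<lbrakk>set L \<subseteq> Ob C; V \<in> Ob C\<rbrakk> \<Longrightarrow> act_arr L (ident V) = ident (act L V)"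
  by (induction L) auto

lemma act_arr_smul [simp]: "\<lbrakk>set L \<subseteq> Ob C; isarr p\<rbrakk> \<Longrightarrow> act_arr L (smul a p) = smul a (act_arr L p)"
  by (induction L) auto

lemma act_asso_typing [simp]:
  "src (act_asso L V Z) = act L V \<boxtimes> Z" "tgt (act_asso L V Z) = act L (V \<boxtimes> Z)"
  "\<lbrakk>set L \<subseteq> Ob C; V \<in> Ob C; Z \<in> Ob C\<rbrakk> \<Longrightarrow> isarr (act_asso L V Z)"
  by (induction L) auto

lemma act_asso_nat:
  "\<lbrakk>set L \<subseteq> Ob C; isarr u; src u = V; tgt u = V'; Z \<in> Ob C\<rbrakk> \<Longrightarrow>
    act_asso L V' Z \<star> (act_arr L u \<bowtie> ident Z) = act_arr L (u \<bowtie> ident Z) \<star> act_asso L V Z"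
proof (induction L)
  case (Cons X L)
  have V: "V \<in> Ob C" "V' \<in> Ob C" using Cons.prems by auto
  have "act_asso (X # L) V' Z \<star> (act_arr (X # L) u \<bowtie> ident Z)
      = (ident X \<bowtie> act_asso L V' Z) \<star> asso X (act L V') Z \<star> ((ident X \<bowtie> act_arr L u) \<bowtie> ident Z)"
    using Cons.prems V by simp
  also have "\<dots> = (ident X \<bowtie> act_asso L V' Z) \<star> (ident X \<bowtie> act_arr L u \<bowtie> ident Z) \<star> asso X (act L V) Z"
    using Cons.prems V
    by (subst asso_nat[of "ident X" "act_arr L u" "ident Z" X "act L V" Z X "act L V'" Z]) simp_all
  also have "\<dots> = (ident X \<bowtie> (act_asso L V' Z \<star> (act_arr L u \<bowtie> ident Z))) \<star> asso X (act L V) Z"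
    using Cons.prems V by (subst cmp_reassoc[OF tens_cmp]) simp_all
  also have "\<dots> = (ident X \<bowtie> (act_arr L (u \<bowtie> ident Z) \<star> act_asso L V Z)) \<star> asso X (act L V) Z"
    using Cons.prems V Cons.IH by simp
  also have "\<dots> = act_arr (X # L) (u \<bowtie> ident Z) \<star> act_asso (X # L) V Z"
    using Cons.prems V by (simp add: tens_cmp_ident)
  finally show ?case .
qed auto

text \<open>Coherence of these isomorphisms with concatenation, the reason why compatibility with
  right tensoring survives whiskering.\<close>

lemma act_asso_append:
  "\<lbrakk>set L \<subseteq> Ob C; set N \<subseteq> Ob C; V \<in> Ob C; Z \<in> Ob C\<rbrakk> \<Longrightarrow>
    act_asso (L @ N) V Z = act_arr L (act_asso N V Z) \<star> act_asso L (act N V) Z"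
proof (induction L)
  case (Cons X L)
  then show ?case by (simp add: tens_cmp_ident)
qed auto

text \<open>A list of objects acts on \<open>C\<close> by tensoring from the left. Its arrows are the natural
  transformations between these endofunctors that commute with tensoring from the right
  (\<open>act_asso\<close>). Composition of endofunctors is strictly associative, so this is a strict monoidal
  category.\<close>

definition nat_trans :: "'o list \<Rightarrow> ('o \<Rightarrow> 'o \<times> 'm \<times> 'o) \<Rightarrow> 'o list \<Rightarrow> bool" where
  "nat_trans A f B \<longleftrightarrow> set A \<subseteq> Ob C \<and> set B \<subseteq> Ob C \<and> f \<in> extensional (Ob C) \<and>
     (\<forall>V\<in>Ob C. isarr (f V) \<and> src (f V) = act A V \<and> tgt (f V) = act B V) \<and>
     (\<forall>u. isarr u \<longrightarrow> f (tgt u) \<star> act_arr A u = act_arr B u \<star> f (src u)) \<and>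
     (\<forall>V\<in>Ob C. \<forall>Z\<in>Ob C. f (V \<boxtimes> Z) \<star> act_asso A V Z = act_asso B V Z \<star> (f V \<bowtie> ident Z))"

lemma nat_transD:
  assumes "nat_trans A f B"
  shows "set A \<subseteq> Ob C" "set B \<subseteq> Ob C" "f \<in> extensional (Ob C)"
    "V \<in> Ob C \<Longrightarrow> isarr (f V)" "V \<in> Ob C \<Longrightarrow> src (f V) = act A V" "V \<in> Ob C \<Longrightarrow> tgt (f V) = act B V"
    "\<lbrakk>isarr u; src u = V; tgt u = V'\<rbrakk> \<Longrightarrow> f V' \<star> act_arr A u = act_arr B u \<star> f V"
    "\<lbrakk>V \<in> Ob C; Z \<in> Ob C\<rbrakk> \<Longrightarrow> f (V \<boxtimes> Z) \<star> act_asso A V Z = act_asso B V Z \<star> (f V \<bowtie> ident Z)"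
  using assms unfolding nat_trans_def by blast+

lemma nat_transI:
  assumes "set A \<subseteq> Ob C" "set B \<subseteq> Ob C" "f \<in> extensional (Ob C)"
    "\<And>V. V \<in> Ob C \<Longrightarrow> isarr (f V) \<and> src (f V) = act A V \<and> tgt (f V) = act B V"
    "\<And>u V V'. \<lbrakk>isarr u; src u = V; tgt u = V'; V \<in> Ob C; V' \<in> Ob C\<rbrakk> \<Longrightarrow> f V' \<star> act_arr A u = act_arr B u \<star> f V"
    "\<And>V Z. \<lbrakk>V \<in> Ob C; Z \<in> Ob C\<rbrakk> \<Longrightarrow> f (V \<boxtimes> Z) \<star> act_asso A V Z = act_asso B V Z \<star> (f V \<bowtie> ident Z)"
  shows "nat_trans A f B"
  unfolding nat_trans_def
  using assms(1-4,6) assms(5)[OF _ refl refl] isarr_Ob by (intro conjI allI ballI impI) simp_all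

lemma nat_trans_cmp:
  assumes f: "nat_trans A f B" and g: "nat_trans B g D"
  shows "nat_trans A (\<lambda>V\<in>Ob C. g V \<star> f V) D"
proof (rule nat_transI)
  note [simp] = nat_transD(1-6)[OF f] nat_transD(1-6)[OF g]
  fix u V V' assume u [simp]: "isarr u" "src u = V" "tgt u = V'" "V \<in> Ob C" "V' \<in> Ob C"
  show "(\<lambda>V\<in>Ob C. g V \<star> f V) V' \<star> act_arr A u = act_arr D u \<star> (\<lambda>V\<in>Ob C. g V \<star> f V) V"
    using nat_transD(7)[OF f u(1-3)]
      cmp_reassoc[OF nat_transD(7)[OF g u(1-3)], of "f V"] by simp
next
  note [simp] = nat_transD(1-6)[OF f] nat_transD(1-6)[OF g]
  fix V Z assume [simp]: "V \<in> Ob C" "Z \<in> Ob C"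
  have "(g (V \<boxtimes> Z) \<star> f (V \<boxtimes> Z)) \<star> act_asso A V Z = g (V \<boxtimes> Z) \<star> act_asso B V Z \<star> (f V \<bowtie> ident Z)"
    using nat_transD(8)[OF f, of V Z] by simp
  also have "\<dots> = act_asso D V Z \<star> (g V \<bowtie> ident Z) \<star> (f V \<bowtie> ident Z)"
    by (subst cmp_reassoc[OF nat_transD(8)[OF g, of V Z]]) simp_all
  finally show "(\<lambda>V\<in>Ob C. g V \<star> f V) (V \<boxtimes> Z) \<star> act_asso A V Z
      = act_asso D V Z \<star> ((\<lambda>V\<in>Ob C. g V \<star> f V) V \<bowtie> ident Z)"
    by (simp add: tens_cmp)
qed (use nat_transD(1-6)[OF f] nat_transD(1-6)[OF g] in auto)

text \<open>Identities on the right mean evaluation at \<open>act N V\<close>, identities on the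
  left mean applying the functor \<open>act L\<close>. Compatibility with right tensoring splits by
  \<open>act_asso_append\<close>; naturality of \<open>f\<close> moves it past the part from
  \<open>N\<close>, and naturality of the part from \<open>L\<close> moves that past
  \<open>f\<close>.\<close>

lemma nat_trans_whisk:
  assumes f: "nat_trans A f B" and L: "set L \<subseteq> Ob C" and N: "set N \<subseteq> Ob C"
  shows "nat_trans (L @ A @ N) (\<lambda>V\<in>Ob C. act_arr L (f (act N V))) (L @ B @ N)"
proof (rule nat_transI)
  note [simp] = nat_transD(1-6)[OF f] L N
  fix u V V' assume u [simp]: "isarr u" "src u = V" "tgt u = V'" "V \<in> Ob C" "V' \<in> Ob C"
  show "(\<lambda>V\<in>Ob C. act_arr L (f (act N V))) V' \<star> act_arr (L @ A @ N) u
      = act_arr (L @ B @ N) u \<star> (\<lambda>V\<in>Ob C. act_arr L (f (act N V))) V"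
    using nat_transD(7)[OF f, of "act_arr N u"] by (simp add: act_arr_cmp[symmetric])
next
  note [simp] = nat_transD(1-6)[OF f] L N
  fix V Z assume [simp]: "V \<in> Ob C" "Z \<in> Ob C"
  have "act_arr L (f (act N (V \<boxtimes> Z))) \<star> act_asso (L @ A @ N) V Z
     = act_arr L (f (act N (V \<boxtimes> Z))) \<star> act_arr L (act_arr A (act_asso N V Z) \<star> act_asso A (act N V) Z)
        \<star> act_asso L (act A (act N V)) Z"
    by (simp add: act_asso_append)
  also have "\<dots> = act_arr L (f (act N (V \<boxtimes> Z)) \<star> act_arr A (act_asso N V Z) \<star> act_asso A (act N V) Z)
        \<star> act_asso L (act A (act N V)) Z"
    by (simp add: act_arr_cmp)
  also have "f (act N (V \<boxtimes> Z)) \<star> act_arr A (act_asso N V Z) \<star> act_asso A (act N V) Z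
     = act_arr B (act_asso N V Z) \<star> f (act N V \<boxtimes> Z) \<star> act_asso A (act N V) Z"
    by (subst cmp_reassoc[OF nat_transD(7)[OF f, of "act_asso N V Z" "act N V \<boxtimes> Z" "act N (V \<boxtimes> Z)"]]) simp_all
  also have "\<dots> = act_arr B (act_asso N V Z) \<star> act_asso B (act N V) Z \<star> (f (act N V) \<bowtie> ident Z)"
    by (simp add: nat_transD(8)[OF f])
  also have "act_arr L \<dots> \<star> act_asso L (act A (act N V)) Z
     = act_arr L (act_arr B (act_asso N V Z)) \<star> act_arr L (act_asso B (act N V) Z)
       \<star> act_arr L (f (act N V) \<bowtie> ident Z) \<star> act_asso L (act A (act N V)) Z"
    by (simp add: act_arr_cmp)
  also have "act_arr L (f (act N V) \<bowtie> ident Z) \<star> act_asso L (act A (act N V)) Z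
     = act_asso L (act B (act N V)) Z \<star> (act_arr L (f (act N V)) \<bowtie> ident Z)"
    by (subst act_asso_nat) simp_all
  finally show "(\<lambda>V\<in>Ob C. act_arr L (f (act N V))) (V \<boxtimes> Z) \<star> act_asso (L @ A @ N) V Z
      = act_asso (L @ B @ N) V Z \<star> ((\<lambda>V\<in>Ob C. act_arr L (f (act N V))) V \<bowtie> ident Z)"
    by (simp add: act_asso_append act_arr_cmp)
qed (use nat_transD(1-6)[OF f] L N in auto)

lemma nat_trans_ident: "set A \<subseteq> Ob C \<Longrightarrow> nat_trans A (\<lambda>V\<in>Ob C. ident (act A V)) A"
  by (rule nat_transI) auto

lemma nat_trans_smul:
  assumes f: "nat_trans A f B"
  shows "nat_trans A (\<lambda>V\<in>Ob C. smul a (f V)) B"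
  using nat_transD[OF f] by (intro nat_transI) (simp_all del: isarr_triple)

lemma nat_trans_eqI:
  "\<lbrakk>nat_trans A f B; nat_trans A' g B'; \<And>V. V \<in> Ob C \<Longrightarrow> f V = g V\<rbrakk> \<Longrightarrow> f = g"
  by (rule extensionalityI[of _ "Ob C"]) (auto dest: nat_transD)


text \<open>The undefined arrow \<^term>\<open>None\<close> makes the laws of the calculus unconditional. The arrow
  \<open>whisk L F N\<close> is \<open>id\<^sub>L \<otimes> F \<otimes> id\<^sub>N\<close>.\<close>

definition dia :: "('o, 'm) nat_family \<Rightarrow> 'o list \<Rightarrow> 'o list \<Rightarrow> bool" where
  "dia F A B \<longleftrightarrow> (\<exists>f. F = Some (A, f, B) \<and> nat_trans A f B)"

definition comp_at :: "('o, 'm) nat_family \<Rightarrow> 'o \<Rightarrow> 'o \<times> 'm \<times> 'o" where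
  "comp_at F = fst (snd (the F))"

definition dcomp :: "('o, 'm) nat_family \<Rightarrow> ('o, 'm) nat_family \<Rightarrow> ('o, 'm) nat_family" (infixr "\<bullet>" 70) where
  "G \<bullet> F = (if \<exists>A B D. dia F A B \<and> dia G B D
     then Some (fst (the F), \<lambda>V\<in>Ob C. comp_at G V \<star> comp_at F V, snd (snd (the G))) else None)"

definition whisk :: "'o list \<Rightarrow> ('o, 'm) nat_family \<Rightarrow> 'o list \<Rightarrow> ('o, 'm) nat_family" where
  "whisk L F N = (if (\<exists>A B. dia F A B) \<and> set L \<subseteq> Ob C \<and> set N \<subseteq> Ob C
     then Some (L @ fst (the F) @ N, \<lambda>V\<in>Ob C. act_arr L (comp_at F (act N V)), L @ snd (snd (the F)) @ N)
     else None)"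

definition did :: "'o list \<Rightarrow> ('o, 'm) nat_family" where
  "did A = (if set A \<subseteq> Ob C then Some (A, \<lambda>V\<in>Ob C. ident (act A V), A) else None)"

definition dscale :: "'k \<Rightarrow> ('o, 'm) nat_family \<Rightarrow> ('o, 'm) nat_family" where
  "dscale a F = (if \<exists>A B. dia F A B
     then Some (fst (the F), \<lambda>V\<in>Ob C. smul a (comp_at F V), snd (snd (the F))) else None)"

lemma dia_unique: "\<lbrakk>dia F A B; dia F A' B'\<rbrakk> \<Longrightarrow> A' = A \<and> B' = B"
  by (auto simp: dia_def)

lemma diaE: assumes "dia F A B" obtains "F = Some (A, comp_at F, B)" "nat_trans A (comp_at F) B"
  using assms by (auto simp: dia_def comp_at_def)

lemma dia_list: "dia F A B \<Longrightarrow> set A \<subseteq> Ob C" "dia F A B \<Longrightarrow> set B \<subseteq> Ob C"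
  by (auto simp: dia_def dest: nat_transD)

lemma dia_eqI: "\<lbrakk>dia F A B; dia G A B; \<And>V. V \<in> Ob C \<Longrightarrow> comp_at F V = comp_at G V\<rbrakk> \<Longrightarrow> F = G"
  by (metis diaE nat_trans_eqI)

lemma dia_at:
  assumes "dia F A B"
  shows "V \<in> Ob C \<Longrightarrow> isarr (comp_at F V)" "V \<in> Ob C \<Longrightarrow> src (comp_at F V) = act A V"
    "V \<in> Ob C \<Longrightarrow> tgt (comp_at F V) = act B V"
    "\<lbrakk>isarr u; src u = V; tgt u = V'\<rbrakk> \<Longrightarrow> comp_at F V' \<star> act_arr A u = act_arr B u \<star> comp_at F V"
    "\<lbrakk>V \<in> Ob C; Z \<in> Ob C\<rbrakk> \<Longrightarrow> comp_at F (V \<boxtimes> Z) \<star> act_asso A V Z = act_asso B V Z \<star> (comp_at F V \<bowtie> ident Z)"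
proof -
  have "nat_trans A (comp_at F) B" using assms by (rule diaE)
  from nat_transD(4-8)[OF this] show "V \<in> Ob C \<Longrightarrow> isarr (comp_at F V)"
    "V \<in> Ob C \<Longrightarrow> src (comp_at F V) = act A V" "V \<in> Ob C \<Longrightarrow> tgt (comp_at F V) = act B V"
    "\<lbrakk>isarr u; src u = V; tgt u = V'\<rbrakk> \<Longrightarrow> comp_at F V' \<star> act_arr A u = act_arr B u \<star> comp_at F V"
    "\<lbrakk>V \<in> Ob C; Z \<in> Ob C\<rbrakk> \<Longrightarrow> comp_at F (V \<boxtimes> Z) \<star> act_asso A V Z = act_asso B V Z \<star> (comp_at F V \<bowtie> ident Z)"
    by blast+
qed

lemma dcomp_Some:
  assumes F: "dia F A B" and G: "dia G B D"
  shows "dia (G \<bullet> F) A D" "V \<in> Ob C \<Longrightarrow> comp_at (G \<bullet> F) V = comp_at G V \<star> comp_at F V"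
proof -
  have eq: "G \<bullet> F = Some (A, \<lambda>V\<in>Ob C. comp_at G V \<star> comp_at F V, D)"
    unfolding dcomp_def using F G by (auto simp: dia_def)
  show "dia (G \<bullet> F) A D"
    using nat_trans_cmp[of A "comp_at F" B "comp_at G" D] F G by (auto simp: eq dia_def comp_at_def)
  show "V \<in> Ob C \<Longrightarrow> comp_at (G \<bullet> F) V = comp_at G V \<star> comp_at F V" by (simp add: eq comp_at_def)
qed

lemma dcomp_dest: "dia (G \<bullet> F) A D \<Longrightarrow> \<exists>B. dia F A B \<and> dia G B D"
  unfolding dcomp_def by (auto simp: dia_def split: if_splits)

lemma whisk_Some:
  assumes F: "dia F A B" and L: "set L \<subseteq> Ob C" "set N \<subseteq> Ob C"
  shows "dia (whisk L F N) (L @ A @ N) (L @ B @ N)"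
    "V \<in> Ob C \<Longrightarrow> comp_at (whisk L F N) V = act_arr L (comp_at F (act N V))"
proof -
  have eq: "whisk L F N = Some (L @ A @ N, \<lambda>V\<in>Ob C. act_arr L (comp_at F (act N V)), L @ B @ N)"
    unfolding whisk_def using F L by (auto simp: dia_def)
  show "dia (whisk L F N) (L @ A @ N) (L @ B @ N)"
    using nat_trans_whisk[of A "comp_at F" B L N] F L by (auto simp: eq dia_def comp_at_def)
  show "V \<in> Ob C \<Longrightarrow> comp_at (whisk L F N) V = act_arr L (comp_at F (act N V))" by (simp add: eq comp_at_def)
qed

lemma whisk_dest: "dia (whisk L F N) A' B' \<Longrightarrow>
   \<exists>A B. dia F A B \<and> set L \<subseteq> Ob C \<and> set N \<subseteq> Ob C \<and> A' = L @ A @ N \<and> B' = L @ B @ N"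
  unfolding whisk_def by (auto simp: dia_def split: if_splits)

lemma did_Some:
  assumes "set A \<subseteq> Ob C"
  shows "dia (did A) A A" "V \<in> Ob C \<Longrightarrow> comp_at (did A) V = ident (act A V)"
  using nat_trans_ident[OF assms] assms by (auto simp: did_def dia_def comp_at_def)

lemma did_dest: "dia (did A) B D \<Longrightarrow> B = A \<and> D = A \<and> set A \<subseteq> Ob C"
  by (auto simp: did_def dia_def split: if_splits)

lemma dscale_Some:
  assumes F: "dia F A B"
  shows "dia (dscale a F) A B" "V \<in> Ob C \<Longrightarrow> comp_at (dscale a F) V = smul a (comp_at F V)"
proof -
  have eq: "dscale a F = Some (A, \<lambda>V\<in>Ob C. smul a (comp_at F V), B)"
    unfolding dscale_def using F by (auto simp: dia_def)
  show "dia (dscale a F) A B"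
    using nat_trans_smul[of A "comp_at F" B a] F by (auto simp: eq dia_def comp_at_def)
  show "V \<in> Ob C \<Longrightarrow> comp_at (dscale a F) V = smul a (comp_at F V)" by (simp add: eq comp_at_def)
qed

lemma dscale_dest: "dia (dscale a F) A B \<Longrightarrow> dia F A B"
  unfolding dscale_def by (auto simp: dia_def split: if_splits)

text \<open>The ill-typed half of every law: when neither side is an arrow, both are
  \<open>None\<close>.\<close>

lemma undefined_eqI:
  "\<lbrakk>F = None \<or> (\<exists>A B. dia F A B); G = None \<or> (\<exists>A B. dia G A B); \<nexists>A B. dia F A B; \<nexists>A B. dia G A B\<rbrakk>
    \<Longrightarrow> F = G"
  by blast

lemma None_or_dia:
  "G \<bullet> F = None \<or> (\<exists>A B. dia (G \<bullet> F) A B)" "whisk L F N = None \<or> (\<exists>A B. dia (whisk L F N) A B)"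
  "dscale a F = None \<or> (\<exists>A B. dia (dscale a F) A B)" "did A = None \<or> (\<exists>B D. dia (did A) B D)"
proof -
  show "G \<bullet> F = None \<or> (\<exists>A B. dia (G \<bullet> F) A B)"
    using dcomp_Some(1)[of F _ _ G] dcomp_def[of G F] by (metis (no_types, lifting))
  show "whisk L F N = None \<or> (\<exists>A B. dia (whisk L F N) A B)"
    using whisk_Some(1)[of F _ _ L N] whisk_def[of L F N] by (metis (no_types, lifting))
  show "dscale a F = None \<or> (\<exists>A B. dia (dscale a F) A B)"
    using dscale_Some(1)[of F _ _ a] dscale_def[of a F] by (metis (no_types, lifting))
  show "did A = None \<or> (\<exists>B D. dia (did A) B D)"
    using did_Some(1)[of A] did_def[of A] by (metis (no_types, lifting))
qed

section \<open>Laws of the strict monoidal category\<close>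

lemma dcomp_assoc: "(H \<bullet> G) \<bullet> F = H \<bullet> G \<bullet> F"
proof (cases "\<exists>A B D E. dia F A B \<and> dia G B D \<and> dia H D E")
  case True
  then obtain A B D E where t: "dia F A B" "dia G B D" "dia H D E" by blast
  note d = dcomp_Some[OF t(1,2)] dcomp_Some[OF t(2,3)]
  show ?thesis
    by (rule dia_eqI[OF dcomp_Some(1)[OF t(1) d(3)] dcomp_Some(1)[OF d(1) t(3)]])
      (simp add: dcomp_Some(2)[OF t(1) d(3)] dcomp_Some(2)[OF d(1) t(3)] d
        dia_at[OF t(1)] dia_at[OF t(2)] dia_at[OF t(3)])
next
  case False
  then have "\<nexists>A E. dia ((H \<bullet> G) \<bullet> F) A E" "\<nexists>A E. dia (H \<bullet> G \<bullet> F) A E"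
    using dcomp_dest dia_unique by metis+
  then show ?thesis by - (rule undefined_eqI; (rule None_or_dia | assumption))
qed

lemma whisk_dcomp: "whisk L (G \<bullet> F) N = whisk L G N \<bullet> whisk L F N"
proof (cases "(\<exists>A B D. dia F A B \<and> dia G B D) \<and> set L \<subseteq> Ob C \<and> set N \<subseteq> Ob C")
  case True
  then obtain A B D where t: "dia F A B" "dia G B D" and [simp]: "set L \<subseteq> Ob C" "set N \<subseteq> Ob C" by blast
  note w = whisk_Some[OF t(1), of L N] whisk_Some[OF t(2), of L N]
  show ?thesis
    by (rule dia_eqI[OF whisk_Some(1)[OF dcomp_Some(1)[OF t]] dcomp_Some(1)[OF w(1,3)]])
      (simp_all add: whisk_Some(2)[OF dcomp_Some(1)[OF t]] dcomp_Some(2)[OF w(1,3)] w dcomp_Some(2)[OF t]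
        act_arr_cmp dia_at[OF t(1)] dia_at[OF t(2)])
next
  case False
  then have "\<nexists>A E. dia (whisk L (G \<bullet> F) N) A E" "\<nexists>A E. dia (whisk L G N \<bullet> whisk L F N) A E"
    by (auto dest!: whisk_dest dcomp_dest)
  then show ?thesis by - (rule undefined_eqI; (rule None_or_dia | assumption))
qed

lemma whisk_whisk: "whisk L (whisk L' F N') N = whisk (L @ L') F (N' @ N)"
proof (cases "(\<exists>A B. dia F A B) \<and> set L \<subseteq> Ob C \<and> set N \<subseteq> Ob C \<and> set L' \<subseteq> Ob C \<and> set N' \<subseteq> Ob C")
  case True
  then obtain A B where t: "dia F A B"
    and [simp]: "set L \<subseteq> Ob C" "set N \<subseteq> Ob C" "set L' \<subseteq> Ob C" "set N' \<subseteq> Ob C" by blast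
  have "dia (whisk L (whisk L' F N') N) (L @ L' @ A @ N' @ N) (L @ L' @ B @ N' @ N)"
    using whisk_Some(1)[OF whisk_Some(1)[OF t, of L' N'], of L N] by simp
  moreover have "dia (whisk (L @ L') F (N' @ N)) (L @ L' @ A @ N' @ N) (L @ L' @ B @ N' @ N)"
    using whisk_Some(1)[OF t, of "L @ L'" "N' @ N"] by simp
  ultimately show ?thesis
    by (rule dia_eqI) (simp add: whisk_Some(2)[OF whisk_Some(1)[OF t]] whisk_Some(2)[OF t])
next
  case False
  then have "\<nexists>A E. dia (whisk L (whisk L' F N') N) A E" "\<nexists>A E. dia (whisk (L @ L') F (N' @ N)) A E"
    by (auto dest!: whisk_dest)
  then show ?thesis by - (rule undefined_eqI; (rule None_or_dia | assumption))
qed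

lemma whisk_did: "whisk L (did A) N = did (L @ A @ N)"
proof (cases "set L \<subseteq> Ob C \<and> set N \<subseteq> Ob C \<and> set A \<subseteq> Ob C")
  case True
  then have [simp]: "set L \<subseteq> Ob C" "set N \<subseteq> Ob C" "set A \<subseteq> Ob C" by auto
  have d: "dia (did A) A A" by (simp add: did_Some)
  show ?thesis
    by (rule dia_eqI[OF whisk_Some(1)[OF d]])
      (auto simp: whisk_Some(2)[OF d] did_Some intro: did_Some(1)[of "L @ A @ N"])
next
  case False
  then have "\<nexists>B E. dia (whisk L (did A) N) B E" "\<nexists>B E. dia (did (L @ A @ N)) B E"
    by (auto dest!: whisk_dest did_dest)
  then show ?thesis by - (rule undefined_eqI; (rule None_or_dia | assumption))
qed

text \<open>The unit laws need a typing premise: with an identity on any other word, the composite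
  is \<open>None\<close>.\<close>

lemma dcomp_did:
  assumes F: "dia F A B"
  shows "F \<bullet> did A = F" "did B \<bullet> F = F"
proof -
  have d: "dia (did A) A A" "dia (did B) B B" using dia_list[OF F] by (auto intro: did_Some)
  show "F \<bullet> did A = F"
    by (rule dia_eqI[OF dcomp_Some(1)[OF d(1) F] F]) (use dia_list[OF F] in \<open>simp add: dcomp_Some(2)[OF d(1) F] did_Some(2) dia_at[OF F]\<close>)
  show "did B \<bullet> F = F"
    by (rule dia_eqI[OF dcomp_Some(1)[OF F d(2)] F]) (use dia_list[OF F] in \<open>simp add: dcomp_Some(2)[OF F d(2)] did_Some(2) dia_at[OF F]\<close>)
qed

lemma whisk_Nil:
  assumes F: "dia F A B"
  shows "whisk [] F [] = F"
  using whisk_Some(1)[OF F, of "[]" "[]"]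
  by (intro dia_eqI[OF _ F]) (simp_all add: whisk_Some(2)[OF F])

text \<open>Arrows on disjoint strands commute. The components of \<open>G\<close> are arrows of
  \<open>C\<close>, and the claim is the naturality of \<open>F\<close> along them.\<close>

lemma interchange:
  assumes F: "dia F A B" and G: "dia G A' B'"
  shows "whisk L F (K @ B' @ N) \<bullet> whisk (L @ A @ K) G N = whisk (L @ B @ K) G N \<bullet> whisk L F (K @ A' @ N)"
proof -
  note d = dia_list[OF F] dia_list[OF G]
  have K: "whisk [] F (K @ B') \<bullet> whisk (A @ K) G [] = whisk (B @ K) G [] \<bullet> whisk [] F (K @ A')"
    if [simp]: "set K \<subseteq> Ob C"
  proof -
    have 1: "dia (whisk [] F (K @ B')) (A @ K @ B') (B @ K @ B')"
      using whisk_Some(1)[OF F, of "[]" "K @ B'"] d by simp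
    have 2: "dia (whisk (A @ K) G []) (A @ K @ A') (A @ K @ B')"
      using whisk_Some(1)[OF G, of "A @ K" "[]"] d by simp
    have 3: "dia (whisk [] F (K @ A')) (A @ K @ A') (B @ K @ A')"
      using whisk_Some(1)[OF F, of "[]" "K @ A'"] d by simp
    have 4: "dia (whisk (B @ K) G []) (B @ K @ A') (B @ K @ B')"
      using whisk_Some(1)[OF G, of "B @ K" "[]"] d by simp
    show ?thesis
    proof (rule dia_eqI[OF dcomp_Some(1)[OF 2 1] dcomp_Some(1)[OF 3 4]])
      fix V assume V: "V \<in> Ob C"
      show "comp_at (whisk [] F (K @ B') \<bullet> whisk (A @ K) G []) V = comp_at (whisk (B @ K) G [] \<bullet> whisk [] F (K @ A')) V"
        using d V by (simp add: dcomp_Some(2)[OF 2 1] dcomp_Some(2)[OF 3 4] whisk_Some(2)[OF F] whisk_Some(2)[OF G]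
            dia_at(1-3)[OF G] dia_at(4)[OF F])
    qed
  qed
  show ?thesis
  proof (cases "set L \<subseteq> Ob C \<and> set K \<subseteq> Ob C \<and> set N \<subseteq> Ob C")
    case True
    then show ?thesis using arg_cong[OF K, of "\<lambda>F. whisk L F N"] by (simp add: whisk_dcomp whisk_whisk)
  next
    case False
    then have "\<nexists>P Q. dia (whisk L F (K @ B' @ N) \<bullet> whisk (L @ A @ K) G N) P Q"
       "\<nexists>P Q. dia (whisk (L @ B @ K) G N \<bullet> whisk L F (K @ A' @ N)) P Q"
      by (auto dest!: whisk_dest dcomp_dest)
    then show ?thesis by - (rule undefined_eqI; (rule None_or_dia | assumption))
  qed
qed

lemma dscale_laws:
  "dscale a G \<bullet> F = dscale a (G \<bullet> F)" "G \<bullet> dscale a F = dscale a (G \<bullet> F)"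
proof -
  have "dscale a G \<bullet> F = dscale a (G \<bullet> F) \<and> G \<bullet> dscale a F = dscale a (G \<bullet> F)"
  proof (cases "\<exists>A B D. dia F A B \<and> dia G B D")
    case True
    then obtain A B D where t: "dia F A B" "dia G B D" by blast
    note d = dscale_Some[where a = a, OF t(1)] dscale_Some[where a = a, OF t(2)] dscale_Some[where a = a, OF dcomp_Some(1)[OF t]]
    show ?thesis
      by (auto intro!: dia_eqI[of _ A D] d dcomp_Some(1)[OF t(1) d(3)] dcomp_Some(1)[OF d(1) t(2)]
          simp: dcomp_Some(2)[OF t(1) d(3)] dcomp_Some(2)[OF d(1) t(2)] d dcomp_Some(2)[OF t] dia_at[OF t(1)] dia_at[OF t(2)])
  next
    case False
    then have "\<nexists>A E. dia (dscale a G \<bullet> F) A E" "\<nexists>A E. dia (G \<bullet> dscale a F) A E" "\<nexists>A E. dia (dscale a (G \<bullet> F)) A E"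
      by (meson dscale_dest dcomp_dest)+
    then show ?thesis by - (rule conjI; rule undefined_eqI; (rule None_or_dia | assumption))
  qed
  then show "dscale a G \<bullet> F = dscale a (G \<bullet> F)" "G \<bullet> dscale a F = dscale a (G \<bullet> F)" by auto
qed

lemma whisk_dscale: "whisk L (dscale a F) N = dscale a (whisk L F N)"
proof (cases "(\<exists>A B. dia F A B) \<and> set L \<subseteq> Ob C \<and> set N \<subseteq> Ob C")
  case True
  then obtain A B where t: "dia F A B" and [simp]: "set L \<subseteq> Ob C" "set N \<subseteq> Ob C" by blast
  note d = dscale_Some[where a = a, OF t]
  show ?thesis
    by (rule dia_eqI[OF whisk_Some(1)[OF d(1)] dscale_Some(1)[OF whisk_Some(1)[OF t]]])
      (auto simp: whisk_Some(2)[OF d(1)] whisk_Some(2)[OF t] dscale_Some(2)[OF whisk_Some(1)[OF t]] d dia_at[OF t])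
next
  case False
  then have "\<nexists>A E. dia (whisk L (dscale a F) N) A E" "\<nexists>A E. dia (dscale a (whisk L F N)) A E"
    by (meson dscale_dest whisk_dest)+
  then show ?thesis by - (rule undefined_eqI; (rule None_or_dia | assumption))
qed

text \<open>Typing rules. The words of a whiskered arrow enter as equations, so that
  \<open>simp\<close> evaluates the concatenations and unification need not guess how a list was
  cut.\<close>

lemma dia_intros:
  "\<lbrakk>dia F A B; dia G B D\<rbrakk> \<Longrightarrow> dia (G \<bullet> F) A D"
  "\<lbrakk>dia F A B; set L \<subseteq> Ob C; set N \<subseteq> Ob C; A' = L @ A @ N; B' = L @ B @ N\<rbrakk> \<Longrightarrow> dia (whisk L F N) A' B'"
  "set A \<subseteq> Ob C \<Longrightarrow> dia (did A) A A"
  by (auto intro: dcomp_Some whisk_Some did_Some)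

end

section \<open>Generators and duality\<close>

context linear_monoidal_category
begin

lemma dcomp_reassoc: "G \<bullet> F = S \<Longrightarrow> G \<bullet> F \<bullet> H = S \<bullet> H"
  by (metis dcomp_assoc)

lemmas strict = dcomp_assoc whisk_dcomp whisk_whisk whisk_did

definition mor :: "'o \<times> 'm \<times> 'o \<Rightarrow> ('o, 'm) nat_family" where
  "mor p = Some ([src p], \<lambda>V\<in>Ob C. p \<bowtie> ident V, [tgt p])"
text \<open>A product \<open>A \<boxtimes> B\<close> and the word \<open>[A, B]\<close> are
  different objects of the strict category. \<open>split\<close> and \<open>fuse\<close> are the
  mutually inverse translations, with associators as components; \<open>del\<close> and
  \<open>ins\<close> play the same role for the unit object and the empty word.\<close>

definition split :: "'o \<Rightarrow> 'o \<Rightarrow> ('o, 'm) nat_family" where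
  "split A B = Some ([A \<boxtimes> B], \<lambda>V\<in>Ob C. asso A B V, [A, B])"
definition fuse :: "'o \<Rightarrow> 'o \<Rightarrow> ('o, 'm) nat_family" where
  "fuse A B = Some ([A, B], \<lambda>V\<in>Ob C. asso_inv A B V, [A \<boxtimes> B])"
definition del :: "('o, 'm) nat_family" where
  "del = Some ([Unit C], \<lambda>V\<in>Ob C. lun V, [])"
definition ins :: "('o, 'm) nat_family" where
  "ins = Some ([], \<lambda>V\<in>Ob C. lun_inv V, [Unit C])"

lemma dia_Some:
  assumes "nat_trans A (\<lambda>V\<in>Ob C. f V) B"
  shows "dia (Some (A, \<lambda>V\<in>Ob C. f V, B)) A B"
    "V \<in> Ob C \<Longrightarrow> comp_at (Some (A, \<lambda>V\<in>Ob C. f V, B)) V = f V"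
  using assms by (auto simp: dia_def comp_at_def)

text \<open>Each square for the inverse comes from the square for \<open>f\<close>, composed with
  \<open>g\<close> on both ends. This yields \<open>fuse\<close> and \<open>ins\<close> without
  separate coherence arguments.\<close>

lemma nat_trans_inverse:
  assumes f: "nat_trans A (\<lambda>V\<in>Ob C. f V) B"
    and g: "\<And>V. V \<in> Ob C \<Longrightarrow> isarr (g V) \<and> src (g V) = act B V \<and> tgt (g V) = act A V"
    and inv: "\<And>V. V \<in> Ob C \<Longrightarrow> g V \<star> f V = ident (act A V)"
      "\<And>V. V \<in> Ob C \<Longrightarrow> f V \<star> g V = ident (act B V)"
  shows "nat_trans B (\<lambda>V\<in>Ob C. g V) A"
proof (rule nat_transI)
  have D: "set A \<subseteq> Ob C" "set B \<subseteq> Ob C" by (simp_all add: nat_transD(1,2)[OF f])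
  have F: "isarr (f V)" "src (f V) = act A V" "tgt (f V) = act B V" if "V \<in> Ob C" for V
    using nat_transD(4-6)[OF f that] that by simp_all
  note [simp] = D F g
  show "set A \<subseteq> Ob C" "set B \<subseteq> Ob C" by simp_all
  fix u V V' assume u: "isarr u" "src u = V" "tgt u = V'" and [simp]: "V \<in> Ob C" "V' \<in> Ob C"
  note [simp] = u
  have "g V' \<star> act_arr B u = g V' \<star> (act_arr B u \<star> f V) \<star> g V"
    by (simp add: inv)
  also have "act_arr B u \<star> f V = f V' \<star> act_arr A u"
    using nat_transD(7)[OF f u] by simp
  also have "g V' \<star> (f V' \<star> act_arr A u) \<star> g V = (g V' \<star> f V') \<star> act_arr A u \<star> g V"
    by simp
  finally show "(\<lambda>V\<in>Ob C. g V) V' \<star> act_arr B u = act_arr A u \<star> (\<lambda>V\<in>Ob C. g V) V"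
    by (simp add: inv)
next
  have D: "set A \<subseteq> Ob C" "set B \<subseteq> Ob C" by (simp_all add: nat_transD(1,2)[OF f])
  have F: "isarr (f V)" "src (f V) = act A V" "tgt (f V) = act B V" if "V \<in> Ob C" for V
    using nat_transD(4-6)[OF f that] that by simp_all
  note [simp] = D F g
  fix V Z assume [simp]: "V \<in> Ob C" "Z \<in> Ob C"
  have "g (V \<boxtimes> Z) \<star> act_asso B V Z = g (V \<boxtimes> Z) \<star> (act_asso B V Z \<star> (f V \<bowtie> ident Z)) \<star> (g V \<bowtie> ident Z)"
    by (simp add: tens_cmp inv)
  also have "act_asso B V Z \<star> (f V \<bowtie> ident Z) = f (V \<boxtimes> Z) \<star> act_asso A V Z"
    using nat_transD(8)[OF f, of V Z] by simp
  also have "g (V \<boxtimes> Z) \<star> (f (V \<boxtimes> Z) \<star> act_asso A V Z) \<star> (g V \<bowtie> ident Z)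
      = (g (V \<boxtimes> Z) \<star> f (V \<boxtimes> Z)) \<star> act_asso A V Z \<star> (g V \<bowtie> ident Z)"
    by simp
  finally show "(\<lambda>V\<in>Ob C. g V) (V \<boxtimes> Z) \<star> act_asso B V Z = act_asso A V Z \<star> ((\<lambda>V\<in>Ob C. g V) V \<bowtie> ident Z)"
    by (simp add: inv)
qed (use nat_transD(1,2)[OF f] g in auto)

lemma nat_trans_mor: "isarr p \<Longrightarrow> nat_trans [src p] (\<lambda>V\<in>Ob C. p \<bowtie> ident V) [tgt p]"
proof (rule nat_transI)
  fix u V V' assume [simp]: "isarr p" "isarr u" "src u = V" "tgt u = V'" "V \<in> Ob C" "V' \<in> Ob C"
  show "(\<lambda>V\<in>Ob C. p \<bowtie> ident V) V' \<star> act_arr [src p] u = act_arr [tgt p] u \<star> (\<lambda>V\<in>Ob C. p \<bowtie> ident V) V"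
    by (simp add: tens_cmp)
next
  fix V Z assume [simp]: "isarr p" "V \<in> Ob C" "Z \<in> Ob C"
  show "(\<lambda>V\<in>Ob C. p \<bowtie> ident V) (V \<boxtimes> Z) \<star> act_asso [src p] V Z
      = act_asso [tgt p] V Z \<star> ((\<lambda>V\<in>Ob C. p \<bowtie> ident V) V \<bowtie> ident Z)"
    using asso_nat[of p "ident V" "ident Z" "src p" V Z "tgt p" V Z] by simp
qed auto

text \<open>Compatibility with right tensoring by \<open>Z\<close> is precisely the pentagon for
  \<open>A\<close>, \<open>B\<close>, \<open>V\<close>, \<open>Z\<close>.\<close>

lemma nat_trans_split:
  assumes [simp]: "A \<in> Ob C" "B \<in> Ob C"
  shows "nat_trans [A \<boxtimes> B] (\<lambda>V\<in>Ob C. asso A B V) [A, B]"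
proof (rule nat_transI)
  fix u V V' assume [simp]: "isarr u" "src u = V" "tgt u = V'" "V \<in> Ob C" "V' \<in> Ob C"
  show "(\<lambda>V\<in>Ob C. asso A B V) V' \<star> act_arr [A \<boxtimes> B] u = act_arr [A, B] u \<star> (\<lambda>V\<in>Ob C. asso A B V) V"
    using asso_nat[of "ident A" "ident B" u A B V A B V'] by simp
next
  fix V Z assume [simp]: "V \<in> Ob C" "Z \<in> Ob C"
  show "(\<lambda>V\<in>Ob C. asso A B V) (V \<boxtimes> Z) \<star> act_asso [A \<boxtimes> B] V Z
      = act_asso [A, B] V Z \<star> ((\<lambda>V\<in>Ob C. asso A B V) V \<bowtie> ident Z)"
    using pentagon_arr[of A B V Z] by simp
qed auto

text \<open>Compatibility with right tensoring is \<open>lun_tens\<close>; this is the purpose of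
  Kelly's identity.\<close>

lemma nat_trans_del: "nat_trans [Unit C] (\<lambda>V\<in>Ob C. lun V) []"
proof (rule nat_transI)
  fix u V V' assume [simp]: "isarr u" "src u = V" "tgt u = V'" "V \<in> Ob C" "V' \<in> Ob C"
  show "(\<lambda>V\<in>Ob C. lun V) V' \<star> act_arr [Unit C] u = act_arr [] u \<star> (\<lambda>V\<in>Ob C. lun V) V"
    using lun_nat[of u V V'] by simp
next
  fix V Z assume [simp]: "V \<in> Ob C" "Z \<in> Ob C"
  show "(\<lambda>V\<in>Ob C. lun V) (V \<boxtimes> Z) \<star> act_asso [Unit C] V Z
      = act_asso [] V Z \<star> ((\<lambda>V\<in>Ob C. lun V) V \<bowtie> ident Z)"
    using lun_tens[of V Z] by simp
qed auto

lemma nat_trans_fuse: "\<lbrakk>A \<in> Ob C; B \<in> Ob C\<rbrakk> \<Longrightarrow> nat_trans [A, B] (\<lambda>V\<in>Ob C. asso_inv A B V) [A \<boxtimes> B]"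
  by (rule nat_trans_inverse[OF nat_trans_split]) auto

lemma nat_trans_ins: "nat_trans [] (\<lambda>V\<in>Ob C. lun_inv V) [Unit C]"
  by (rule nat_trans_inverse[OF nat_trans_del]) auto

lemma mor_Some:
  "isarr p \<Longrightarrow> dia (mor p) [src p] [tgt p]" "\<lbrakk>isarr p; V \<in> Ob C\<rbrakk> \<Longrightarrow> comp_at (mor p) V = p \<bowtie> ident V"
  using dia_Some[OF nat_trans_mor] by (simp_all add: mor_def)

lemma split_Some:
  "\<lbrakk>A \<in> Ob C; B \<in> Ob C\<rbrakk> \<Longrightarrow> dia (split A B) [A \<boxtimes> B] [A, B]"
  "\<lbrakk>A \<in> Ob C; B \<in> Ob C; V \<in> Ob C\<rbrakk> \<Longrightarrow> comp_at (split A B) V = asso A B V"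
  using dia_Some[OF nat_trans_split] by (simp_all add: split_def)

lemma fuse_Some:
  "\<lbrakk>A \<in> Ob C; B \<in> Ob C\<rbrakk> \<Longrightarrow> dia (fuse A B) [A, B] [A \<boxtimes> B]"
  "\<lbrakk>A \<in> Ob C; B \<in> Ob C; V \<in> Ob C\<rbrakk> \<Longrightarrow> comp_at (fuse A B) V = asso_inv A B V"
  using dia_Some[OF nat_trans_fuse] by (simp_all add: fuse_def)

lemma del_Some: "dia del [Unit C] []" "V \<in> Ob C \<Longrightarrow> comp_at del V = lun V"
  using dia_Some[OF nat_trans_del] by (simp_all add: del_def)

lemma ins_Some: "dia ins [] [Unit C]" "V \<in> Ob C \<Longrightarrow> comp_at ins V = lun_inv V"
  using dia_Some[OF nat_trans_ins] by (simp_all add: ins_def)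

lemma dia_mor: "\<lbrakk>isarr p; src p = A; tgt p = B\<rbrakk> \<Longrightarrow> dia (mor p) [A] [B]"
  by (drule mor_Some(1)) simp

lemmas dia_generators = dia_mor split_Some(1) fuse_Some(1) del_Some(1) ins_Some(1)

lemma whisk_Nil_generators [simp]:
  "isarr p \<Longrightarrow> whisk [] (mor p) [] = mor p"
  "\<lbrakk>A \<in> Ob C; B \<in> Ob C\<rbrakk> \<Longrightarrow> whisk [] (split A B) [] = split A B"
  "\<lbrakk>A \<in> Ob C; B \<in> Ob C\<rbrakk> \<Longrightarrow> whisk [] (fuse A B) [] = fuse A B"
  "whisk [] del [] = del" "whisk [] ins [] = ins" "whisk [] (did L) [] = did L"
  by (auto intro: whisk_Nil mor_Some(1) split_Some(1) fuse_Some(1) del_Some(1) ins_Some(1) simp: whisk_did)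

lemma dcomp2_eqI:
  assumes F: "dia F A B" "dia G B D" and F': "dia F' A B'" "dia G' B' D"
    and eq: "\<And>V. V \<in> Ob C \<Longrightarrow> comp_at G V \<star> comp_at F V = comp_at G' V \<star> comp_at F' V"
  shows "G \<bullet> F = G' \<bullet> F'"
  by (rule dia_eqI[OF dcomp_Some(1)[OF F] dcomp_Some(1)[OF F']])
    (simp add: dcomp_Some(2)[OF F] dcomp_Some(2)[OF F'] eq)

lemma dcomp1_eqI:
  assumes F: "dia F A B" "dia G B D" and F': "dia H A D"
    and eq: "\<And>V. V \<in> Ob C \<Longrightarrow> comp_at G V \<star> comp_at F V = comp_at H V"
  shows "G \<bullet> F = H"
  by (rule dia_eqI[OF dcomp_Some(1)[OF F] F']) (simp add: dcomp_Some(2)[OF F] eq)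

lemma mor_cmp:
  assumes [simp]: "isarr p" "isarr q" "src q = tgt p"
  shows "mor (q \<star> p) = mor q \<bullet> mor p"
  by (rule dcomp1_eqI[OF dia_mor dia_mor dia_mor, symmetric]) (simp_all add: mor_Some tens_cmp)

lemma mor_ident: "A \<in> Ob C \<Longrightarrow> mor (ident A) = did [A]"
  by (rule dia_eqI[OF dia_mor did_Some(1)]) (simp_all add: mor_Some did_Some)

lemma mor_smul: "isarr p \<Longrightarrow> mor (smul a p) = dscale a (mor p)"
  by (rule dia_eqI[OF dia_mor dscale_Some(1)[OF dia_mor]]) (simp_all add: mor_Some dscale_Some[OF dia_mor])

lemma split_fuse:
  assumes [simp]: "A \<in> Ob C" "B \<in> Ob C"
  shows "split A B \<bullet> fuse A B = did [A, B]" "fuse A B \<bullet> split A B = did [A \<boxtimes> B]"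
  by (rule dcomp1_eqI[OF fuse_Some(1) split_Some(1) did_Some(1)] dcomp1_eqI[OF split_Some(1) fuse_Some(1) did_Some(1)];
      simp add: split_Some fuse_Some did_Some)+

lemma del_ins: "del \<bullet> ins = did []" "ins \<bullet> del = did [Unit C]"
  by (rule dcomp1_eqI[OF ins_Some(1) del_Some(1) did_Some(1)] dcomp1_eqI[OF del_Some(1) ins_Some(1) did_Some(1)];
      simp add: del_Some ins_Some did_Some)+

lemma split_mor:
  assumes [simp]: "isarr p" "isarr q" "src p = A" "tgt p = A'" "src q = B" "tgt q = B'"
  shows "split A' B' \<bullet> mor (p \<bowtie> q) = whisk [] (mor p) [B'] \<bullet> whisk [A] (mor q) [] \<bullet> split A B"
proof -
  have [simp]: "A \<in> Ob C" "B \<in> Ob C" "A' \<in> Ob C" "B' \<in> Ob C"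
    using isarr_Ob[OF assms(1)] isarr_Ob[OF assms(2)] by simp_all
  have 1: "dia (whisk [] (mor p) [B']) [A, B'] [A', B']"
    using whisk_Some(1)[OF dia_mor[of p A A'], of "[]" "[B']"] by simp
  have 2: "dia (whisk [A] (mor q) []) [A, B] [A, B']"
    using whisk_Some(1)[OF dia_mor[of q B B'], of "[A]" "[]"] by simp
  have 3: "dia (whisk [A] (mor q) [] \<bullet> split A B) [A \<boxtimes> B] [A, B']"
    by (rule dcomp_Some(1)[OF split_Some(1) 2]) simp_all
  show ?thesis
  proof (rule dcomp2_eqI[OF dia_mor split_Some(1) 3 1])
    fix V assume [simp]: "V \<in> Ob C"
    have "(p \<bowtie> ident (B' \<boxtimes> V)) \<star> (ident A \<bowtie> q \<bowtie> ident V) \<star> asso A B V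
        = ((p \<bowtie> ident (B' \<boxtimes> V)) \<star> (ident A \<bowtie> q \<bowtie> ident V)) \<star> asso A B V" by simp
    also have "\<dots> = (p \<bowtie> q \<bowtie> ident V) \<star> asso A B V" by (subst tens_cmp) simp_all
    finally show "comp_at (split A' B') V \<star> comp_at (mor (p \<bowtie> q)) V
        = comp_at (whisk [] (mor p) [B']) V \<star> comp_at (whisk [A] (mor q) [] \<bullet> split A B) V"
      using asso_nat[of p q "ident V" A B V A' B' V]
      by (simp add: split_Some mor_Some dcomp_Some(2)[OF split_Some(1) 2] whisk_Some(2)[OF mor_Some(1)])
  qed simp_all
qed

lemma split_mor_left:
  "\<lbrakk>isarr p; src p = A; tgt p = A'; B \<in> Ob C\<rbrakk>
    \<Longrightarrow> split A' B \<bullet> mor (p \<bowtie> ident B) = whisk [] (mor p) [B] \<bullet> split A B"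
  using split_mor[of p "ident B" A A' B B] isarr_Ob[of p] dcomp_did(2)[OF split_Some(1), of A B]
  by (simp add: mor_ident whisk_did)

lemma split_mor_right:
  assumes "isarr q" "src q = B" "tgt q = B'" "A \<in> Ob C"
  shows "split A B' \<bullet> mor (ident A \<bowtie> q) = whisk [A] (mor q) [] \<bullet> split A B"
proof -
  have B: "B \<in> Ob C" "B' \<in> Ob C" using assms isarr_Ob[of q] by auto
  have "dia (whisk [A] (mor q) [] \<bullet> split A B) [A \<boxtimes> B] [A, B']"
    using assms B by - ((rule dia_intros dia_generators | simp)+)
  from dcomp_did(2)[OF this] show ?thesis
    using split_mor[of "ident A" q A A B B'] assms B by (simp add: mor_ident whisk_did)
qed

lemma split_pentagon:
  assumes [simp]: "A \<in> Ob C" "B \<in> Ob C" "D \<in> Ob C"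
  shows "whisk [A] (split B D) [] \<bullet> split A (B \<boxtimes> D) \<bullet> mor (asso A B D) = whisk [] (split A B) [D] \<bullet> split (A \<boxtimes> B) D"
proof -
  have 1: "dia (whisk [A] (split B D) []) [A, B \<boxtimes> D] [A, B, D]"
    using whisk_Some(1)[OF split_Some(1), of B D "[A]" "[]"] by simp
  have 2: "dia (whisk [] (split A B) [D]) [A \<boxtimes> B, D] [A, B, D]"
    using whisk_Some(1)[OF split_Some(1), of A B "[]" "[D]"] by simp
  have 3: "dia (mor (asso A B D)) [(A \<boxtimes> B) \<boxtimes> D] [A \<boxtimes> (B \<boxtimes> D)]"
    by (rule dia_mor) simp_all
  have 4: "dia (split A (B \<boxtimes> D)) [A \<boxtimes> (B \<boxtimes> D)] [A, B \<boxtimes> D]"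
    by (rule split_Some) simp_all
  show ?thesis
  proof (rule dcomp2_eqI[OF dcomp_Some(1)[OF 3 4] 1 split_Some(1) 2])
    fix V assume [simp]: "V \<in> Ob C"
    show "comp_at (whisk [A] (split B D) []) V \<star> comp_at (split A (B \<boxtimes> D) \<bullet> mor (asso A B D)) V =
      comp_at (whisk [] (split A B) [D]) V \<star> comp_at (split (A \<boxtimes> B) D) V"
      using pentagon_arr[of A B D V]
      by (simp add: split_Some mor_Some dcomp_Some(2)[OF 3 4] whisk_Some(2)[OF split_Some(1)])
  qed simp_all
qed

lemma split_triangle:
  assumes [simp]: "A \<in> Ob C"
  shows "whisk [A] del [] \<bullet> split A (Unit C) = mor (run A)" "whisk [] del [A] \<bullet> split (Unit C) A = mor (lun A)"
proof -
  have 1: "dia (whisk [A] del []) [A, Unit C] [A]"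
    using whisk_Some(1)[OF del_Some(1), of "[A]" "[]"] by simp
  have 2: "dia (whisk [] del [A]) [Unit C, A] [A]"
    using whisk_Some(1)[OF del_Some(1), of "[]" "[A]"] by simp
  show "whisk [A] del [] \<bullet> split A (Unit C) = mor (run A)"
    by (rule dcomp1_eqI[OF split_Some(1) 1 dia_mor])
      (simp_all add: split_Some whisk_Some(2)[OF del_Some(1)] del_Some mor_Some triangle_arr)
  show "whisk [] del [A] \<bullet> split (Unit C) A = mor (lun A)"
    by (rule dcomp1_eqI[OF split_Some(1) 2 dia_mor])
      (simp_all add: split_Some whisk_Some(2)[OF del_Some(1)] del_Some mor_Some lun_tens)
qed

text \<open>A transformation compatible with right tensoring is determined by its component at the
  unit object, as a module map is by the image of 1. Hence nothing is gained or lost on words of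
  length one, and statements about endomorphisms in \<open>C\<close>, such as Schur's lemma, apply
  to diagrams.\<close>

lemma mor_full:
  assumes F: "dia F [A] [B]"
  obtains p where "isarr p" "src p = A" "tgt p = B" "F = mor p"
proof
  let ?I = "Unit C" let ?p = "run B \<star> comp_at F ?I \<star> run_inv A"
  have [simp]: "A \<in> Ob C" "B \<in> Ob C" using dia_list[OF F] by auto
  note [simp] = dia_at(1-3)[OF F]
  show "isarr ?p" "src ?p = A" "tgt ?p = B" by simp_all
  show "F = mor ?p"
  proof (rule dia_eqI[OF F dia_mor])
    fix V assume [simp]: "V \<in> Ob C"
    \<comment> \<open>Naturality along \<open>lun V\<close> leads from the component at
      \<open>?I \<boxtimes> V\<close> to the one at \<open>V\<close>; compatibility with right
      tensoring by \<open>V\<close> leads to it from the one at \<open>?I\<close>.\<close>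
    have nat: "comp_at F V \<star> (ident A \<bowtie> lun V) = (ident B \<bowtie> lun V) \<star> comp_at F (?I \<boxtimes> V)"
      using dia_at(4)[OF F, of "lun V" "?I \<boxtimes> V" V] by simp
    have "comp_at F V \<star> (run A \<bowtie> ident V) = comp_at F V \<star> (ident A \<bowtie> lun V) \<star> asso A ?I V"
      by (simp add: triangle_arr)
    also have "\<dots> = (ident B \<bowtie> lun V) \<star> comp_at F (?I \<boxtimes> V) \<star> asso A ?I V"
      by (subst cmp_reassoc[OF nat]) simp_all
    also have "comp_at F (?I \<boxtimes> V) \<star> asso A ?I V = asso B ?I V \<star> (comp_at F ?I \<bowtie> ident V)"
      using dia_at(5)[OF F, of ?I V] by simp
    also have "(ident B \<bowtie> lun V) \<star> asso B ?I V \<star> (comp_at F ?I \<bowtie> ident V)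
        = (run B \<bowtie> ident V) \<star> (comp_at F ?I \<bowtie> ident V)"
      by (subst cmp_reassoc[OF triangle_arr]) simp_all
    finally have *: "comp_at F V \<star> (run A \<bowtie> ident V) = (run B \<bowtie> ident V) \<star> (comp_at F ?I \<bowtie> ident V)" .
    have "comp_at F V = comp_at F V \<star> ((run A \<bowtie> ident V) \<star> (run_inv A \<bowtie> ident V))"
      by (simp add: tens_cmp)
    also have "\<dots> = ((run B \<bowtie> ident V) \<star> (comp_at F ?I \<bowtie> ident V)) \<star> (run_inv A \<bowtie> ident V)"
      by (subst cmp_reassoc[OF *]) simp_all
    finally show "comp_at F V = comp_at (mor ?p) V"
      by (simp add: mor_Some tens_cmp)
  qed simp_all
qed

text \<open>Splitting one pair and fusing the other rebrackets three factors while leaving words of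
  length two, so an associator must appear. This is how the associators in the duality axioms and
  the hexagons are absorbed.\<close>

lemma assoc_slide:
  assumes [simp]: "A \<in> Ob C" "B \<in> Ob C" "D \<in> Ob C"
  shows "whisk [A] (fuse B D) [] \<bullet> whisk [] (split A B) [D] = split A (B \<boxtimes> D) \<bullet> mor (asso A B D) \<bullet> fuse (A \<boxtimes> B) D"
    "whisk [] (fuse A B) [D] \<bullet> whisk [A] (split B D) [] = split (A \<boxtimes> B) D \<bullet> mor (asso_inv A B D) \<bullet> fuse A (B \<boxtimes> D)"
proof -
  have d: "dia (split A (B \<boxtimes> D) \<bullet> mor (asso A B D) \<bullet> fuse (A \<boxtimes> B) D) [A \<boxtimes> B, D] [A, B \<boxtimes> D]"
    by (rule dia_intros dia_generators | simp)+
  have d2: "dia (whisk [] (split A B) [D]) [A \<boxtimes> B, D] [A, B, D]"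
    by (rule dia_intros(2)[OF split_Some(1)]) simp_all
  have d3: "dia (whisk [] (fuse A B) [D]) [A, B, D] [A \<boxtimes> B, D]"
    by (rule dia_intros(2)[OF fuse_Some(1)]) simp_all
  have d4: "dia (whisk [A] (split B D) []) [A, B \<boxtimes> D] [A, B, D]"
    by (rule dia_intros(2)[OF split_Some(1)]) simp_all
  have "whisk [A] (fuse B D) [] \<bullet> whisk [] (split A B) [D]
      = whisk [A] (fuse B D) [] \<bullet> (whisk [] (split A B) [D] \<bullet> split (A \<boxtimes> B) D) \<bullet> fuse (A \<boxtimes> B) D"
    using dcomp_did(1)[OF d2] by (simp add: dcomp_assoc split_fuse)
  also have "\<dots> = whisk [A] (fuse B D \<bullet> split B D) [] \<bullet> split A (B \<boxtimes> D) \<bullet> mor (asso A B D) \<bullet> fuse (A \<boxtimes> B) D"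
    by (subst split_pentagon[symmetric]) (simp_all add: strict)
  also have "\<dots> = split A (B \<boxtimes> D) \<bullet> mor (asso A B D) \<bullet> fuse (A \<boxtimes> B) D"
    using dcomp_did(2)[OF d] by (simp add: split_fuse whisk_did)
  finally show 1: "whisk [A] (fuse B D) [] \<bullet> whisk [] (split A B) [D]
      = split A (B \<boxtimes> D) \<bullet> mor (asso A B D) \<bullet> fuse (A \<boxtimes> B) D" .
  let ?s = "split (A \<boxtimes> B) D \<bullet> mor (asso_inv A B D) \<bullet> fuse A (B \<boxtimes> D)"
  have ds: "dia ?s [A, B \<boxtimes> D] [A \<boxtimes> B, D]"
    by (rule dia_intros dia_generators | simp)+
  have inv: "(split A (B \<boxtimes> D) \<bullet> mor (asso A B D) \<bullet> fuse (A \<boxtimes> B) D) \<bullet> ?s = did [A, B \<boxtimes> D]"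
  proof -
    have m: "dia (mor (asso_inv A B D)) [A \<boxtimes> (B \<boxtimes> D)] [(A \<boxtimes> B) \<boxtimes> D]"
      "dia (fuse A (B \<boxtimes> D)) [A, B \<boxtimes> D] [A \<boxtimes> (B \<boxtimes> D)]"
      by ((rule dia_intros dia_generators | simp)+)
    have "(split A (B \<boxtimes> D) \<bullet> mor (asso A B D) \<bullet> fuse (A \<boxtimes> B) D) \<bullet> ?s
      = split A (B \<boxtimes> D) \<bullet> mor (asso A B D) \<bullet> (fuse (A \<boxtimes> B) D \<bullet> split (A \<boxtimes> B) D) \<bullet> mor (asso_inv A B D) \<bullet> fuse A (B \<boxtimes> D)"
      by (simp add: strict)
    also have "\<dots> = split A (B \<boxtimes> D) \<bullet> (mor (asso A B D) \<bullet> mor (asso_inv A B D)) \<bullet> fuse A (B \<boxtimes> D)"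
      using dcomp_did(2)[OF dcomp_Some(1)[OF m(2,1)]] by (simp add: split_fuse strict)
    also have "\<dots> = did [A, B \<boxtimes> D]"
      using dcomp_did(2)[OF m(2)] by (simp add: mor_cmp[symmetric] mor_ident split_fuse)
    finally show ?thesis .
  qed
  \<comment> \<open>The composite of the first identity's right side with its inverse is inserted,
    so the second identity follows from the first.\<close>
  have "whisk [] (fuse A B) [D] \<bullet> whisk [A] (split B D) []
     = whisk [] (fuse A B) [D] \<bullet> whisk [A] (split B D) [] \<bullet> (split A (B \<boxtimes> D) \<bullet> mor (asso A B D) \<bullet> fuse (A \<boxtimes> B) D) \<bullet> ?s"
    using dcomp_did(1)[OF dcomp_Some(1)[OF d4 d3]] by (subst inv) (simp add: dcomp_assoc)
  also have "\<dots> = whisk [] (fuse A B) [D] \<bullet> whisk [A] (split B D \<bullet> fuse B D) [] \<bullet> whisk [] (split A B) [D] \<bullet> ?s"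
    by (subst 1[symmetric]) (simp add: strict)
  also have "\<dots> = whisk [] (fuse A B) [D] \<bullet> (did [A, B, D] \<bullet> whisk [] (split A B) [D]) \<bullet> ?s"
    by (simp add: split_fuse whisk_did dcomp_assoc)
  also have "\<dots> = whisk [] (fuse A B \<bullet> split A B) [D] \<bullet> ?s"
    by (simp only: dcomp_did(2)[OF d2] whisk_dcomp dcomp_assoc)
  also have "\<dots> = ?s" using dcomp_did(2)[OF ds] by (simp add: split_fuse whisk_did)
  finally show "whisk [] (fuse A B) [D] \<bullet> whisk [A] (split B D) [] = ?s" .
qed

lemma mor_fuse_left:
  assumes "isarr p" "src p = A" "tgt p = A'" "B \<in> Ob C"
  shows "mor (p \<bowtie> ident B) \<bullet> fuse A B = fuse A' B \<bullet> whisk [] (mor p) [B]"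
proof -
  have [simp]: "A \<in> Ob C" "A' \<in> Ob C" "B \<in> Ob C" using assms isarr_Ob[of p] by auto
  have 1: "dia (mor (p \<bowtie> ident B) \<bullet> fuse A B) [A, B] [A' \<boxtimes> B]"
    using assms by - ((rule dia_intros dia_generators | simp)+)
  have 2: "dia (whisk [] (mor p) [B]) [A, B] [A', B]"
    by (rule dia_intros(2)[OF dia_mor]) (use assms in simp_all)
  have "mor (p \<bowtie> ident B) \<bullet> fuse A B = fuse A' B \<bullet> (split A' B \<bullet> mor (p \<bowtie> ident B)) \<bullet> fuse A B"
    using dcomp_did(2)[OF 1] by (simp add: dcomp_assoc[symmetric] split_fuse)
  also have "\<dots> = fuse A' B \<bullet> whisk [] (mor p) [B] \<bullet> split A B \<bullet> fuse A B"
    by (subst split_mor_left[OF assms]) (simp add: strict)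
  finally show ?thesis using dcomp_did(1)[OF 2] by (simp add: split_fuse)
qed

lemma mor_fuse_right:
  assumes "isarr q" "src q = B" "tgt q = B'" "A \<in> Ob C"
  shows "mor (ident A \<bowtie> q) \<bullet> fuse A B = fuse A B' \<bullet> whisk [A] (mor q) []"
proof -
  have [simp]: "A \<in> Ob C" "B \<in> Ob C" "B' \<in> Ob C" using assms isarr_Ob[of q] by auto
  have 1: "dia (mor (ident A \<bowtie> q) \<bullet> fuse A B) [A, B] [A \<boxtimes> B']"
    using assms by - ((rule dia_intros dia_generators | simp)+)
  have 2: "dia (whisk [A] (mor q) []) [A, B] [A, B']"
    by (rule dia_intros(2)[OF dia_mor]) (use assms in simp_all)
  have "mor (ident A \<bowtie> q) \<bullet> fuse A B = fuse A B' \<bullet> (split A B' \<bullet> mor (ident A \<bowtie> q)) \<bullet> fuse A B"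
    using dcomp_did(2)[OF 1] by (simp add: dcomp_assoc[symmetric] split_fuse)
  also have "\<dots> = fuse A B' \<bullet> whisk [A] (mor q) [] \<bullet> split A B \<bullet> fuse A B"
    by (subst split_mor_right[OF assms]) (simp add: strict)
  finally show ?thesis using dcomp_did(1)[OF 2] by (simp add: split_fuse)
qed

lemma fuse_ins:
  assumes [simp]: "A \<in> Ob C"
  shows "fuse A (Unit C) \<bullet> whisk [A] ins [] = mor (run_inv A)" "fuse (Unit C) A \<bullet> whisk [] ins [A] = mor (lun_inv A)"
proof -
  have 1: "dia (fuse A (Unit C) \<bullet> whisk [A] ins []) [A] [A \<boxtimes> Unit C]"
    by (rule dia_intros(1)[OF dia_intros(2)[OF ins_Some(1)] fuse_Some(1)]) simp_all
  have 2: "dia (fuse (Unit C) A \<bullet> whisk [] ins [A]) [A] [Unit C \<boxtimes> A]"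
    by (rule dia_intros(1)[OF dia_intros(2)[OF ins_Some(1)] fuse_Some(1)]) simp_all
  have 3: "dia (whisk [A] ins []) [A] [A, Unit C]" "dia (whisk [] ins [A]) [A] [Unit C, A]"
    by (rule dia_intros(2)[OF ins_Some(1)]; simp)+
  have "fuse A (Unit C) \<bullet> whisk [A] ins [] = mor (run_inv A \<star> run A) \<bullet> fuse A (Unit C) \<bullet> whisk [A] ins []"
    using dcomp_did(2)[OF 1] by (simp add: mor_ident)
  also have "\<dots> = mor (run_inv A) \<bullet> mor (run A) \<bullet> fuse A (Unit C) \<bullet> whisk [A] ins []"
    by (subst mor_cmp) (simp_all add: strict)
  also have "\<dots> = mor (run_inv A) \<bullet> whisk [A] del [] \<bullet> (split A (Unit C) \<bullet> fuse A (Unit C)) \<bullet> whisk [A] ins []"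
    by (subst split_triangle(1)[symmetric]) (simp_all add: strict)
  also have "\<dots> = mor (run_inv A) \<bullet> whisk [A] (del \<bullet> ins) []"
    using dcomp_did(2)[OF 3(1)] by (simp add: split_fuse whisk_dcomp)
  also have "\<dots> = mor (run_inv A)"
    using dcomp_did(1)[OF dia_mor[of "run_inv A"]] by (simp add: del_ins whisk_did)
  finally show "fuse A (Unit C) \<bullet> whisk [A] ins [] = mor (run_inv A)" .
  have "fuse (Unit C) A \<bullet> whisk [] ins [A] = mor (lun_inv A \<star> lun A) \<bullet> fuse (Unit C) A \<bullet> whisk [] ins [A]"
    using dcomp_did(2)[OF 2] by (simp add: mor_ident)
  also have "\<dots> = mor (lun_inv A) \<bullet> mor (lun A) \<bullet> fuse (Unit C) A \<bullet> whisk [] ins [A]"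
    by (subst mor_cmp) (simp_all add: strict)
  also have "\<dots> = mor (lun_inv A) \<bullet> whisk [] del [A] \<bullet> (split (Unit C) A \<bullet> fuse (Unit C) A) \<bullet> whisk [] ins [A]"
    by (subst split_triangle(2)[symmetric]) (simp_all add: strict)
  also have "\<dots> = mor (lun_inv A) \<bullet> whisk [] (del \<bullet> ins) [A]"
    using dcomp_did(2)[OF 3(2)] by (simp add: split_fuse whisk_dcomp)
  also have "\<dots> = mor (lun_inv A)"
    using dcomp_did(1)[OF dia_mor[of "lun_inv A"]] by (simp add: del_ins whisk_did)
  finally show "fuse (Unit C) A \<bullet> whisk [] ins [A] = mor (lun_inv A)" .
qed

end

section \<open>Duality as snake identities\<close>

context rigid_monoidal_category
begin

definition ev_arr :: "'o \<Rightarrow> 'o \<times> 'm \<times> 'o" where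
  "ev_arr X = (dual C X \<boxtimes> X, ev C X, Unit C)"
definition coev_arr :: "'o \<Rightarrow> 'o \<times> 'm \<times> 'o" where
  "coev_arr X = (Unit C, coev C X, X \<boxtimes> dual C X)"

lemma dual_Ob [simp]: "X \<in> Ob C \<Longrightarrow> dual C X \<in> Ob C"
  using left_dual[of X] by (simp add: is_left_dual_def)

lemma ev_arr_simps [simp]:
  "src (ev_arr X) = dual C X \<boxtimes> X" "tgt (ev_arr X) = Unit C" "X \<in> Ob C \<Longrightarrow> isarr (ev_arr X)"
  "src (coev_arr X) = Unit C" "tgt (coev_arr X) = X \<boxtimes> dual C X" "X \<in> Ob C \<Longrightarrow> isarr (coev_arr X)"
  using left_dual[of X] by (auto simp: ev_arr_def coev_arr_def isarr_triple is_left_dual_def)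

lemma zigzag_arr:
  assumes "X \<in> Ob C"
  shows "run X \<star> (ident X \<bowtie> ev_arr X) \<star> asso X (dual C X) X \<star> (coev_arr X \<bowtie> ident X) = lun X"
    "lun (dual C X) \<star> (ev_arr X \<bowtie> ident (dual C X)) \<star> asso_inv (dual C X) X (dual C X)
      \<star> (ident (dual C X) \<bowtie> coev_arr X) = run (dual C X)"
  using left_dual[of X] assms
  by (auto simp: ev_arr_def coev_arr_def is_left_dual_def intro!: src_mid_tgt_eqI)

definition cap :: "'o \<Rightarrow> ('o, 'm) nat_family" where
  "cap X = del \<bullet> mor (ev_arr X) \<bullet> fuse (dual C X) X"
definition cup :: "'o \<Rightarrow> ('o, 'm) nat_family" where
  "cup X = split X (dual C X) \<bullet> mor (coev_arr X) \<bullet> ins"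

lemma dia_cap: "X \<in> Ob C \<Longrightarrow> dia (cap X) [dual C X, X] []"
  unfolding cap_def by (rule dia_intros dia_generators | simp)+

lemma dia_cup: "X \<in> Ob C \<Longrightarrow> dia (cup X) [] [X, dual C X]"
  unfolding cup_def by (rule dia_intros dia_generators | simp)+

text \<open>Unfolding \<open>cap\<close> and \<open>cup\<close> leaves one misplaced pair of
  \<open>fuse\<close> and \<open>split\<close>, which \<open>assoc_slide\<close> turns into the
  associator of the duality axiom, while \<open>split_triangle\<close> and \<open>fuse_ins\<close>
  supply its unit constraints. In the strict category only the bare snake remains.\<close>

lemma zigzag:
  assumes [simp]: "X \<in> Ob C"
  shows "whisk [X] (cap X) [] \<bullet> whisk [] (cup X) [X] = did [X]"
    "whisk [] (cap X) [dual C X] \<bullet> whisk [dual C X] (cup X) [] = did [dual C X]"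
proof -
  let ?D = "dual C X" let ?I = "Unit C"
  have "whisk [X] (cap X) [] \<bullet> whisk [] (cup X) [X]
     = whisk [X] del [] \<bullet> whisk [X] (mor (ev_arr X)) [] \<bullet> (whisk [X] (fuse ?D X) [] \<bullet> whisk [] (split X ?D) [X])
       \<bullet> whisk [] (mor (coev_arr X)) [X] \<bullet> whisk [] ins [X]"
    by (simp add: cap_def cup_def strict)
  also have "\<dots> = whisk [X] del [] \<bullet> (whisk [X] (mor (ev_arr X)) [] \<bullet> split X (?D \<boxtimes> X)) \<bullet> mor (asso X ?D X)
      \<bullet> (fuse (X \<boxtimes> ?D) X \<bullet> whisk [] (mor (coev_arr X)) [X]) \<bullet> whisk [] ins [X]"
    by (simp add: assoc_slide(1) dcomp_assoc)
  also have "\<dots> = (whisk [X] del [] \<bullet> split X ?I) \<bullet> mor (ident X \<bowtie> ev_arr X) \<bullet> mor (asso X ?D X)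
      \<bullet> mor (coev_arr X \<bowtie> ident X) \<bullet> (fuse ?I X \<bullet> whisk [] ins [X])"
    by (subst split_mor_right[symmetric, of "ev_arr X" "?D \<boxtimes> X" ?I], simp_all)
      (subst mor_fuse_left[symmetric, of "coev_arr X" ?I], simp_all add: dcomp_assoc)
  also have "\<dots> = mor (run X \<star> (ident X \<bowtie> ev_arr X) \<star> asso X ?D X \<star> (coev_arr X \<bowtie> ident X) \<star> lun_inv X)"
    by (simp add: split_triangle fuse_ins mor_cmp dcomp_assoc)
  also have "run X \<star> (ident X \<bowtie> ev_arr X) \<star> asso X ?D X \<star> (coev_arr X \<bowtie> ident X) \<star> lun_inv X
     = (run X \<star> (ident X \<bowtie> ev_arr X) \<star> asso X ?D X \<star> (coev_arr X \<bowtie> ident X)) \<star> lun_inv X" by simp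
  also have "\<dots> = ident X" by (simp only: zigzag_arr(1)[OF assms]) simp
  finally show "whisk [X] (cap X) [] \<bullet> whisk [] (cup X) [X] = did [X]" by (simp add: mor_ident)
  have "whisk [] (cap X) [?D] \<bullet> whisk [?D] (cup X) []
     = whisk [] del [?D] \<bullet> whisk [] (mor (ev_arr X)) [?D] \<bullet> (whisk [] (fuse ?D X) [?D] \<bullet> whisk [?D] (split X ?D) [])
       \<bullet> whisk [?D] (mor (coev_arr X)) [] \<bullet> whisk [?D] ins []"
    by (simp add: cap_def cup_def strict)
  also have "\<dots> = whisk [] del [?D] \<bullet> (whisk [] (mor (ev_arr X)) [?D] \<bullet> split (?D \<boxtimes> X) ?D) \<bullet> mor (asso_inv ?D X ?D)
      \<bullet> (fuse ?D (X \<boxtimes> ?D) \<bullet> whisk [?D] (mor (coev_arr X)) []) \<bullet> whisk [?D] ins []"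
    by (simp add: assoc_slide(2) dcomp_assoc)
  also have "\<dots> = (whisk [] del [?D] \<bullet> split ?I ?D) \<bullet> mor (ev_arr X \<bowtie> ident ?D) \<bullet> mor (asso_inv ?D X ?D)
      \<bullet> mor (ident ?D \<bowtie> coev_arr X) \<bullet> (fuse ?D ?I \<bullet> whisk [?D] ins [])"
    by (subst split_mor_left[symmetric, of "ev_arr X" "?D \<boxtimes> X" ?I], simp_all)
      (subst mor_fuse_right[symmetric, of "coev_arr X" ?I], simp_all add: dcomp_assoc)
  also have "\<dots> = mor (lun ?D \<star> (ev_arr X \<bowtie> ident ?D) \<star> asso_inv ?D X ?D \<star> (ident ?D \<bowtie> coev_arr X) \<star> run_inv ?D)"
    by (simp add: split_triangle fuse_ins mor_cmp dcomp_assoc)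
  also have "lun ?D \<star> (ev_arr X \<bowtie> ident ?D) \<star> asso_inv ?D X ?D \<star> (ident ?D \<bowtie> coev_arr X) \<star> run_inv ?D
     = (lun ?D \<star> (ev_arr X \<bowtie> ident ?D) \<star> asso_inv ?D X ?D \<star> (ident ?D \<bowtie> coev_arr X)) \<star> run_inv ?D" by simp
  also have "\<dots> = ident ?D" by (simp only: zigzag_arr(2)[OF assms]) simp
  finally show "whisk [] (cap X) [?D] \<bullet> whisk [?D] (cup X) [] = did [?D]" by (simp add: mor_ident)
qed

end

section \<open>The braiding\<close>

context braided_fusion_category
begin

definition braid_arr :: "'o \<Rightarrow> 'o \<Rightarrow> 'o \<times> 'm \<times> 'o" where
  "braid_arr X Y = (X \<boxtimes> Y, braiding C X Y, Y \<boxtimes> X)"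
definition braid_inv_arr :: "'o \<Rightarrow> 'o \<Rightarrow> 'o \<times> 'm \<times> 'o" where
  "braid_inv_arr X Y = (Y \<boxtimes> X, inverse_mor C (X \<boxtimes> Y) (Y \<boxtimes> X) (braiding C X Y), X \<boxtimes> Y)"

lemma braid_arr_simps [simp]:
  "src (braid_arr X Y) = X \<boxtimes> Y" "tgt (braid_arr X Y) = Y \<boxtimes> X"
  "src (braid_inv_arr X Y) = Y \<boxtimes> X" "tgt (braid_inv_arr X Y) = X \<boxtimes> Y"
  "\<lbrakk>X \<in> Ob C; Y \<in> Ob C\<rbrakk> \<Longrightarrow> isarr (braid_arr X Y)"
  "\<lbrakk>X \<in> Ob C; Y \<in> Ob C\<rbrakk> \<Longrightarrow> isarr (braid_inv_arr X Y)"
  "\<lbrakk>X \<in> Ob C; Y \<in> Ob C\<rbrakk> \<Longrightarrow> braid_inv_arr X Y \<star> braid_arr X Y = ident (X \<boxtimes> Y)"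
  "\<lbrakk>X \<in> Ob C; Y \<in> Ob C\<rbrakk> \<Longrightarrow> braid_arr X Y \<star> braid_inv_arr X Y = ident (Y \<boxtimes> X)"
  using braiding_iso[of X Y] inverse_mor_props[OF _ _ braiding_iso[of X Y]]
  by (auto simp: braid_arr_def braid_inv_arr_def isarr_triple is_iso_def intro!: src_mid_tgt_eqI)

lemma braid_arr_nat:
  "\<lbrakk>isarr p; isarr q; src p = A; tgt p = A'; src q = B; tgt q = B'\<rbrakk>
    \<Longrightarrow> braid_arr A' B' \<star> (p \<bowtie> q) = (q \<bowtie> p) \<star> braid_arr A B"
  using braiding_natural[of A A' B B' "mid p" "mid q"]
  by (auto simp: braid_arr_def isarr_def simp del: isarr_Ob intro!: src_mid_tgt_eqI)

lemma hexagon_arr: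
  assumes "X \<in> Ob C" "Y \<in> Ob C" "Z \<in> Ob C"
  shows "asso Y Z X \<star> braid_arr X (Y \<boxtimes> Z) \<star> asso X Y Z
      = (ident Y \<bowtie> braid_arr X Z) \<star> asso Y X Z \<star> (braid_arr X Y \<bowtie> ident Z)"
    "asso_inv Z X Y \<star> braid_arr (X \<boxtimes> Y) Z \<star> asso_inv X Y Z
      = (braid_arr X Z \<bowtie> ident Y) \<star> asso_inv X Z Y \<star> (ident X \<bowtie> braid_arr Y Z)"
  using hexagon1[of X Y Z] hexagon2[of X Y Z] assms
  by (auto simp: braid_arr_def intro!: src_mid_tgt_eqI)

definition cross :: "'o \<Rightarrow> 'o \<Rightarrow> ('o, 'm) nat_family" where
  "cross X Y = split Y X \<bullet> mor (braid_arr X Y) \<bullet> fuse X Y"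
definition cross_inv :: "'o \<Rightarrow> 'o \<Rightarrow> ('o, 'm) nat_family" where
  "cross_inv X Y = split X Y \<bullet> mor (braid_inv_arr X Y) \<bullet> fuse Y X"

lemma dia_cross: "\<lbrakk>X \<in> Ob C; Y \<in> Ob C\<rbrakk> \<Longrightarrow> dia (cross X Y) [X, Y] [Y, X]"
  unfolding cross_def by (rule dia_intros dia_generators | simp)+

lemma dia_cross_inv: "\<lbrakk>X \<in> Ob C; Y \<in> Ob C\<rbrakk> \<Longrightarrow> dia (cross_inv X Y) [Y, X] [X, Y]"
  unfolding cross_inv_def by (rule dia_intros dia_generators | simp)+

lemmas dia_rules = dia_intros dia_generators dia_cap dia_cup dia_cross dia_cross_inv

lemma cross_fuse:
  assumes [simp]: "X \<in> Ob C" "Y \<in> Ob C"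
  shows "cross X Y \<bullet> split X Y = split Y X \<bullet> mor (braid_arr X Y)"
  using dcomp_did(1)[OF dia_mor[of "braid_arr X Y"]] by (simp add: cross_def dcomp_assoc split_fuse)

lemma cross_cross_inv:
  assumes [simp]: "X \<in> Ob C" "Y \<in> Ob C"
  shows "cross_inv X Y \<bullet> cross X Y = did [X, Y]"
proof -
  have d: "dia (fuse X Y) [X, Y] [X \<boxtimes> Y]" "dia (mor (braid_arr X Y) \<bullet> fuse X Y) [X, Y] [Y \<boxtimes> X]"
    by ((rule dia_rules | simp)+)
  have "cross_inv X Y \<bullet> cross X Y
      = split X Y \<bullet> mor (braid_inv_arr X Y) \<bullet> (fuse Y X \<bullet> split Y X) \<bullet> mor (braid_arr X Y) \<bullet> fuse X Y"
    by (simp add: cross_def cross_inv_def dcomp_assoc)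
  also have "\<dots> = split X Y \<bullet> (mor (braid_inv_arr X Y) \<bullet> mor (braid_arr X Y)) \<bullet> fuse X Y"
    using dcomp_did(2)[OF d(2)] by (simp add: split_fuse dcomp_assoc)
  also have "\<dots> = did [X, Y]"
    using dcomp_did(2)[OF d(1)] by (simp add: mor_cmp[symmetric] mor_ident split_fuse)
  finally show ?thesis .
qed

lemma cross_mor_right:
  assumes [simp]: "X \<in> Ob C" and p [simp]: "isarr p" "src p = A" "tgt p = B"
  shows "cross X B \<bullet> whisk [X] (mor p) [] = whisk [] (mor p) [X] \<bullet> cross X A"
proof -
  have [simp]: "A \<in> Ob C" "B \<in> Ob C" using isarr_Ob[of p] by simp_all
  have "cross X B \<bullet> whisk [X] (mor p) [] = split B X \<bullet> (mor (braid_arr X B) \<bullet> mor (ident X \<bowtie> p)) \<bullet> fuse X A"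
    by (simp add: cross_def dcomp_assoc mor_fuse_right[OF p])
  also have "\<dots> = (split B X \<bullet> mor (p \<bowtie> ident X)) \<bullet> mor (braid_arr X A) \<bullet> fuse X A"
    using braid_arr_nat[of "ident X" p X X A B] by (simp add: mor_cmp[symmetric]) (simp add: mor_cmp dcomp_assoc)
  finally show ?thesis by (simp add: split_mor_left[OF p] cross_def dcomp_assoc)
qed

lemma cross_mor_left:
  assumes [simp]: "X \<in> Ob C" and p [simp]: "isarr p" "src p = A" "tgt p = B"
  shows "cross B X \<bullet> whisk [] (mor p) [X] = whisk [X] (mor p) [] \<bullet> cross A X"
proof -
  have [simp]: "A \<in> Ob C" "B \<in> Ob C" using isarr_Ob[of p] by simp_all
  have "cross B X \<bullet> whisk [] (mor p) [X] = split X B \<bullet> (mor (braid_arr B X) \<bullet> mor (p \<bowtie> ident X)) \<bullet> fuse A X"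
    by (simp add: cross_def dcomp_assoc mor_fuse_left[OF p])
  also have "\<dots> = (split X B \<bullet> mor (ident X \<bowtie> p)) \<bullet> mor (braid_arr A X) \<bullet> fuse A X"
    using braid_arr_nat[of p "ident X" A B X X] by (simp add: mor_cmp[symmetric]) (simp add: mor_cmp dcomp_assoc)
  finally show ?thesis by (simp add: split_mor_right[OF p] cross_def dcomp_assoc)
qed

lemma fuse_asso:
  assumes [simp]: "A \<in> Ob C" "B \<in> Ob C" "D \<in> Ob C"
  shows "fuse A (B \<boxtimes> D) = mor (asso A B D) \<bullet> fuse (A \<boxtimes> B) D \<bullet> whisk [] (fuse A B) [D] \<bullet> whisk [A] (split B D) []"
    "fuse (A \<boxtimes> B) D = mor (asso_inv A B D) \<bullet> fuse A (B \<boxtimes> D) \<bullet> whisk [A] (fuse B D) [] \<bullet> whisk [] (split A B) [D]"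
proof -
  have d: "dia (fuse A (B \<boxtimes> D)) [A, B \<boxtimes> D] [A \<boxtimes> (B \<boxtimes> D)]"
    "dia (fuse (A \<boxtimes> B) D) [A \<boxtimes> B, D] [(A \<boxtimes> B) \<boxtimes> D]"
    "dia (mor (asso_inv A B D) \<bullet> fuse A (B \<boxtimes> D)) [A, B \<boxtimes> D] [(A \<boxtimes> B) \<boxtimes> D]"
    "dia (mor (asso A B D) \<bullet> fuse (A \<boxtimes> B) D) [A \<boxtimes> B, D] [A \<boxtimes> (B \<boxtimes> D)]"
    by ((rule dia_rules | simp)+)
  have "mor (asso A B D) \<bullet> fuse (A \<boxtimes> B) D \<bullet> whisk [] (fuse A B) [D] \<bullet> whisk [A] (split B D) []
     = mor (asso A B D) \<bullet> (fuse (A \<boxtimes> B) D \<bullet> split (A \<boxtimes> B) D) \<bullet> mor (asso_inv A B D) \<bullet> fuse A (B \<boxtimes> D)"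
    by (simp add: assoc_slide(2) dcomp_assoc)
  also have "\<dots> = (mor (asso A B D) \<bullet> mor (asso_inv A B D)) \<bullet> fuse A (B \<boxtimes> D)"
    using dcomp_did(2)[OF d(3)] by (simp add: split_fuse dcomp_assoc)
  also have "\<dots> = fuse A (B \<boxtimes> D)"
    using dcomp_did(2)[OF d(1)] by (simp add: mor_cmp[symmetric] mor_ident)
  finally show "fuse A (B \<boxtimes> D) = mor (asso A B D) \<bullet> fuse (A \<boxtimes> B) D \<bullet> whisk [] (fuse A B) [D] \<bullet> whisk [A] (split B D) []"
    by (rule sym)
  have "mor (asso_inv A B D) \<bullet> fuse A (B \<boxtimes> D) \<bullet> whisk [A] (fuse B D) [] \<bullet> whisk [] (split A B) [D]
     = mor (asso_inv A B D) \<bullet> (fuse A (B \<boxtimes> D) \<bullet> split A (B \<boxtimes> D)) \<bullet> mor (asso A B D) \<bullet> fuse (A \<boxtimes> B) D"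
    by (simp add: assoc_slide(1) dcomp_assoc)
  also have "\<dots> = (mor (asso_inv A B D) \<bullet> mor (asso A B D)) \<bullet> fuse (A \<boxtimes> B) D"
    using dcomp_did(2)[OF d(4)] by (simp add: split_fuse dcomp_assoc)
  also have "\<dots> = fuse (A \<boxtimes> B) D"
    using dcomp_did(2)[OF d(2)] by (simp add: mor_cmp[symmetric] mor_ident)
  finally show "fuse (A \<boxtimes> B) D = mor (asso_inv A B D) \<bullet> fuse A (B \<boxtimes> D) \<bullet> whisk [A] (fuse B D) [] \<bullet> whisk [] (split A B) [D]"
    by (rule sym)
qed

lemma split_pentagon_inv:
  assumes [simp]: "A \<in> Ob C" "B \<in> Ob C" "D \<in> Ob C"
  shows "whisk [A] (split B D) [] \<bullet> split A (B \<boxtimes> D) = whisk [] (split A B) [D] \<bullet> split (A \<boxtimes> B) D \<bullet> mor (asso_inv A B D)"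
proof -
  have "dia (split A (B \<boxtimes> D)) [A \<boxtimes> (B \<boxtimes> D)] [A, B \<boxtimes> D]"
    by ((rule dia_rules | simp)+)
  from dcomp_did(1)[OF this]
  have "whisk [A] (split B D) [] \<bullet> split A (B \<boxtimes> D)
     = whisk [A] (split B D) [] \<bullet> split A (B \<boxtimes> D) \<bullet> mor (asso A B D) \<bullet> mor (asso_inv A B D)"
    by (simp add: mor_cmp[symmetric] mor_ident)
  also have "\<dots> = (whisk [A] (split B D) [] \<bullet> split A (B \<boxtimes> D) \<bullet> mor (asso A B D)) \<bullet> mor (asso_inv A B D)"
    by (simp add: dcomp_assoc)
  finally show ?thesis by (simp add: split_pentagon dcomp_assoc)
qed

text \<open>The first hexagon without associators: a product is crossed by crossing its factors one
  after the other.\<close>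

lemma cross_split_right:
  assumes [simp]: "X \<in> Ob C" "Y \<in> Ob C" "Z \<in> Ob C"
  shows "whisk [Y] (cross X Z) [] \<bullet> whisk [] (cross X Y) [Z] \<bullet> whisk [X] (split Y Z) []
    = whisk [] (split Y Z) [X] \<bullet> cross X (Y \<boxtimes> Z)"
proof -
  have "whisk [] (split Y Z) [X] \<bullet> cross X (Y \<boxtimes> Z)
     = (whisk [] (split Y Z) [X] \<bullet> split (Y \<boxtimes> Z) X) \<bullet> mor (braid_arr X (Y \<boxtimes> Z)) \<bullet> fuse X (Y \<boxtimes> Z)"
    by (simp add: cross_def dcomp_assoc)
  also have "\<dots> = whisk [Y] (split Z X) [] \<bullet> split Y (Z \<boxtimes> X) \<bullet> (mor (asso Y Z X) \<bullet> mor (braid_arr X (Y \<boxtimes> Z)) \<bullet> mor (asso X Y Z))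
      \<bullet> fuse (X \<boxtimes> Y) Z \<bullet> whisk [] (fuse X Y) [Z] \<bullet> whisk [X] (split Y Z) []"
    by (subst split_pentagon[symmetric], simp_all) (subst fuse_asso(1), simp_all add: dcomp_assoc)
  also have "mor (asso Y Z X) \<bullet> mor (braid_arr X (Y \<boxtimes> Z)) \<bullet> mor (asso X Y Z)
     = mor (ident Y \<bowtie> braid_arr X Z) \<bullet> mor (asso Y X Z) \<bullet> mor (braid_arr X Y \<bowtie> ident Z)"
    by (simp add: mor_cmp[symmetric] hexagon_arr(1))
  also have "whisk [Y] (split Z X) [] \<bullet> split Y (Z \<boxtimes> X) \<bullet> (mor (ident Y \<bowtie> braid_arr X Z) \<bullet> mor (asso Y X Z)
      \<bullet> mor (braid_arr X Y \<bowtie> ident Z)) \<bullet> fuse (X \<boxtimes> Y) Z \<bullet> whisk [] (fuse X Y) [Z] \<bullet> whisk [X] (split Y Z) []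
    = whisk [Y] (split Z X) [] \<bullet> (split Y (Z \<boxtimes> X) \<bullet> mor (ident Y \<bowtie> braid_arr X Z)) \<bullet> mor (asso Y X Z)
      \<bullet> (mor (braid_arr X Y \<bowtie> ident Z) \<bullet> fuse (X \<boxtimes> Y) Z) \<bullet> whisk [] (fuse X Y) [Z] \<bullet> whisk [X] (split Y Z) []"
    by (simp add: dcomp_assoc)
  also have "\<dots> = whisk [Y] (split Z X) [] \<bullet> whisk [Y] (mor (braid_arr X Z)) [] \<bullet> (split Y (X \<boxtimes> Z) \<bullet> mor (asso Y X Z)
      \<bullet> fuse (Y \<boxtimes> X) Z) \<bullet> whisk [] (mor (braid_arr X Y)) [Z] \<bullet> whisk [] (fuse X Y) [Z] \<bullet> whisk [X] (split Y Z) []"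
    by (simp add: split_mor_right[of "braid_arr X Z" "X \<boxtimes> Z" "Z \<boxtimes> X"] mor_fuse_left[of "braid_arr X Y" "X \<boxtimes> Y" "Y \<boxtimes> X"] dcomp_assoc)
  also have "\<dots> = whisk [Y] (cross X Z) [] \<bullet> whisk [] (cross X Y) [Z] \<bullet> whisk [X] (split Y Z) []"
    by (simp add: assoc_slide(1)[symmetric] cross_def strict)
  finally show ?thesis by (rule sym)
qed

text \<open>The second hexagon. It allows a loop labelled by a product to be followed strand by
  strand.\<close>

lemma cross_split_left:
  assumes [simp]: "X \<in> Ob C" "Y \<in> Ob C" "Z \<in> Ob C"
  shows "whisk [] (cross X Z) [Y] \<bullet> whisk [X] (cross Y Z) [] \<bullet> whisk [] (split X Y) [Z]
    = whisk [Z] (split X Y) [] \<bullet> cross (X \<boxtimes> Y) Z"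
proof -
  have "whisk [Z] (split X Y) [] \<bullet> cross (X \<boxtimes> Y) Z
     = (whisk [Z] (split X Y) [] \<bullet> split Z (X \<boxtimes> Y)) \<bullet> mor (braid_arr (X \<boxtimes> Y) Z) \<bullet> fuse (X \<boxtimes> Y) Z"
    by (simp add: cross_def dcomp_assoc)
  also have "\<dots> = whisk [] (split Z X) [Y] \<bullet> split (Z \<boxtimes> X) Y \<bullet> (mor (asso_inv Z X Y) \<bullet> mor (braid_arr (X \<boxtimes> Y) Z) \<bullet> mor (asso_inv X Y Z))
      \<bullet> fuse X (Y \<boxtimes> Z) \<bullet> whisk [X] (fuse Y Z) [] \<bullet> whisk [] (split X Y) [Z]"
    by (subst split_pentagon_inv, simp_all) (subst fuse_asso(2), simp_all add: dcomp_assoc)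
  also have "mor (asso_inv Z X Y) \<bullet> mor (braid_arr (X \<boxtimes> Y) Z) \<bullet> mor (asso_inv X Y Z)
     = mor (braid_arr X Z \<bowtie> ident Y) \<bullet> mor (asso_inv X Z Y) \<bullet> mor (ident X \<bowtie> braid_arr Y Z)"
    by (simp add: mor_cmp[symmetric] hexagon_arr(2))
  also have "whisk [] (split Z X) [Y] \<bullet> split (Z \<boxtimes> X) Y \<bullet> (mor (braid_arr X Z \<bowtie> ident Y) \<bullet> mor (asso_inv X Z Y)
      \<bullet> mor (ident X \<bowtie> braid_arr Y Z)) \<bullet> fuse X (Y \<boxtimes> Z) \<bullet> whisk [X] (fuse Y Z) [] \<bullet> whisk [] (split X Y) [Z]
    = whisk [] (split Z X) [Y] \<bullet> (split (Z \<boxtimes> X) Y \<bullet> mor (braid_arr X Z \<bowtie> ident Y)) \<bullet> mor (asso_inv X Z Y)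
      \<bullet> (mor (ident X \<bowtie> braid_arr Y Z) \<bullet> fuse X (Y \<boxtimes> Z)) \<bullet> whisk [X] (fuse Y Z) [] \<bullet> whisk [] (split X Y) [Z]"
    by (simp add: dcomp_assoc)
  also have "\<dots> = whisk [] (split Z X) [Y] \<bullet> whisk [] (mor (braid_arr X Z)) [Y] \<bullet> (split (X \<boxtimes> Z) Y \<bullet> mor (asso_inv X Z Y)
      \<bullet> fuse X (Z \<boxtimes> Y)) \<bullet> whisk [X] (mor (braid_arr Y Z)) [] \<bullet> whisk [X] (fuse Y Z) [] \<bullet> whisk [] (split X Y) [Z]"
    by (simp add: split_mor_left[of "braid_arr X Z" "X \<boxtimes> Z" "Z \<boxtimes> X"] mor_fuse_right[of "braid_arr Y Z" "Y \<boxtimes> Z" "Z \<boxtimes> Y"] dcomp_assoc)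
  also have "\<dots> = whisk [] (cross X Z) [Y] \<bullet> whisk [X] (cross Y Z) [] \<bullet> whisk [] (split X Y) [Z]"
    by (simp add: assoc_slide(2)[symmetric] cross_def strict)
  finally show ?thesis by (rule sym)
qed

text \<open>An arrow is recovered from its product with a unit strand by inserting that strand
  before and deleting it after.\<close>

lemma whisk_unit_faithful:
  assumes F: "dia F A B" and G: "dia G A B" and eq: "whisk [] F [Unit C] = whisk [] G [Unit C]"
  shows "F = G"
proof -
  have *: "H = whisk B del [] \<bullet> whisk [] H [Unit C] \<bullet> whisk A ins []" if H: "dia H A B" for H
  proof -
    have [simp]: "set A \<subseteq> Ob C" "set B \<subseteq> Ob C" using dia_list[OF H] by auto
    have "whisk [] H [Unit C] \<bullet> whisk A ins [] = whisk B ins [] \<bullet> H"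
      using interchange[OF H ins_Some(1), of "[]" "[]" "[]"] whisk_Nil[OF H] by simp
    then show ?thesis
      using dcomp_did(2)[OF H] by (simp add: dcomp_assoc[symmetric] whisk_dcomp[symmetric] del_ins whisk_did)
  qed
  show ?thesis using *[OF F] *[OF G] eq by simp
qed

text \<open>By naturality and the hexagon, \<open>(del \<otimes> X) \<circ> cross X 1 \<circ> (X \<otimes> ins)\<close> is an invertible idempotent.\<close>

lemma cross_unit:
  assumes [simp]: "X \<in> Ob C"
  shows "whisk [] del [X] \<bullet> cross X (Unit C) = whisk [X] del []"
proof -
  let ?I = "Unit C" let ?c = "cross X ?I"
  have d: "dia (whisk [] del [X] \<bullet> ?c) [X, ?I] [X]" "dia (whisk [X] del []) [X, ?I] [X]"
    "dia (whisk [X] del [?I]) [X, ?I, ?I] [X, ?I]"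
    "dia (whisk [] (whisk [] del [X] \<bullet> ?c) [?I]) [X, ?I, ?I] [X, ?I]"
    "dia (whisk [X] del [?I]) [X, ?I, ?I] [X, ?I]" "dia (?c \<bullet> whisk [X] del [?I]) [X, ?I, ?I] [?I, X]"
    "dia (?c \<bullet> whisk [] (whisk [] del [X] \<bullet> ?c) [?I]) [X, ?I, ?I] [?I, X]"
    "dia (whisk [X] (split ?I ?I) []) [X, ?I \<boxtimes> ?I] [X, ?I, ?I]"
    by ((rule dia_rules | simp)+)
  \<comment> \<open>Two ways of removing the first of two units are compared: deleting it before the
    crossing, and crossing both units by the hexagon before deleting it. They agree by naturality
    along \<open>lun\<close> at the unit object.\<close>
  have "(?c \<bullet> whisk [X] del [?I]) \<bullet> whisk [X] (split ?I ?I) [] = ?c \<bullet> whisk [X] (whisk [] del [?I] \<bullet> split ?I ?I) []"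
    by (simp add: strict)
  also have "\<dots> = whisk [] (whisk [] del [?I] \<bullet> split ?I ?I) [X] \<bullet> cross X (?I \<boxtimes> ?I)"
    by (simp add: split_triangle cross_mor_right[of X "lun ?I" "?I \<boxtimes> ?I" ?I])
  also have "\<dots> = whisk [] del [?I, X] \<bullet> (whisk [] (split ?I ?I) [X] \<bullet> cross X (?I \<boxtimes> ?I))"
    by (simp add: strict)
  also have "\<dots> = (whisk [] del [?I, X] \<bullet> whisk [?I] ?c []) \<bullet> whisk [] ?c [?I] \<bullet> whisk [X] (split ?I ?I) []"
    by (subst cross_split_right[symmetric]) (simp_all add: dcomp_assoc)
  also have "whisk [] del [?I, X] \<bullet> whisk [?I] ?c [] = ?c \<bullet> whisk [] del [X, ?I]"
    using interchange[OF del_Some(1) dia_cross[of X ?I], of "[]" "[]" "[]"] whisk_Nil[OF dia_cross[of X ?I]] by simp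
  also have "(?c \<bullet> whisk [] del [X, ?I]) \<bullet> whisk [] ?c [?I] \<bullet> whisk [X] (split ?I ?I) []
     = (?c \<bullet> whisk [] (whisk [] del [X] \<bullet> ?c) [?I]) \<bullet> whisk [X] (split ?I ?I) []"
    by (simp add: strict)
  finally have "((?c \<bullet> whisk [X] del [?I]) \<bullet> whisk [X] (split ?I ?I) []) \<bullet> whisk [X] (fuse ?I ?I) []
     = ((?c \<bullet> whisk [] (whisk [] del [X] \<bullet> ?c) [?I]) \<bullet> whisk [X] (split ?I ?I) []) \<bullet> whisk [X] (fuse ?I ?I) []"
    by simp
  then have "(?c \<bullet> whisk [X] del [?I]) \<bullet> whisk [X] (split ?I ?I \<bullet> fuse ?I ?I) []
     = (?c \<bullet> whisk [] (whisk [] del [X] \<bullet> ?c) [?I]) \<bullet> whisk [X] (split ?I ?I \<bullet> fuse ?I ?I) []"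
    by (simp only: strict)
  then have "?c \<bullet> whisk [X] del [?I] = ?c \<bullet> whisk [] (whisk [] del [X] \<bullet> ?c) [?I]"
    using dcomp_did(1)[OF d(6)] dcomp_did(1)[OF d(7)] by (simp only: split_fuse Unit_Ob whisk_did append.simps append_Nil2)
  \<comment> \<open>One crossing is cancelled because it is invertible; what remains carries an idle
    unit strand, which \<open>whisk_unit_faithful\<close> removes.\<close>
  then have "(cross_inv X ?I \<bullet> ?c) \<bullet> whisk [X] del [?I] = (cross_inv X ?I \<bullet> ?c) \<bullet> whisk [] (whisk [] del [X] \<bullet> ?c) [?I]"
    by (simp only: dcomp_assoc)
  then have "whisk [X] del [?I] = whisk [] (whisk [] del [X] \<bullet> ?c) [?I]"
    using dcomp_did(2)[OF d(3)] dcomp_did(2)[OF d(4)] by (simp only: cross_cross_inv assms Unit_Ob)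
  then have "whisk [] (whisk [X] del []) [?I] = whisk [] (whisk [] del [X] \<bullet> ?c) [?I]"
    by (simp add: whisk_whisk)
  then show ?thesis using whisk_unit_faithful[OF d(2,1)] by simp
qed

section \<open>Naturality of the braiding for arrows between words\<close>

fun over :: "'o \<Rightarrow> 'o list \<Rightarrow> ('o, 'm) nat_family" where
  "over X [] = did [X]"
| "over X (Y # L) = whisk [Y] (over X L) [] \<bullet> whisk [] (cross X Y) L"

lemma dia_over: "\<lbrakk>X \<in> Ob C; set L \<subseteq> Ob C\<rbrakk> \<Longrightarrow> dia (over X L) (X # L) (L @ [X])"
proof (induction L)
  case (Cons Y L)
  then have 1: "dia (over X L) (X # L) (L @ [X])" by simp
  have 2: "dia (whisk [Y] (over X L) []) (Y # X # L) (Y # L @ [X])"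
    by (rule dia_intros(2)[OF 1]) (use Cons.prems in auto)
  have 3: "dia (whisk [] (cross X Y) L) (X # Y # L) (Y # X # L)"
    by (rule dia_intros(2)[OF dia_cross]) (use Cons.prems in auto)
  show ?case using dcomp_Some(1)[OF 3 2] by simp
qed (auto intro: did_Some)

lemma over_singleton [simp]:
  assumes [simp]: "X \<in> Ob C" "Y \<in> Ob C" shows "over X [Y] = cross X Y"
  using whisk_Nil[OF dia_cross[of X Y]] dcomp_did(2)[OF dia_cross[of X Y]] by (simp add: whisk_did)

declare over.simps(2) [simp del]

text \<open>The naturality square as a property of \<open>F\<close>, so that it can be propagated
  from generators by closure under composition, inversion and whiskering.\<close>

definition slides :: "'o \<Rightarrow> ('o, 'm) nat_family \<Rightarrow> 'o list \<Rightarrow> 'o list \<Rightarrow> bool" where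
  "slides X F A B \<longleftrightarrow> dia F A B \<and> over X B \<bullet> whisk [X] F [] = whisk [] F [X] \<bullet> over X A"

lemma slides_dcomp:
  assumes "slides X F A B" "slides X G B D"
  shows "slides X (G \<bullet> F) A D"
proof -
  have F: "dia F A B" "over X B \<bullet> whisk [X] F [] = whisk [] F [X] \<bullet> over X A"
    and G: "dia G B D" "over X D \<bullet> whisk [X] G [] = whisk [] G [X] \<bullet> over X B"
    using assms by (auto simp: slides_def)
  have "over X D \<bullet> whisk [X] (G \<bullet> F) [] = whisk [] G [X] \<bullet> over X B \<bullet> whisk [X] F []"
    using dcomp_reassoc[OF G(2)] by (simp add: strict)
  then show ?thesis using dcomp_Some(1)[OF F(1) G(1)] F(2) by (simp add: slides_def strict)
qed

text \<open>Conjugation of the square for \<open>F\<close> by \<open>G\<close>; it serves the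
  inverses of \<open>unbracket\<close>.\<close>

lemma slides_inverse:
  assumes X [simp]: "X \<in> Ob C" and F: "slides X F A B" and G: "dia G B A"
    and inv: "G \<bullet> F = did A" "F \<bullet> G = did B"
  shows "slides X G B A"
proof -
  have F: "dia F A B" "over X B \<bullet> whisk [X] F [] = whisk [] F [X] \<bullet> over X A"
    using F by (auto simp: slides_def)
  have [simp]: "set A \<subseteq> Ob C" "set B \<subseteq> Ob C" using dia_list[OF F(1)] by auto
  have oA: "dia (over X A) (X # A) (A @ [X])" and oB: "dia (over X B) (X # B) (B @ [X])"
    by (simp_all add: dia_over)
  have w: "dia (whisk [X] G []) (X # B) (X # A)"
    by (rule dia_intros(2)[OF G]) simp_all
  have "over X A \<bullet> whisk [X] G [] = whisk [] (G \<bullet> F) [X] \<bullet> over X A \<bullet> whisk [X] G []"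
    using dcomp_did(2)[OF dcomp_Some(1)[OF w oA]] by (simp add: inv whisk_did)
  also have "\<dots> = whisk [] G [X] \<bullet> (whisk [] F [X] \<bullet> over X A) \<bullet> whisk [X] G []"
    by (simp add: strict)
  also have "\<dots> = whisk [] G [X] \<bullet> over X B \<bullet> whisk [X] (F \<bullet> G) []"
    by (subst F(2)[symmetric]) (simp add: strict)
  also have "\<dots> = whisk [] G [X] \<bullet> over X B"
    using dcomp_did(1)[OF oB] by (simp add: inv whisk_did)
  finally show ?thesis using G by (simp add: slides_def)
qed

lemma slides_whisk_left:
  assumes X [simp]: "X \<in> Ob C" "Y \<in> Ob C" and F: "slides X F A B"
  shows "slides X (whisk [Y] F []) (Y # A) (Y # B)"
proof -
  have F: "dia F A B" "over X B \<bullet> whisk [X] F [] = whisk [] F [X] \<bullet> over X A"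
    using F by (auto simp: slides_def)
  have "over X (Y # B) \<bullet> whisk [X] (whisk [Y] F []) []
      = whisk [Y] (over X B) [] \<bullet> (whisk [] (cross X Y) B \<bullet> whisk [X, Y] F [])"
    by (simp add: over.simps(2) strict)
  also have "whisk [] (cross X Y) B \<bullet> whisk [X, Y] F [] = whisk [Y, X] F [] \<bullet> whisk [] (cross X Y) A"
    using interchange[OF dia_cross[of X Y] F(1), of "[]" "[]" "[]"] by simp
  also have "whisk [Y] (over X B) [] \<bullet> whisk [Y, X] F [] \<bullet> whisk [] (cross X Y) A
      = whisk [Y] (over X B \<bullet> whisk [X] F []) [] \<bullet> whisk [] (cross X Y) A"
    by (simp add: over.simps(2) strict)
  also have "\<dots> = whisk [] (whisk [Y] F []) [X] \<bullet> over X (Y # A)"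
    by (subst F(2)) (simp add: over.simps(2) strict)
  finally show ?thesis
    using dia_intros(2)[OF F(1), of "[Y]" "[]"] by (simp add: slides_def)
qed

text \<open>The three squares are naturality of the braiding, the first hexagon, and
  \<open>cross_unit\<close>.\<close>

lemma slides_generators:
  assumes [simp]: "X \<in> Ob C"
  shows "\<lbrakk>isarr p; src p = A; tgt p = B\<rbrakk> \<Longrightarrow> slides X (mor p) [A] [B]"
    "\<lbrakk>A \<in> Ob C; B \<in> Ob C\<rbrakk> \<Longrightarrow> slides X (split A B) [A \<boxtimes> B] [A, B]"
    "slides X del [Unit C] []"
proof -
  show "slides X (mor p) [A] [B]" if p: "isarr p" "src p = A" "tgt p = B"
    using cross_mor_right[OF assms p] isarr_Ob[of p] p dia_mor[OF p] by (auto simp: slides_def)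
  show "slides X (split A B) [A \<boxtimes> B] [A, B]" if [simp]: "A \<in> Ob C" "B \<in> Ob C"
  proof -
    have "over X [A, B] = whisk [A] (cross X B) [] \<bullet> whisk [] (cross X A) [B]"
      by (subst over.simps) (simp only: over_singleton assms that)
    then show ?thesis
      using cross_split_right[of X A B] split_Some(1)[of A B] by (simp add: slides_def dcomp_assoc)
  qed
  have "dia (whisk [X] del []) [X, Unit C] [X]" by ((rule dia_rules | simp)+)
  from dcomp_did(2)[OF this] show "slides X del [Unit C] []"
    using cross_unit[of X] del_Some(1) by (simp add: slides_def)
qed

text \<open>Every arrow is conjugate to an arrow of \<open>C\<close> by means of these isomorphisms.\<close>

fun bracket :: "'o list \<Rightarrow> 'o" where
  "bracket [] = Unit C"
| "bracket (X # L) = X \<boxtimes> bracket L"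

fun unbracket :: "'o list \<Rightarrow> ('o, 'm) nat_family" where
  "unbracket [] = del"
| "unbracket (X # L) = whisk [X] (unbracket L) [] \<bullet> split X (bracket L)"

lemma bracket_Ob [simp]: "set L \<subseteq> Ob C \<Longrightarrow> bracket L \<in> Ob C"
  by (induction L) auto

lemma unbracket_iso:
  "set L \<subseteq> Ob C \<Longrightarrow> dia (unbracket L) [bracket L] L \<and>
    (\<exists>G. dia G L [bracket L] \<and> G \<bullet> unbracket L = did [bracket L] \<and> unbracket L \<bullet> G = did L)"
proof (induction L)
  case Nil
  then show ?case using del_Some(1) ins_Some(1) del_ins by auto
next
  case (Cons X L)
  then have [simp]: "X \<in> Ob C" "set L \<subseteq> Ob C" by auto
  from Cons obtain G where u: "dia (unbracket L) [bracket L] L" and G: "dia G L [bracket L]"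
    and inv: "G \<bullet> unbracket L = did [bracket L]" "unbracket L \<bullet> G = did L" by auto
  have 1: "dia (whisk [X] (unbracket L) []) [X, bracket L] (X # L)"
    by (rule dia_intros(2)[OF u]) simp_all
  have 2: "dia (whisk [X] G []) (X # L) [X, bracket L]"
    by (rule dia_intros(2)[OF G]) simp_all
  have 3: "dia (split X (bracket L)) [X \<boxtimes> bracket L] [X, bracket L]"
    "dia (fuse X (bracket L)) [X, bracket L] [X \<boxtimes> bracket L]"
    by (simp_all add: split_Some fuse_Some)
  have 4: "(fuse X (bracket L) \<bullet> whisk [X] G []) \<bullet> unbracket (X # L) = did [bracket (X # L)]"
  proof -
    have "(fuse X (bracket L) \<bullet> whisk [X] G []) \<bullet> unbracket (X # L)
        = fuse X (bracket L) \<bullet> whisk [X] (G \<bullet> unbracket L) [] \<bullet> split X (bracket L)"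
      by (simp add: strict)
    then show ?thesis using dcomp_did(2)[OF 3(1)] by (simp add: inv whisk_did split_fuse)
  qed
  have 5: "unbracket (X # L) \<bullet> fuse X (bracket L) \<bullet> whisk [X] G [] = did (X # L)"
  proof -
    have "unbracket (X # L) \<bullet> fuse X (bracket L) \<bullet> whisk [X] G []
        = whisk [X] (unbracket L) [] \<bullet> (split X (bracket L) \<bullet> fuse X (bracket L)) \<bullet> whisk [X] G []"
      by (simp add: strict)
    also have "\<dots> = whisk [X] (unbracket L \<bullet> G) []"
      using dcomp_did(2)[OF 2] by (simp add: split_fuse whisk_dcomp)
    finally show ?thesis by (simp add: inv whisk_did)
  qed
  show ?case
    using dcomp_Some(1)[OF 3(1) 1] dcomp_Some(1)[OF 2 3(2)] 4 5 by (simp del: append.simps) blast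
qed

text \<open>After bracketing both ends, \<open>F\<close> becomes an arrow between words of length
  one, hence some \<open>mor p\<close> by fullness. Every bracketing ends in a unit object, so the
  square for \<open>del\<close> enters even for nonempty words.\<close>

lemma slides_all:
  assumes X [simp]: "X \<in> Ob C" and F: "dia F A B"
  shows "slides X F A B"
proof -
  have u: "slides X (unbracket L) [bracket L] L" if "set L \<subseteq> Ob C" for L
    using that
  proof (induction L)
    case (Cons Y L)
    then show ?case
      using slides_dcomp[OF slides_generators(2)[of X Y "bracket L"] slides_whisk_left[of X Y]] by simp
  qed (simp add: slides_generators)
  have [simp]: "set A \<subseteq> Ob C" "set B \<subseteq> Ob C" using dia_list[OF F] by auto
  obtain G where G: "dia G A [bracket A]" "G \<bullet> unbracket A = did [bracket A]" "unbracket A \<bullet> G = did A"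
    using unbracket_iso[of A] by auto
  obtain H where H: "dia H B [bracket B]" "H \<bullet> unbracket B = did [bracket B]" "unbracket B \<bullet> H = did B"
    using unbracket_iso[of B] by auto
  have d: "dia (H \<bullet> F \<bullet> unbracket A) [bracket A] [bracket B]"
    using unbracket_iso[of A] F H(1) by (auto intro: dcomp_Some(1))
  then obtain p where p: "isarr p" "src p = bracket A" "tgt p = bracket B" "H \<bullet> F \<bullet> unbracket A = mor p"
    by (rule mor_full)
  have "unbracket B \<bullet> mor p \<bullet> G = (unbracket B \<bullet> H) \<bullet> F \<bullet> (unbracket A \<bullet> G)"
    by (simp only: p(4)[symmetric] dcomp_assoc)
  then have "F = unbracket B \<bullet> mor p \<bullet> G"
    using dcomp_did[OF F] by (simp add: G H)
  moreover have "slides X (unbracket B \<bullet> mor p \<bullet> G) A B"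
    by (rule slides_dcomp[OF slides_dcomp[OF slides_inverse[OF X u G] slides_generators(1)[OF X p(1-3)]] u])
      simp_all
  ultimately show ?thesis by simp
qed

lemma over_nat:
  assumes "X \<in> Ob C" "dia F A B"
  shows "over X B \<bullet> whisk [X] F [] = whisk [] F [X] \<bullet> over X A"
  using slides_all[OF assms] by (simp add: slides_def)

end

section \<open>Partial traces\<close>

context ribbon_fusion_category
begin

definition twist_arr :: "'a \<Rightarrow> 'a \<times> 'b \<times> 'a" where
  "twist_arr X = (X, twist C X, X)"

lemma twist_arr_simps [simp]:
  "src (twist_arr X) = X" "tgt (twist_arr X) = X" "X \<in> Ob C \<Longrightarrow> isarr (twist_arr X)"
  using twist_iso[of X] by (auto simp: twist_arr_def isarr_triple is_iso_def)

lemma twist_arr_nat: "\<lbrakk>isarr p; src p = A; tgt p = B\<rbrakk> \<Longrightarrow> twist_arr B \<star> p = p \<star> twist_arr A"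
  using twist_natural[of A B "mid p"]
  by (auto simp: twist_arr_def isarr_def simp del: isarr_Ob intro!: src_mid_tgt_eqI)

lemma balancing_arr:
  "\<lbrakk>X \<in> Ob C; Y \<in> Ob C\<rbrakk> \<Longrightarrow>
    twist_arr (X \<boxtimes> Y) = (twist_arr X \<bowtie> twist_arr Y) \<star> braid_arr Y X \<star> braid_arr X Y"
  using balancing[of X Y] by (auto simp: twist_arr_def braid_arr_def intro!: src_mid_tgt_eqI)

lemma dia_twist: "X \<in> Ob C \<Longrightarrow> dia (mor (twist_arr X)) [X] [X]"
  by (rule dia_mor) simp_all

text \<open>Balancing on two strands: the twist of a product consists of the twists of both factors
  and a full turn of the strands around each other.\<close>

lemma split_twist:
  assumes [simp]: "X \<in> Ob C" "Z \<in> Ob C"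
  shows "split X Z \<bullet> mor (twist_arr (X \<boxtimes> Z))
    = whisk [] (mor (twist_arr X)) [Z] \<bullet> whisk [X] (mor (twist_arr Z)) [] \<bullet> cross Z X \<bullet> cross X Z \<bullet> split X Z"
proof -
  have "split X Z \<bullet> mor (twist_arr (X \<boxtimes> Z))
    = (split X Z \<bullet> mor (twist_arr X \<bowtie> twist_arr Z)) \<bullet> mor (braid_arr Z X) \<bullet> mor (braid_arr X Z)"
    by (simp add: balancing_arr mor_cmp dcomp_assoc)
  also have "\<dots> = whisk [] (mor (twist_arr X)) [Z] \<bullet> whisk [X] (mor (twist_arr Z)) [] \<bullet> cross Z X \<bullet> (split Z X \<bullet> mor (braid_arr X Z))"
    by (simp add: split_mor[of _ _ X X Z Z] dcomp_assoc) (simp add: dcomp_reassoc[OF cross_fuse[symmetric]] dcomp_assoc)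
  finally show ?thesis by (simp add: cross_fuse[symmetric])
qed

text \<open>A cup with its legs exchanged, which can be closed off by \<open>cap\<close>. The
  crossing stands for the Drinfeld isomorphism and the twist completes the spherical structure, as
  in \<open>quantum_trace\<close>.\<close>

definition rcup :: "'a \<Rightarrow> ('a, 'b) nat_family" where
  "rcup X = whisk [dual C X] (mor (twist_arr X)) [] \<bullet> cross X (dual C X) \<bullet> cup X"

lemma dia_rcup: "X \<in> Ob C \<Longrightarrow> dia (rcup X) [] [dual C X, X]"
  unfolding rcup_def by (rule dia_rules | simp)+

text \<open>The partial trace over the first tensor factor; \<open>V\<close> lists the remaining ones.\<close>

definition ptr :: "'a \<Rightarrow> 'a list \<Rightarrow> ('a, 'b) nat_family \<Rightarrow> ('a, 'b) nat_family" where
  "ptr X V G = whisk [] (cap X) V \<bullet> whisk [dual C X] G [] \<bullet> whisk [] (rcup X) V"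

lemma ptr_whisk: "ptr X (V @ N) (whisk [] G N) = whisk [] (ptr X V G) N"
  by (simp add: ptr_def strict)

lemma ptr_dscale: "ptr X V (dscale a G) = dscale a (ptr X V G)"
  by (simp add: ptr_def whisk_dscale dscale_laws)

text \<open>What touches only the remaining strands leaves the loop by \<open>interchange\<close>
  with \<open>cap\<close> and \<open>rcup\<close>.\<close>

lemma ptr_conj:
  assumes [simp]: "X \<in> Ob C" and u: "dia u W V" and v: "dia v V W"
  shows "ptr X V (whisk [X] u [] \<bullet> G \<bullet> whisk [X] v []) = u \<bullet> ptr X W G \<bullet> v"
proof -
  have u': "whisk [] (cap X) V \<bullet> whisk [dual C X, X] u [] = u \<bullet> whisk [] (cap X) W"
    using interchange[OF dia_cap[of X] u, of "[]" "[]" "[]"] whisk_Nil[OF u] by simp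
  have v': "whisk [] (rcup X) W \<bullet> v = whisk [dual C X, X] v [] \<bullet> whisk [] (rcup X) V"
    using interchange[OF dia_rcup[of X] v, of "[]" "[]" "[]"] whisk_Nil[OF v] by simp
  have "ptr X V (whisk [X] u [] \<bullet> G \<bullet> whisk [X] v [])
      = (whisk [] (cap X) V \<bullet> whisk [dual C X, X] u []) \<bullet> whisk [dual C X] G []
        \<bullet> (whisk [dual C X, X] v [] \<bullet> whisk [] (rcup X) V)"
    by (simp add: ptr_def strict)
  then show ?thesis by (simp add: u' v'[symmetric] ptr_def dcomp_assoc)
qed

text \<open>The transpose \<open>t\<close> of \<open>f\<close> carries \<open>f\<close> around the loop.\<close>

lemma ptr_cyclic:
  assumes f [simp]: "isarr f" "src f = X" "tgt f = Y" and h: "dia h (Y # V) (X # V)"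
  shows "ptr X V (h \<bullet> whisk [] (mor f) V) = ptr Y V (whisk [] (mor f) V \<bullet> h)"
proof -
  have [simp]: "X \<in> Ob C" "Y \<in> Ob C" using isarr_Ob[of f] by simp_all
  let ?D = "dual C X" and ?E = "dual C Y"
  define t where "t = whisk [] (cap Y) [?D] \<bullet> whisk [?E] (mor f) [?D] \<bullet> whisk [?E] (cup X) []"
  have t: "dia t [?E] [?D]" unfolding t_def by (rule dia_rules | simp)+
  have df: "dia (mor f) [X] [Y]" by (rule dia_mor) simp_all
  have cap_t: "cap X \<bullet> whisk [] t [X] = cap Y \<bullet> whisk [?E] (mor f) []"
  proof -
    have "cap X \<bullet> whisk [] t [X] = (cap X \<bullet> whisk [] (cap Y) [?D, X]) \<bullet> whisk [?E] (mor f) [?D, X] \<bullet> whisk [?E] (cup X) [X]"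
      by (simp add: t_def strict)
    also have "cap X \<bullet> whisk [] (cap Y) [?D, X] = cap Y \<bullet> whisk [?E, Y] (cap X) []"
      using interchange[OF dia_cap[of Y] dia_cap[of X], of "[]" "[]" "[]"]
        whisk_Nil[OF dia_cap[of X]] whisk_Nil[OF dia_cap[of Y]] by simp
    also have "(cap Y \<bullet> whisk [?E, Y] (cap X) []) \<bullet> whisk [?E] (mor f) [?D, X] \<bullet> whisk [?E] (cup X) [X]
      = cap Y \<bullet> whisk [?E] (whisk [Y] (cap X) [] \<bullet> whisk [] (mor f) [?D, X]) [] \<bullet> whisk [?E] (cup X) [X]"
      by (simp add: strict)
    also have "whisk [Y] (cap X) [] \<bullet> whisk [] (mor f) [?D, X] = mor f \<bullet> whisk [X] (cap X) []"
      using interchange[OF df dia_cap[of X], of "[]" "[]" "[]"] by simp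
    also have "cap Y \<bullet> whisk [?E] (mor f \<bullet> whisk [X] (cap X) []) [] \<bullet> whisk [?E] (cup X) [X]
      = cap Y \<bullet> whisk [?E] (mor f \<bullet> (whisk [X] (cap X) [] \<bullet> whisk [] (cup X) [X])) []"
      by (simp add: strict)
    also have "\<dots> = cap Y \<bullet> whisk [?E] (mor f) []"
      using dcomp_did(1)[OF df] by (simp add: zigzag)
    finally show ?thesis .
  qed
  have cup_t: "whisk [Y] t [] \<bullet> cup Y = whisk [] (mor f) [?D] \<bullet> cup X"
  proof -
    have d: "dia (whisk [] (mor f) [?D] \<bullet> cup X) [] [Y, ?D]" by (rule dia_rules | simp)+
    have "whisk [Y] t [] \<bullet> cup Y
      = whisk [Y] (cap Y) [?D] \<bullet> (whisk [Y, ?E] (whisk [] (mor f) [?D] \<bullet> cup X) [] \<bullet> cup Y)"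
      by (simp add: t_def strict)
    also have "whisk [Y, ?E] (whisk [] (mor f) [?D] \<bullet> cup X) [] \<bullet> cup Y
      = whisk [] (cup Y) [Y, ?D] \<bullet> whisk [] (mor f) [?D] \<bullet> cup X"
      using interchange[OF dia_cup[of Y] d, of "[]" "[]" "[]"] whisk_Nil[OF dia_cup[of Y]] whisk_Nil[OF d] by simp
    also have "whisk [Y] (cap Y) [?D] \<bullet> whisk [] (cup Y) [Y, ?D] \<bullet> whisk [] (mor f) [?D] \<bullet> cup X
      = whisk [] (whisk [Y] (cap Y) [] \<bullet> whisk [] (cup Y) [Y]) [?D] \<bullet> whisk [] (mor f) [?D] \<bullet> cup X"
      by (simp add: strict)
    also have "\<dots> = whisk [] (mor f) [?D] \<bullet> cup X"
      using dcomp_did(2)[OF d] by (simp add: zigzag whisk_did)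
    finally show ?thesis .
  qed
  \<comment> \<open>The twist is passed by its naturality. The crossing now has \<open>t\<close> on
    the dual strand, so \<open>over_nat\<close> is used for it.\<close>
  have rcup_t: "whisk [?D] (mor f) [] \<bullet> rcup X = whisk [] t [Y] \<bullet> rcup Y"
  proof -
    have "whisk [?D] (mor f) [] \<bullet> rcup X = whisk [?D] (mor f \<bullet> mor (twist_arr X)) [] \<bullet> cross X ?D \<bullet> cup X"
      by (simp add: rcup_def strict)
    also have "mor f \<bullet> mor (twist_arr X) = mor (twist_arr Y) \<bullet> mor f"
      by (simp add: mor_cmp[symmetric] twist_arr_nat[of f X Y])
    also have "whisk [?D] (mor (twist_arr Y) \<bullet> mor f) [] \<bullet> cross X ?D \<bullet> cup X
      = whisk [?D] (mor (twist_arr Y)) [] \<bullet> (whisk [?D] (mor f) [] \<bullet> cross X ?D) \<bullet> cup X"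
      by (simp add: strict)
    also have "whisk [?D] (mor f) [] \<bullet> cross X ?D = cross Y ?D \<bullet> whisk [] (mor f) [?D]"
      by (simp add: cross_mor_left[of ?D f X Y])
    also have "whisk [?D] (mor (twist_arr Y)) [] \<bullet> (cross Y ?D \<bullet> whisk [] (mor f) [?D]) \<bullet> cup X
      = whisk [?D] (mor (twist_arr Y)) [] \<bullet> (cross Y ?D \<bullet> whisk [Y] t []) \<bullet> cup Y"
      by (simp add: dcomp_assoc cup_t)
    also have "cross Y ?D \<bullet> whisk [Y] t [] = whisk [] t [Y] \<bullet> cross Y ?E"
      using over_nat[of Y t "[?E]" "[?D]"] t by simp
    also have "whisk [?D] (mor (twist_arr Y)) [] \<bullet> (whisk [] t [Y] \<bullet> cross Y ?E) \<bullet> cup Y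
      = (whisk [?D] (mor (twist_arr Y)) [] \<bullet> whisk [] t [Y]) \<bullet> cross Y ?E \<bullet> cup Y"
      by (simp add: dcomp_assoc)
    also have "whisk [?D] (mor (twist_arr Y)) [] \<bullet> whisk [] t [Y] = whisk [] t [Y] \<bullet> whisk [?E] (mor (twist_arr Y)) []"
      using interchange[OF t dia_twist[of Y], of "[]" "[]" "[]"] by simp
    finally show ?thesis by (simp add: rcup_def dcomp_assoc)
  qed
  have "ptr X V (h \<bullet> whisk [] (mor f) V)
      = whisk [] (cap X) V \<bullet> whisk [?D] h [] \<bullet> whisk [] (whisk [?D] (mor f) [] \<bullet> rcup X) V"
    by (simp add: ptr_def strict)
  also have "\<dots> = whisk [] (cap X) V \<bullet> (whisk [?D] h [] \<bullet> whisk [] t (Y # V)) \<bullet> whisk [] (rcup Y) V"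
    by (simp add: rcup_t strict)
  also have "whisk [?D] h [] \<bullet> whisk [] t (Y # V) = whisk [] t (X # V) \<bullet> whisk [?E] h []"
    using interchange[OF t h, of "[]" "[]" "[]"] by simp
  also have "whisk [] (cap X) V \<bullet> (whisk [] t (X # V) \<bullet> whisk [?E] h []) \<bullet> whisk [] (rcup Y) V
    = whisk [] (cap X \<bullet> whisk [] t [X]) V \<bullet> whisk [?E] h [] \<bullet> whisk [] (rcup Y) V"
    by (simp add: strict)
  also have "\<dots> = ptr Y V (whisk [] (mor f) V \<bullet> h)"
    by (simp add: cap_t ptr_def strict)
  finally show ?thesis .
qed

text \<open>The chosen dual of \<open>X \<boxtimes> Z\<close> is compared by \<open>s\<close> with the nested dual \<open>Z\<^sup>* \<otimes> X\<^sup>*\<close>. The double braiding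
  in the twist of \<open>X \<boxtimes> Z\<close> unlinks the two nested loops (\<open>slide\<close>).\<close>

lemma ptr_tensor:
  assumes [simp]: "X \<in> Ob C" "Z \<in> Ob C" and G: "dia G (X # Z # V) (X # Z # V)"
  shows "ptr (X \<boxtimes> Z) V (whisk [] (fuse X Z) V \<bullet> G \<bullet> whisk [] (split X Z) V) = ptr Z V (ptr X (Z # V) G)"
proof -
  let ?W = "X \<boxtimes> Z" let ?D = "dual C ?W" and ?P = "dual C X" and ?Q = "dual C Z"
  \<comment> \<open>\<open>e\<close> and \<open>k\<close> are the nested evaluation and coevaluation
    that make the word \<open>[?Q, ?P]\<close> a dual of \<open>[X, Z]\<close>.\<close>
  define e where "e = cap Z \<bullet> whisk [?Q] (cap X) [Z]"
  define k where "k = whisk [X] (cup Z) [?P] \<bullet> cup X"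
  define s where "s = whisk [] (cap ?W) [?Q, ?P] \<bullet> whisk [?D] (fuse X Z) [?Q, ?P] \<bullet> whisk [?D] k []"
  \<comment> \<open>\<open>kap\<close> is \<open>rcup\<close> without the twist; setting the twists
    aside leaves a statement about crossings alone.\<close>
  define kap where "kap = (\<lambda>A. cross A (dual C A) \<bullet> cup A)"
  let ?T = "whisk [] (mor (twist_arr X)) [Z] \<bullet> whisk [X] (mor (twist_arr Z)) []"
  have e: "dia e [?Q, ?P, X, Z] []" unfolding e_def by (rule dia_rules | simp)+
  have k: "dia k [] [X, Z, ?Q, ?P]" unfolding k_def by (rule dia_rules | simp)+
  have s: "dia s [?D] [?Q, ?P]" unfolding s_def by (rule dia_rules k | simp)+
  have kap: "dia (kap A) [] [dual C A, A]" if "A \<in> Ob C" for A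
    unfolding kap_def using that by - (rule dia_rules | simp)+
  note Nil = whisk_Nil[OF e] whisk_Nil[OF k] whisk_Nil[OF dia_cap] whisk_Nil[OF dia_cup] whisk_Nil[OF dia_cross]

  have zigzag_nested: "whisk [X, Z] e [] \<bullet> whisk [] k [X, Z] = did [X, Z]"
  proof -
    have "whisk [X, Z] e [] \<bullet> whisk [] k [X, Z]
      = whisk [X, Z] (cap Z) [] \<bullet> (whisk [X, Z, ?Q] (cap X) [Z] \<bullet> whisk [X] (cup Z) [?P, X, Z]) \<bullet> whisk [] (cup X) [X, Z]"
      by (simp add: e_def k_def strict)
    also have "whisk [X, Z, ?Q] (cap X) [Z] \<bullet> whisk [X] (cup Z) [?P, X, Z] = whisk [X] (cup Z) [Z] \<bullet> whisk [X] (cap X) [Z]"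
      using interchange[OF dia_cup[of Z] dia_cap[of X], of "[X]" "[]" "[Z]"] by simp
    also have "whisk [X, Z] (cap Z) [] \<bullet> (whisk [X] (cup Z) [Z] \<bullet> whisk [X] (cap X) [Z]) \<bullet> whisk [] (cup X) [X, Z]
      = whisk [X] (whisk [Z] (cap Z) [] \<bullet> whisk [] (cup Z) [Z]) [] \<bullet> whisk [] (whisk [X] (cap X) [] \<bullet> whisk [] (cup X) [X]) [Z]"
      by (simp add: strict)
    also have "\<dots> = did [X, Z]"
      by (simp add: zigzag whisk_did dcomp_did(1)[OF did_Some(1)])
    finally show ?thesis .
  qed

  have cap_s: "cap ?W \<bullet> whisk [?D] (fuse X Z) [] = e \<bullet> whisk [] s [X, Z]"
  proof -
    have "e \<bullet> whisk [] s [X, Z]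
      = (e \<bullet> whisk [] (cap ?W) [?Q, ?P, X, Z]) \<bullet> whisk [?D] (fuse X Z) [?Q, ?P, X, Z] \<bullet> whisk [?D] k [X, Z]"
      by (simp add: s_def strict)
    also have "e \<bullet> whisk [] (cap ?W) [?Q, ?P, X, Z] = cap ?W \<bullet> whisk [?D, ?W] e []"
      using interchange[OF dia_cap[of ?W] e, of "[]" "[]" "[]"] by (simp add: Nil)
    also have "(cap ?W \<bullet> whisk [?D, ?W] e []) \<bullet> whisk [?D] (fuse X Z) [?Q, ?P, X, Z] \<bullet> whisk [?D] k [X, Z]
      = cap ?W \<bullet> whisk [?D] (whisk [?W] e [] \<bullet> whisk [] (fuse X Z) [?Q, ?P, X, Z]) [] \<bullet> whisk [?D] k [X, Z]"
      by (simp add: strict)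
    also have "whisk [?W] e [] \<bullet> whisk [] (fuse X Z) [?Q, ?P, X, Z] = fuse X Z \<bullet> whisk [X, Z] e []"
      using interchange[OF fuse_Some(1)[of X Z] e, of "[]" "[]" "[]"] by simp
    also have "cap ?W \<bullet> whisk [?D] (fuse X Z \<bullet> whisk [X, Z] e []) [] \<bullet> whisk [?D] k [X, Z]
      = cap ?W \<bullet> whisk [?D] (fuse X Z \<bullet> (whisk [X, Z] e [] \<bullet> whisk [] k [X, Z])) []"
      by (simp add: strict)
    finally show ?thesis by (simp add: zigzag_nested dcomp_did(1)[OF fuse_Some(1)])
  qed

  have cup_s: "whisk [] (split X Z) [?Q, ?P] \<bullet> whisk [?W] s [] \<bullet> cup ?W = k"
  proof -
    let ?g = "whisk [] (fuse X Z) [?Q, ?P] \<bullet> k"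
    have g: "dia ?g [] [?W, ?Q, ?P]" by (rule dia_rules k | simp)+
    have "whisk [?W] s [] \<bullet> cup ?W = whisk [?W] (cap ?W) [?Q, ?P] \<bullet> (whisk [?W, ?D] ?g [] \<bullet> cup ?W)"
      by (simp add: s_def strict)
    also have "whisk [?W, ?D] ?g [] \<bullet> cup ?W = whisk [] (cup ?W) [?W, ?Q, ?P] \<bullet> ?g"
      using interchange[OF dia_cup[of ?W] g, of "[]" "[]" "[]"] whisk_Nil[OF g] by (simp add: Nil)
    also have "whisk [?W] (cap ?W) [?Q, ?P] \<bullet> whisk [] (cup ?W) [?W, ?Q, ?P] \<bullet> ?g
      = whisk [] (whisk [?W] (cap ?W) [] \<bullet> whisk [] (cup ?W) [?W]) [?Q, ?P] \<bullet> ?g"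
      by (simp add: strict)
    also have "\<dots> = ?g"
      using dcomp_did(2)[OF g] by (simp add: zigzag whisk_did)
    finally have "whisk [] (split X Z) [?Q, ?P] \<bullet> whisk [?W] s [] \<bullet> cup ?W = whisk [] (split X Z \<bullet> fuse X Z) [?Q, ?P] \<bullet> k"
      by (simp add: strict)
    then show ?thesis using dcomp_did(2)[OF k] by (simp add: split_fuse whisk_did)
  qed

  have over2: "over A [B, B'] = whisk [B] (cross A B') [] \<bullet> whisk [] (cross A B) [B']"
    if "A \<in> Ob C" "B \<in> Ob C" "B' \<in> Ob C" for A B B'
    using that by (subst over.simps) (simp only: over_singleton)
  \<comment> \<open>A strand that crosses both legs of a cup comes free: by naturality it could as
    well cross the empty word at which the cup starts.\<close>
  have over_kap: "over A [dual C B, B] \<bullet> whisk [A] (kap B) [] = whisk [] (kap B) [A]"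
    if "A \<in> Ob C" "B \<in> Ob C" for A B
  proof -
    have "dia (whisk [] (kap B) [A]) [A] [dual C B, B, A]"
      using whisk_Some(1)[OF kap[of B], of "[]" "[A]"] that by simp
    from dcomp_did(1)[OF this] show ?thesis
      using over_nat[OF that(1) kap[OF that(2)]] that by simp
  qed

  have slide: "whisk [?Q, ?P] (cross Z X \<bullet> cross X Z) [] \<bullet> whisk [] (over X [?Q, ?P]) [Z] \<bullet> whisk [X] (over Z [?Q, ?P]) [] \<bullet> k
      = whisk [?Q] (kap X) [Z] \<bullet> kap Z"
  proof -
    have "whisk [?Q, ?P] (cross Z X \<bullet> cross X Z) [] \<bullet> whisk [] (over X [?Q, ?P]) [Z] \<bullet> whisk [X] (over Z [?Q, ?P]) [] \<bullet> k
      = whisk [?Q, ?P] (cross Z X) [] \<bullet> whisk [?Q, ?P] (cross X Z) [] \<bullet> whisk [?Q] (cross X ?P) [Z]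
        \<bullet> (whisk [] (cross X ?Q) [?P, Z] \<bullet> whisk [X, ?Q] (cross Z ?P) []) \<bullet> whisk [X] (kap Z) [?P] \<bullet> cup X"
      by (simp add: over2 k_def kap_def strict)
    also have "whisk [] (cross X ?Q) [?P, Z] \<bullet> whisk [X, ?Q] (cross Z ?P) []
        = whisk [?Q, X] (cross Z ?P) [] \<bullet> whisk [] (cross X ?Q) [Z, ?P]"
      using interchange[OF dia_cross[of X ?Q] dia_cross[of Z ?P], of "[]" "[]" "[]"] by simp
    also have "whisk [?Q, ?P] (cross Z X) [] \<bullet> whisk [?Q, ?P] (cross X Z) [] \<bullet> whisk [?Q] (cross X ?P) [Z]
        \<bullet> (whisk [?Q, X] (cross Z ?P) [] \<bullet> whisk [] (cross X ?Q) [Z, ?P]) \<bullet> whisk [X] (kap Z) [?P] \<bullet> cup X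
      = whisk [?Q, ?P] (cross Z X) [] \<bullet> whisk [?Q] (over X [?P, Z] \<bullet> whisk [X] (cross Z ?P) []) []
        \<bullet> whisk [] (cross X ?Q) [Z, ?P] \<bullet> whisk [X] (kap Z) [?P] \<bullet> cup X"
      by (simp add: over2 strict)
    \<comment> \<open>The third Reidemeister move, as naturality of crossing with \<open>X\<close>
      along another crossing.\<close>
    also have "over X [?P, Z] \<bullet> whisk [X] (cross Z ?P) [] = whisk [] (cross Z ?P) [X] \<bullet> over X [Z, ?P]"
      by (rule over_nat) (simp_all add: dia_cross)
    also have "whisk [?Q, ?P] (cross Z X) [] \<bullet> whisk [?Q] (whisk [] (cross Z ?P) [X] \<bullet> over X [Z, ?P]) []
        \<bullet> whisk [] (cross X ?Q) [Z, ?P] \<bullet> whisk [X] (kap Z) [?P] \<bullet> cup X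
      = whisk [?Q] (over Z [?P, X]) [] \<bullet> whisk [?Q, Z] (cross X ?P) []
        \<bullet> whisk [] (over X [?Q, Z] \<bullet> whisk [X] (kap Z) []) [?P] \<bullet> cup X"
      by (simp add: over2 strict)
    \<comment> \<open>The strand of \<open>X\<close> now crosses both legs of \<open>kap Z\<close>
      and is released from that loop. The same move with the roles exchanged then releases
      \<open>Z\<close> from \<open>kap X\<close>.\<close>
    also have "over X [?Q, Z] \<bullet> whisk [X] (kap Z) [] = whisk [] (kap Z) [X]"
      by (simp only: over_kap assms)
    also have "whisk [?Q] (over Z [?P, X]) [] \<bullet> whisk [?Q, Z] (cross X ?P) [] \<bullet> whisk [] (whisk [] (kap Z) [X]) [?P] \<bullet> cup X
      = whisk [?Q] (over Z [?P, X]) [] \<bullet> whisk [?Q, Z] (cross X ?P) [] \<bullet> (whisk [] (kap Z) [X, ?P] \<bullet> cup X)"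
      by (simp add: strict)
    also have "whisk [] (kap Z) [X, ?P] \<bullet> cup X = whisk [?Q, Z] (cup X) [] \<bullet> kap Z"
      using interchange[OF kap[of Z] dia_cup[of X], of "[]" "[]" "[]"] whisk_Nil[OF kap[of Z]] by (simp add: Nil)
    also have "whisk [?Q] (over Z [?P, X]) [] \<bullet> whisk [?Q, Z] (cross X ?P) [] \<bullet> whisk [?Q, Z] (cup X) [] \<bullet> kap Z
      = whisk [?Q] (over Z [?P, X] \<bullet> whisk [Z] (kap X) []) [] \<bullet> kap Z"
      by (simp add: kap_def strict)
    also have "over Z [?P, X] \<bullet> whisk [Z] (kap X) [] = whisk [] (kap X) [Z]"
      by (simp only: over_kap assms)
    finally show ?thesis by (simp add: whisk_whisk)
  qed

  \<comment> \<open>\<open>?q\<close> is \<open>rcup ?W\<close> with the product on its right leg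
    already split.\<close>
  let ?q = "whisk [?D] (split X Z \<bullet> mor (twist_arr ?W)) [] \<bullet> cross ?W ?D \<bullet> cup ?W"
  have q: "dia ?q [] [?D, X, Z]" by (rule dia_rules | simp)+
  have rcup_s: "whisk [] s [X, Z] \<bullet> ?q = whisk [?Q] (rcup X) [Z] \<bullet> rcup Z"
  proof -
    let ?t = "?T \<bullet> cross Z X \<bullet> cross X Z"
    have t: "dia ?t [X, Z] [X, Z]" by (rule dia_rules | simp)+
    have "whisk [] s [X, Z] \<bullet> ?q
      = (whisk [] s [X, Z] \<bullet> whisk [?D] ?t []) \<bullet> (whisk [?D] (split X Z) [] \<bullet> cross ?W ?D) \<bullet> cup ?W"
      by (simp add: split_twist strict)
    also have "whisk [] s [X, Z] \<bullet> whisk [?D] ?t [] = whisk [?Q, ?P] ?t [] \<bullet> whisk [] s [X, Z]"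
      using interchange[OF s t, of "[]" "[]" "[]"] by simp
    also have "whisk [?D] (split X Z) [] \<bullet> cross ?W ?D
      = whisk [] (cross X ?D) [Z] \<bullet> whisk [X] (cross Z ?D) [] \<bullet> whisk [] (split X Z) [?D]"
      by (simp add: cross_split_left)
    also have "(whisk [?Q, ?P] ?t [] \<bullet> whisk [] s [X, Z]) \<bullet> (whisk [] (cross X ?D) [Z] \<bullet> whisk [X] (cross Z ?D) [] \<bullet> whisk [] (split X Z) [?D]) \<bullet> cup ?W
      = whisk [?Q, ?P] ?t [] \<bullet> whisk [] (whisk [] s [X] \<bullet> over X [?D]) [Z] \<bullet> whisk [X] (cross Z ?D) [] \<bullet> whisk [] (split X Z) [?D] \<bullet> cup ?W"
      by (simp add: strict)
    also have "whisk [] s [X] \<bullet> over X [?D] = over X [?Q, ?P] \<bullet> whisk [X] s []"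
      by (rule over_nat[symmetric]) (simp_all add: s)
    also have "whisk [?Q, ?P] ?t [] \<bullet> whisk [] (over X [?Q, ?P] \<bullet> whisk [X] s []) [Z] \<bullet> whisk [X] (cross Z ?D) [] \<bullet> whisk [] (split X Z) [?D] \<bullet> cup ?W
      = whisk [?Q, ?P] ?t [] \<bullet> whisk [] (over X [?Q, ?P]) [Z] \<bullet> whisk [X] (whisk [] s [Z] \<bullet> over Z [?D]) [] \<bullet> whisk [] (split X Z) [?D] \<bullet> cup ?W"
      by (simp add: strict)
    also have "whisk [] s [Z] \<bullet> over Z [?D] = over Z [?Q, ?P] \<bullet> whisk [Z] s []"
      by (rule over_nat[symmetric]) (simp_all add: s)
    also have "whisk [?Q, ?P] ?t [] \<bullet> whisk [] (over X [?Q, ?P]) [Z] \<bullet> whisk [X] (over Z [?Q, ?P] \<bullet> whisk [Z] s []) [] \<bullet> whisk [] (split X Z) [?D] \<bullet> cup ?W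
      = whisk [?Q, ?P] ?t [] \<bullet> whisk [] (over X [?Q, ?P]) [Z] \<bullet> whisk [X] (over Z [?Q, ?P]) [] \<bullet> (whisk [X, Z] s [] \<bullet> whisk [] (split X Z) [?D]) \<bullet> cup ?W"
      by (simp add: strict)
    also have "whisk [X, Z] s [] \<bullet> whisk [] (split X Z) [?D] = whisk [] (split X Z) [?Q, ?P] \<bullet> whisk [?W] s []"
      using interchange[OF split_Some(1)[of X Z] s, of "[]" "[]" "[]"] by simp
    also have "whisk [?Q, ?P] ?t [] \<bullet> whisk [] (over X [?Q, ?P]) [Z] \<bullet> whisk [X] (over Z [?Q, ?P]) [] \<bullet> (whisk [] (split X Z) [?Q, ?P] \<bullet> whisk [?W] s []) \<bullet> cup ?W
      = whisk [?Q, ?P] ?T [] \<bullet> (whisk [?Q, ?P] (cross Z X \<bullet> cross X Z) [] \<bullet> whisk [] (over X [?Q, ?P]) [Z] \<bullet> whisk [X] (over Z [?Q, ?P]) [] \<bullet> k)"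
      by (simp add: cup_s[symmetric] strict)
    also have "\<dots> = whisk [?Q, ?P] (whisk [] (mor (twist_arr X)) [Z]) [] \<bullet> (whisk [?Q, ?P, X] (mor (twist_arr Z)) [] \<bullet> whisk [?Q] (kap X) [Z]) \<bullet> kap Z"
      by (simp only: slide) (simp add: strict)
    also have "whisk [?Q, ?P, X] (mor (twist_arr Z)) [] \<bullet> whisk [?Q] (kap X) [Z] = whisk [?Q] (kap X) [Z] \<bullet> whisk [?Q] (mor (twist_arr Z)) []"
      using interchange[OF kap[of X] dia_twist[of Z], of "[?Q]" "[]" "[]"] by simp
    also have "whisk [?Q, ?P] (whisk [] (mor (twist_arr X)) [Z]) [] \<bullet> (whisk [?Q] (kap X) [Z] \<bullet> whisk [?Q] (mor (twist_arr Z)) []) \<bullet> kap Z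
      = whisk [?Q] (rcup X) [Z] \<bullet> rcup Z"
      by (simp add: rcup_def kap_def strict)
    finally show ?thesis .
  qed

  have "ptr ?W V (whisk [] (fuse X Z) V \<bullet> G \<bullet> whisk [] (split X Z) V)
    = whisk [] (cap ?W \<bullet> whisk [?D] (fuse X Z) []) V \<bullet> whisk [?D] G [] \<bullet> whisk [] ?q V"
    by (simp add: ptr_def rcup_def strict)
  also have "\<dots> = whisk [] e V \<bullet> (whisk [] s (X # Z # V) \<bullet> whisk [?D] G []) \<bullet> whisk [] ?q V"
    by (simp add: cap_s strict)
  also have "whisk [] s (X # Z # V) \<bullet> whisk [?D] G [] = whisk [?Q, ?P] G [] \<bullet> whisk [] s (X # Z # V)"
    using interchange[OF s G, of "[]" "[]" "[]"] by simp
  also have "whisk [] e V \<bullet> (whisk [?Q, ?P] G [] \<bullet> whisk [] s (X # Z # V)) \<bullet> whisk [] ?q V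
    = whisk [] e V \<bullet> whisk [?Q, ?P] G [] \<bullet> whisk [] (whisk [] s [X, Z] \<bullet> ?q) V"
    by (simp add: strict)
  also have "\<dots> = ptr Z V (ptr X (Z # V) G)"
    by (simp only: rcup_s) (simp add: e_def ptr_def strict)
  finally show ?thesis .
qed

section \<open>Encircling one strand by another, and its multiplicativity\<close>

definition encircle :: "'a \<Rightarrow> 'a \<Rightarrow> ('a, 'b) nat_family" where
  "encircle X Y = cross Y X \<bullet> cross X Y"

lemma dia_encircle: "\<lbrakk>X \<in> Ob C; Y \<in> Ob C\<rbrakk> \<Longrightarrow> dia (encircle X Y) [X, Y] [X, Y]"
  unfolding encircle_def by (rule dia_rules | simp)+

text \<open>By the two hexagons the rings become nested: the strand of \<open>Z\<close> crosses
  \<open>Y\<close>, the strand of \<open>X\<close> makes its full turn around \<open>Y\<close>, and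
  \<open>Z\<close> crosses back.\<close>

lemma encircle_tensor:
  assumes [simp]: "X \<in> Ob C" "Y \<in> Ob C" "Z \<in> Ob C"
  shows "encircle (X \<boxtimes> Z) Y = whisk [] (fuse X Z) [Y]
    \<bullet> (whisk [X] (cross Y Z) [] \<bullet> whisk [] (encircle X Y) [Z] \<bullet> whisk [X] (cross Z Y) []) \<bullet> whisk [] (split X Z) [Y]"
proof -
  have d: "dia (encircle (X \<boxtimes> Z) Y) [X \<boxtimes> Z, Y] [X \<boxtimes> Z, Y]" by (simp add: dia_encircle)
  have "whisk [] (fuse X Z) [Y]
    \<bullet> (whisk [X] (cross Y Z) [] \<bullet> whisk [] (encircle X Y) [Z] \<bullet> whisk [X] (cross Z Y) []) \<bullet> whisk [] (split X Z) [Y]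
    = whisk [] (fuse X Z) [Y] \<bullet> whisk [X] (cross Y Z) [] \<bullet> whisk [] (cross Y X) [Z]
      \<bullet> (whisk [] (cross X Y) [Z] \<bullet> whisk [X] (cross Z Y) [] \<bullet> whisk [] (split X Z) [Y])"
    by (simp add: encircle_def strict)
  also have "\<dots> = whisk [] (fuse X Z) [Y] \<bullet> (whisk [X] (cross Y Z) [] \<bullet> whisk [] (cross Y X) [Z]
      \<bullet> whisk [Y] (split X Z) []) \<bullet> cross (X \<boxtimes> Z) Y"
    by (simp add: cross_split_left dcomp_assoc)
  also have "\<dots> = whisk [] (fuse X Z \<bullet> split X Z) [Y] \<bullet> encircle (X \<boxtimes> Z) Y"
    by (simp add: cross_split_right) (simp add: encircle_def strict)
  also have "\<dots> = encircle (X \<boxtimes> Z) Y"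
    using dcomp_did(2)[OF d] by (simp add: split_fuse whisk_did)
  finally show ?thesis by (rule sym)
qed

text \<open>Closing the inner loop of \<open>X\<close> gives a scalar, after which the two outer
  crossings are \<open>encircle Z Y\<close>. This is the multiplicativity of the characters given by
  the rows of the S-matrix.\<close>

lemma ptr_encircle_tensor:
  assumes [simp]: "X \<in> Ob C" "Y \<in> Ob C" "Z \<in> Ob C"
    and X: "ptr X [Y] (encircle X Y) = dscale a (did [Y])" and Z: "ptr Z [Y] (encircle Z Y) = dscale b (did [Y])"
  shows "ptr (X \<boxtimes> Z) [Y] (encircle (X \<boxtimes> Z) Y) = dscale a (dscale b (did [Y]))"
proof -
  let ?G = "whisk [X] (cross Y Z) [] \<bullet> whisk [] (encircle X Y) [Z] \<bullet> whisk [X] (cross Z Y) []"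
  have G: "dia ?G [X, Z, Y] [X, Z, Y]" by (rule dia_rules dia_encircle | simp)+
  have "ptr X [Z, Y] ?G = cross Y Z \<bullet> ptr X [Y, Z] (whisk [] (encircle X Y) [Z]) \<bullet> cross Z Y"
    by (rule ptr_conj) (simp_all add: dia_cross)
  also have "\<dots> = cross Y Z \<bullet> dscale a (did [Y, Z]) \<bullet> cross Z Y"
    using ptr_whisk[of X "[Y]" "[Z]" "encircle X Y"] by (simp add: X whisk_dscale whisk_did)
  also have "\<dots> = dscale a (encircle Z Y)"
    using dcomp_did(2)[OF dia_cross[of Z Y]] by (simp add: dscale_laws encircle_def)
  finally show ?thesis
    by (simp add: encircle_tensor ptr_tensor[OF _ _ G] ptr_dscale Z)
qed

text \<open>The link between S-matrix entries, traces over a product, and loops around a single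
  strand; the trace over the product is taken apart by \<open>ptr_tensor\<close>.\<close>

lemma ptr_braiding_square:
  assumes [simp]: "X \<in> Ob C" "Y \<in> Ob C"
  shows "ptr (X \<boxtimes> Y) [] (mor (braid_arr Y X \<star> braid_arr X Y)) = ptr Y [] (ptr X [Y] (encircle X Y))"
proof -
  have d: "dia (mor (braid_arr Y X) \<bullet> mor (braid_arr X Y)) [X \<boxtimes> Y] [X \<boxtimes> Y]"
    "dia (mor (braid_arr X Y)) [X \<boxtimes> Y] [Y \<boxtimes> X]"
    by ((rule dia_rules | simp)+)
  have "fuse X Y \<bullet> encircle X Y \<bullet> split X Y
    = fuse X Y \<bullet> (cross Y X \<bullet> split Y X) \<bullet> mor (braid_arr X Y)"
    by (simp only: encircle_def dcomp_assoc cross_fuse[OF assms])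
  also have "\<dots> = (fuse X Y \<bullet> split X Y) \<bullet> mor (braid_arr Y X) \<bullet> mor (braid_arr X Y)"
    by (subst cross_fuse) (simp_all add: dcomp_assoc)
  also have "\<dots> = mor (braid_arr Y X \<star> braid_arr X Y)"
    using dcomp_did(2)[OF d(1)] by (simp add: split_fuse mor_cmp)
  finally show ?thesis
    using ptr_tensor[of X Y "encircle X Y" "[]"] dia_encircle[of X Y] by simp
qed

definition trace_arr :: "'a \<Rightarrow> 'a \<times> 'b \<times> 'a \<Rightarrow> 'a \<times> 'b \<times> 'a" where
  "trace_arr X f = ev_arr X \<star> braid_arr X (dual C X) \<star> ((twist_arr X \<star> f) \<bowtie> ident (dual C X)) \<star> coev_arr X"

text \<open>With no strands left, the loop agrees with the composite in
  \<open>quantum_trace\<close>: \<open>f\<close> and the twist slide back through the crossing onto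
  the coevaluation.\<close>

lemma ptr_mor:
  assumes [simp]: "isarr f" "src f = X" "tgt f = X"
  shows "ptr X [] (mor f) = del \<bullet> mor (trace_arr X f) \<bullet> ins"
proof -
  have [simp]: "X \<in> Ob C" using isarr_Ob[of f] by simp
  let ?D = "dual C X" and ?g = "twist_arr X \<star> f"
  have d: "dia (mor (coev_arr X) \<bullet> ins) [] [X \<boxtimes> ?D]" "dia (mor (braid_arr X ?D) \<bullet> mor (?g \<bowtie> ident ?D) \<bullet> mor (coev_arr X) \<bullet> ins) [] [?D \<boxtimes> X]"
    "dia (rcup X) [] [?D, X]" "dia (mor ?g) [X] [X]"
    by ((rule dia_rules dia_rcup | simp)+)
  have "ptr X [] (mor f) = cap X \<bullet> whisk [?D] (mor f) [] \<bullet> rcup X"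
    using whisk_Nil[OF dia_cap[of X]] whisk_Nil[OF d(3)] by (simp add: ptr_def)
  also have "\<dots> = cap X \<bullet> (whisk [?D] (mor ?g) [] \<bullet> cross X ?D) \<bullet> cup X"
    by (simp add: rcup_def strict twist_arr_nat[of f X X] mor_cmp)
  also have "\<dots> = cap X \<bullet> cross X ?D \<bullet> whisk [] (mor ?g) [?D] \<bullet> cup X"
    by (simp add: cross_mor_left[of ?D ?g X X, symmetric] dcomp_assoc)
  also have "\<dots> = del \<bullet> mor (ev_arr X) \<bullet> (fuse ?D X \<bullet> split ?D X) \<bullet> mor (braid_arr X ?D)
     \<bullet> (fuse X ?D \<bullet> whisk [] (mor ?g) [?D]) \<bullet> split X ?D \<bullet> mor (coev_arr X) \<bullet> ins"
    by (simp add: cap_def cross_def cup_def dcomp_assoc)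
  also have "\<dots> = del \<bullet> mor (ev_arr X) \<bullet> did [?D \<boxtimes> X] \<bullet> mor (braid_arr X ?D)
     \<bullet> mor (?g \<bowtie> ident ?D) \<bullet> fuse X ?D \<bullet> split X ?D \<bullet> mor (coev_arr X) \<bullet> ins"
    by (subst mor_fuse_left[of ?g X X, symmetric]) (simp_all add: split_fuse dcomp_assoc)
  also have "\<dots> = del \<bullet> mor (ev_arr X) \<bullet> did [?D \<boxtimes> X] \<bullet> mor (braid_arr X ?D)
     \<bullet> mor (?g \<bowtie> ident ?D) \<bullet> did [X \<boxtimes> ?D] \<bullet> mor (coev_arr X) \<bullet> ins"
    by (simp add: dcomp_reassoc[OF split_fuse(2)])
  also have "\<dots> = del \<bullet> mor (ev_arr X) \<bullet> mor (braid_arr X ?D) \<bullet> mor (?g \<bowtie> ident ?D) \<bullet> mor (coev_arr X) \<bullet> ins"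
    using dcomp_did(2)[OF d(1)] dcomp_did(2)[OF d(2)] by (simp add: split_fuse)
  finally show ?thesis by (simp add: trace_arr_def mor_cmp dcomp_assoc)
qed

end

section \<open>Semisimplicity\<close>

context linear_category
begin

lemma Hom_closed:
  assumes "X \<in> Ob C" "Y \<in> Ob C"
  shows "0 \<in> Hom C X Y" "\<lbrakk>f \<in> Hom C X Y; g \<in> Hom C X Y\<rbrakk> \<Longrightarrow> f + g \<in> Hom C X Y"
    "f \<in> Hom C X Y \<Longrightarrow> scal C a f \<in> Hom C X Y" "\<lbrakk>f \<in> Hom C X Y; g \<in> Hom C X Y\<rbrakk> \<Longrightarrow> f - g \<in> Hom C X Y"
    "(\<And>i. i \<in> I \<Longrightarrow> h i \<in> Hom C X Y) \<Longrightarrow> sum h I \<in> Hom C X Y"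
proof -
  note s = subspace_Hom[OF assms]
  show "0 \<in> Hom C X Y" by (rule V.subspace_0[OF s])
  show "\<lbrakk>f \<in> Hom C X Y; g \<in> Hom C X Y\<rbrakk> \<Longrightarrow> f + g \<in> Hom C X Y" by (rule V.subspace_add[OF s])
  show "f \<in> Hom C X Y \<Longrightarrow> scal C a f \<in> Hom C X Y" by (rule V.subspace_scale[OF s])
  show "\<lbrakk>f \<in> Hom C X Y; g \<in> Hom C X Y\<rbrakk> \<Longrightarrow> f - g \<in> Hom C X Y" by (rule V.subspace_diff[OF s])
  show "(\<And>i. i \<in> I \<Longrightarrow> h i \<in> Hom C X Y) \<Longrightarrow> sum h I \<in> Hom C X Y" by (rule V.subspace_sum[OF s])
qed

lemma Comp_zero:
  assumes "X \<in> Ob C" "Y \<in> Ob C" "Z \<in> Ob C"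
  shows "f \<in> Hom C X Y \<Longrightarrow> 0 \<cdot> f = 0" "g \<in> Hom C Y Z \<Longrightarrow> g \<cdot> 0 = 0"
  using Comp_add_left[OF assms, of f 0 0] Comp_add_right[OF assms, of 0 0 g] Hom_closed(1) assms by auto

lemma Comp_diff:
  assumes "X \<in> Ob C" "Y \<in> Ob C" "Z \<in> Ob C" "f \<in> Hom C X Y" "f' \<in> Hom C X Y" "g \<in> Hom C Y Z"
  shows "g \<cdot> (f - f') = g \<cdot> f - g \<cdot> f'"
  using Comp_add_right[of X Y Z "f - f'" f' g] assms Hom_closed(4) by (simp add: eq_diff_eq)

lemma Comp_sum:
  assumes "X \<in> Ob C" "Y \<in> Ob C" "Z \<in> Ob C"
  shows "\<lbrakk>f \<in> Hom C X Y; \<And>i. i \<in> I \<Longrightarrow> h i \<in> Hom C Y Z\<rbrakk> \<Longrightarrow> sum h I \<cdot> f = (\<Sum>i\<in>I. h i \<cdot> f)"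
    "\<lbrakk>g \<in> Hom C Y Z; \<And>i. i \<in> I \<Longrightarrow> h' i \<in> Hom C X Y\<rbrakk> \<Longrightarrow> g \<cdot> sum h' I = (\<Sum>i\<in>I. g \<cdot> h' i)"
proof -
  show "sum h I \<cdot> f = (\<Sum>i\<in>I. h i \<cdot> f)" if "f \<in> Hom C X Y" "\<And>i. i \<in> I \<Longrightarrow> h i \<in> Hom C Y Z"
    using that(2)
  proof (induction I rule: infinite_finite_induct)
    case (insert i I)
    then show ?case
      using Comp_add_left[OF assms that(1), of "h i" "sum h I"] Hom_closed(5)[OF assms(2,3), of I h] by simp
  qed (use Comp_zero[OF assms] that in auto)
  show "g \<cdot> sum h' I = (\<Sum>i\<in>I. g \<cdot> h' i)" if "g \<in> Hom C Y Z" "\<And>i. i \<in> I \<Longrightarrow> h' i \<in> Hom C X Y"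
    using that(2)
  proof (induction I rule: infinite_finite_induct)
    case (insert i I)
    then show ?case
      using Comp_add_right[OF assms, of "h' i" "sum h' I" g] Hom_closed(5)[OF assms(1,2), of I h'] that(1) by simp
  qed (use Comp_zero[OF assms] that in auto)
qed

lemma isomorphic_refl: "X \<in> Ob C \<Longrightarrow> isomorphic C X X"
  unfolding isomorphic_def is_iso_def using Id_Hom Id_Comp by blast

lemma isomorphic_sym: "isomorphic C X Y \<Longrightarrow> isomorphic C Y X"
  unfolding isomorphic_def is_iso_def by blast

lemma isomorphic_trans:
  assumes "X \<in> Ob C" "Y \<in> Ob C" "Z \<in> Ob C" "isomorphic C X Y" "isomorphic C Y Z"
  shows "isomorphic C X Z"
proof -
  obtain f f' where f: "f \<in> Hom C X Y" "f' \<in> Hom C Y X" "f' \<cdot> f = Id C X" "f \<cdot> f' = Id C Y"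
    using assms by (auto simp: isomorphic_def is_iso_def)
  obtain g g' where g: "g \<in> Hom C Y Z" "g' \<in> Hom C Z Y" "g' \<cdot> g = Id C Y" "g \<cdot> g' = Id C Z"
    using assms by (auto simp: isomorphic_def is_iso_def)
  have gf: "g \<cdot> f \<in> Hom C X Z" "f' \<cdot> g' \<in> Hom C Z X" using Comp_Hom assms f g by blast+
  have "(f' \<cdot> g') \<cdot> (g \<cdot> f) = f' \<cdot> ((g' \<cdot> g) \<cdot> f)"
    using Comp_assoc[of X Z Y X "g \<cdot> f" g' f'] Comp_assoc[of X Y Z Y f g g'] assms f g gf by simp
  moreover have "(g \<cdot> f) \<cdot> (f' \<cdot> g') = g \<cdot> ((f \<cdot> f') \<cdot> g')"
    using Comp_assoc[of Z X Y Z "f' \<cdot> g'" f g] Comp_assoc[of Z Y X Y g' f' f] assms f g gf by simp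
  ultimately show ?thesis
    using gf f g Id_Comp assms unfolding isomorphic_def is_iso_def by metis
qed

lemma iso_is_mono:
  assumes "X \<in> Ob C" "Y \<in> Ob C" "is_iso C X Y f"
  shows "is_mono C X Y f"
proof -
  obtain g where g: "f \<in> Hom C X Y" "g \<in> Hom C Y X" "g \<cdot> f = Id C X"
    using assms by (auto simp: is_iso_def)
  have "g \<cdot> (f \<cdot> h) = h" if "W \<in> Ob C" "h \<in> Hom C W X" for W h
    using Comp_assoc[of W X Y X h f g] Id_Comp[of W X h] g assms that by simp
  then show ?thesis using g unfolding is_mono_def by metis
qed

lemma subobject_iso: "\<lbrakk>X \<in> Ob C; Y \<in> Ob C; isomorphic C X Y\<rbrakk> \<Longrightarrow> subobject C X Y"
  using iso_is_mono unfolding subobject_def isomorphic_def by blast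

lemma simple_Ob: "simple_ob C X \<Longrightarrow> X \<in> Ob C"
  by (simp add: simple_ob_def)

lemma direct_sum_iso:
  assumes "X \<in> Ob C" "Y \<in> Ob C" "isomorphic C X Y"
  shows "is_direct_sum C 1 (\<lambda>_. Y) X"
proof -
  obtain f g where f: "f \<in> Hom C X Y" "g \<in> Hom C Y X" "g \<cdot> f = Id C X" "f \<cdot> g = Id C Y"
    using assms by (auto simp: isomorphic_def is_iso_def)
  show ?thesis unfolding is_direct_sum_def
    using assms f by (intro conjI exI[of _ "\<lambda>_. g"] exI[of _ "\<lambda>_. f"]) auto
qed

lemma direct_sum_single:
  assumes "is_direct_sum C (Suc 0) S X"
  shows "isomorphic C X (S 0)"
  using assms unfolding is_direct_sum_def isomorphic_def is_iso_def by auto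

text \<open>An indexed basis described by coefficient functions. A map between Hom spaces is
  meaningful only on a subset of \<open>'m\<close>, and in this form a basis can be transported
  along it without extending it to a linear map on all of \<open>'m\<close>.\<close>

definition coord_basis :: "'i set \<Rightarrow> ('i \<Rightarrow> 'm) \<Rightarrow> 'm set \<Rightarrow> bool" where
  "coord_basis J b H \<longleftrightarrow> finite J \<and> H = (\<lambda>c. \<Sum>i\<in>J. scal C (c i) (b i)) ` UNIV \<and>
     (\<forall>c. (\<Sum>i\<in>J. scal C (c i) (b i)) = 0 \<longrightarrow> (\<forall>i\<in>J. c i = 0))"

lemma coord_basis_mem:
  assumes "coord_basis J b H"
  shows "(\<Sum>i\<in>J. scal C (c i) (b i)) \<in> H"
proof -
  have "H = range (\<lambda>c. \<Sum>i\<in>J. scal C (c i) (b i))" using assms by (simp add: coord_basis_def)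
  then show ?thesis by auto
qed

lemma coord_basis_dim:
  assumes "coord_basis J b H"
  shows "V.dim H = card J"
proof -
  have J: "finite J" and H: "H = (\<lambda>c. \<Sum>i\<in>J. scal C (c i) (b i)) ` UNIV"
    and ind: "\<And>c i. (\<Sum>i\<in>J. scal C (c i) (b i)) = 0 \<Longrightarrow> i \<in> J \<Longrightarrow> c i = 0"
    using assms by (auto simp: coord_basis_def)
  have inj: "inj_on b J"
  proof (rule inj_onI, rule ccontr)
    fix i j assume ij: "i \<in> J" "j \<in> J" "b i = b j" "i \<noteq> j"
    have "(\<Sum>k\<in>J. scal C (if k = i then 1 else if k = j then - 1 else 0) (b k))
      = (\<Sum>k\<in>J. (if k = i then b i else 0) - (if k = j then b j else 0))"
      by (rule sum.cong) (use ij in auto)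
    also have "\<dots> = 0" using J ij by (simp add: sum_subtractf)
    finally show False using ind[of "\<lambda>k. if k = i then 1 else if k = j then - 1 else 0" i] ij by simp
  qed
  have re: "(\<Sum>v\<in>b ` J. scal C (u v) v) = (\<Sum>i\<in>J. scal C (u (b i)) (b i))" for u
    by (simp add: sum.reindex[OF inj])
  have "V.independent (b ` J)"
  proof
    assume "V.dependent (b ` J)"
    then obtain u v where "v \<in> b ` J" "u v \<noteq> 0" "(\<Sum>v\<in>b ` J. scal C (u v) v) = 0"
      using V.dependent_finite J by auto
    then show False using ind[of "\<lambda>i. u (b i)"] by (auto simp: re)
  qed
  moreover have "V.span (b ` J) = H"
  proof -
    have "\<exists>u. (\<Sum>i\<in>J. scal C (c i) (b i)) = (\<Sum>i\<in>J. scal C (u (b i)) (b i))" for c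
      by (rule exI[of _ "\<lambda>v. c (the_inv_into J b v)"], rule sum.cong)
        (simp_all add: the_inv_into_f_f[OF inj])
    moreover have "\<exists>c. (\<Sum>i\<in>J. scal C (u (b i)) (b i)) = (\<Sum>i\<in>J. scal C (c i) (b i))" for u
      by (rule exI[of _ "\<lambda>i. u (b i)"]) simp
    ultimately show ?thesis
      unfolding H V.span_finite[OF finite_imageI[OF J]] re by (auto simp: image_iff)
  qed
  ultimately have "V.dim H = card (b ` J)" using V.dim_span V.dim_eq_card_independent by metis
  then show ?thesis using card_image[OF inj] by simp
qed

lemma coord_basis_map:
  assumes b: "coord_basis J b H"
    and lin: "\<And>c. T (\<Sum>i\<in>J. scal C (c i) (b i)) = (\<Sum>i\<in>J. scal C (c i) (T (b i)))"
    and inj: "\<And>u. u \<in> H \<Longrightarrow> T u = 0 \<Longrightarrow> u = 0" and img: "T ` H = H'"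
  shows "coord_basis J (\<lambda>i. T (b i)) H'"
  unfolding coord_basis_def
proof (intro conjI allI impI)
  show "finite J" using b by (simp add: coord_basis_def)
  show "H' = range (\<lambda>c. \<Sum>i\<in>J. scal C (c i) (T (b i)))"
    using b img unfolding coord_basis_def by (metis (no_types, lifting) image_cong image_image lin)
  fix c assume "(\<Sum>i\<in>J. scal C (c i) (T (b i))) = 0"
  moreover have "(\<Sum>i\<in>J. scal C (c i) (b i)) \<in> H" using b by (rule coord_basis_mem)
  ultimately have "(\<Sum>i\<in>J. scal C (c i) (b i)) = 0" using inj lin by metis
  then show "\<forall>i\<in>J. c i = 0" using b unfolding coord_basis_def by blast
qed

lemma is_mono_zero:
  assumes "X \<in> Ob C" "Y \<in> Ob C" "W \<in> Ob C" "is_mono C X Y m" "g \<in> Hom C W X" "m \<cdot> g = 0"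
  shows "g = 0"
proof -
  have "m \<cdot> 0 = 0" using Comp_zero(2)[of W X Y m] assms by (simp add: is_mono_def)
  then show ?thesis using assms Hom_closed(1)[of W X] unfolding is_mono_def by metis
qed

end

section \<open>Schur's lemma and representatives of simple objects\<close>

context abelian_category
begin

text \<open>The kernel of \<open>f\<close> is a subobject of \<open>X\<close>. If it is zero then
  \<open>f\<close> is mono, and if it is all of \<open>X\<close> then \<open>f\<close>
  vanishes.\<close>

lemma simple_nonzero_mono:
  assumes X: "simple_ob C X" and Y: "Y \<in> Ob C" and f: "f \<in> Hom C X Y" "f \<noteq> 0"
  shows "is_mono C X Y f"
proof -
  have XO: "X \<in> Ob C" using X by (rule simple_Ob)
  obtain K k where K: "is_kernel C X Y f K k" using kernel_exists[OF XO Y f(1)] by auto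
  have k: "K \<in> Ob C" "k \<in> Hom C K X" "f \<cdot> k = 0"
    and uni: "\<And>W g. W \<in> Ob C \<Longrightarrow> g \<in> Hom C W X \<Longrightarrow> f \<cdot> g = 0 \<Longrightarrow> \<exists>!h. h \<in> Hom C W K \<and> k \<cdot> h = g"
    using K unfolding is_kernel_def by auto
  have "is_mono C K X k" unfolding is_mono_def
  proof (intro conjI ballI impI)
    fix W g h assume W: "W \<in> Ob C" and g: "g \<in> Hom C W K" and h: "h \<in> Hom C W K" and eq: "k \<cdot> g = k \<cdot> h"
    have "f \<cdot> (k \<cdot> g) = 0"
      using Comp_assoc[of W K X Y g k f] Comp_zero(1)[of W K Y g] k W g XO Y f by simp
    moreover have "k \<cdot> g \<in> Hom C W X" using Comp_Hom k W g XO by blast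
    ultimately show "g = h" using uni[OF W, of "k \<cdot> g"] g h eq by metis
  qed (rule k)
  then consider "Id C K = 0" | "is_iso C K X k" using X k unfolding simple_ob_def by blast
  then show ?thesis
  proof cases
    case 1
    show ?thesis unfolding is_mono_def
    proof (intro conjI ballI impI)
      fix W g h assume W: "W \<in> Ob C" and g: "g \<in> Hom C W X" and h: "h \<in> Hom C W X" and eq: "f \<cdot> g = f \<cdot> h"
      have "f \<cdot> (g - h) = 0" using Comp_diff[of W X Y g h f] W XO Y f g h eq by simp
      moreover have "g - h \<in> Hom C W X" using Hom_closed(4) W XO g h by blast
      ultimately obtain u where u: "u \<in> Hom C W K" "k \<cdot> u = g - h" using uni[OF W] by blast
      have "u = 0" using Id_Comp[of W K u] Comp_zero(1)[of W K K u] 1 W k u by simp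
      then show "g = h" using u Comp_zero(2)[of W K X k] W k XO by simp
    qed (rule f)
  next
    case 2
    then obtain g where g: "g \<in> Hom C X K" "k \<cdot> g = Id C X" unfolding is_iso_def by auto
    have "f = f \<cdot> (k \<cdot> g)" using g Comp_Id f XO Y by simp
    also have "\<dots> = (f \<cdot> k) \<cdot> g" using Comp_assoc[of X K X Y g k f] g f k XO Y by simp
    also have "\<dots> = 0" using k Comp_zero(1)[of X K Y g] g XO Y by simp
    finally show ?thesis using f by simp
  qed
qed

lemma Schur:
  assumes "simple_ob C X" "simple_ob C Y" "f \<in> Hom C X Y" "f \<noteq> 0"
  shows "is_iso C X Y f"
  using simple_nonzero_mono[of X Y f] assms unfolding simple_ob_def by blast

lemma Irr_props:
  shows "Irr C \<subseteq> Collect (simple_ob C)" "simple_ob C X \<Longrightarrow> \<exists>!Y. Y \<in> Irr C \<and> isomorphic C X Y"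
proof -
  define rep where "rep X = (SOME Y. simple_ob C Y \<and> isomorphic C X Y)" for X
  have rep: "simple_ob C (rep X) \<and> isomorphic C X (rep X)" if "simple_ob C X" for X
    unfolding rep_def by (rule someI[of _ X]) (use that isomorphic_refl simple_Ob in auto)
  have "\<exists>I. I \<subseteq> Collect (simple_ob C) \<and> (\<forall>X. simple_ob C X \<longrightarrow> (\<exists>!Y. Y \<in> I \<and> isomorphic C X Y))"
  proof (intro exI[of _ "rep ` Collect (simple_ob C)"] conjI allI impI)
    show "rep ` Collect (simple_ob C) \<subseteq> Collect (simple_ob C)" using rep by auto
    fix X assume X: "simple_ob C X"
    show "\<exists>!Y. Y \<in> rep ` Collect (simple_ob C) \<and> isomorphic C X Y"
    proof (rule ex1I[of _ "rep X"])
      show "rep X \<in> rep ` Collect (simple_ob C) \<and> isomorphic C X (rep X)" using X rep by auto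
      fix Y assume "Y \<in> rep ` Collect (simple_ob C) \<and> isomorphic C X Y"
      then obtain W where W: "simple_ob C W" "Y = rep W" "isomorphic C X Y" by auto
      then have "isomorphic C X W"
        using rep[of W] X by (meson isomorphic_sym isomorphic_trans simple_Ob)
      \<comment> \<open>Isomorphic objects define the same predicate, hence \<open>SOME\<close>
        picks the same representative for both; this is what makes the representative
        unique.\<close>
      then have "(\<lambda>Y. simple_ob C Y \<and> isomorphic C X Y) = (\<lambda>Y. simple_ob C Y \<and> isomorphic C W Y)"
        using W(1) X by (intro ext) (meson isomorphic_sym isomorphic_trans simple_Ob)
      then show "Y = rep X" using W by (simp add: rep_def)
    qed
  qed
  from someI_ex[OF this] show "Irr C \<subseteq> Collect (simple_ob C)"
    "simple_ob C X \<Longrightarrow> \<exists>!Y. Y \<in> Irr C \<and> isomorphic C X Y"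
    unfolding Irr_def by blast+
qed

end

section \<open>Decomposition into simple objects and multiplicities\<close>

context fusion_category
begin

lemma Irr_simple: "Z \<in> Irr C \<Longrightarrow> simple_ob C Z"
  using Irr_props(1) by auto

lemma Irr_Ob [simp]: "Z \<in> Irr C \<Longrightarrow> Z \<in> Ob C"
  using Irr_simple simple_Ob by blast

text \<open>Since \<open>k\<close> is algebraically closed and \<open>Hom X X\<close> is finite-dimensional, an endomorphism \<open>f\<close> is
  annihilated by a product of factors \<open>f - a\<close>, one of which is not invertible.\<close>

lemma End_simple:
  assumes X: "simple_ob C X" and f: "f \<in> Hom C X X"
  shows "\<exists>a. f = scal C a (Id C X)"
proof -
  have XO [simp]: "X \<in> Ob C" using X by (rule simple_Ob)
  have I [simp]: "Id C X \<in> Hom C X X" by (simp add: Id_Hom)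
  define pw where "pw n = ((\<lambda>g. f \<cdot> g) ^^ n) (Id C X)" for n
  have pw_Suc: "pw (Suc n) = f \<cdot> pw n" and pw_0: "pw 0 = Id C X" for n by (simp_all add: pw_def)
  have pw [simp]: "pw n \<in> Hom C X X" for n
    by (induction n) (simp_all add: pw_Suc pw_0 Comp_Hom[OF XO XO XO _ f])
  \<comment> \<open>Induction on a bound \<open>N\<close> for the degree of an annihilating
    polynomial, removing one root at a time.\<close>
  have step: "\<exists>a. f = scal C a (Id C X)"
    if "p \<noteq> 0" "degree p \<le> N" "(\<Sum>k\<le>N. scal C (coeff p k) (pw k)) = 0" for N p
    using that
  proof (induction N arbitrary: p)
    case 0
    then obtain a where "p = [:a:]" using degree_eq_zeroE by blast
    with 0 have "scal C a (Id C X) = 0" "a \<noteq> 0" by (auto simp: pw_0)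
    then show ?case using X V.scale_eq_0_iff unfolding simple_ob_def by blast
  next
    case (Suc N)
    show ?case
    proof (cases "degree p = 0")
      case True
      then show ?thesis using Suc.prems by (intro Suc.IH[of p]) (auto simp: coeff_eq_0)
    next
      case False
      then obtain r where "poly p r = 0" using alg_closed_imp_poly_has_root[of p] by auto
      then obtain q where q: "p = [:- r, 1:] * q" using poly_eq_0_iff_dvd by (auto simp: dvd_def)
      have q0: "q \<noteq> 0" using q Suc.prems by auto
      have "degree p = Suc (degree q)" unfolding q using q0 by (subst degree_mult_eq) auto
      then have dq: "degree q \<le> N" using Suc.prems by simp
      \<comment> \<open>\<open>h\<close> is the cofactor \<open>q\<close> evaluated at
        \<open>f\<close>, and \<open>g\<close> below is \<open>f\<close> minus the root. Their
        composite is \<open>p\<close> evaluated at \<open>f\<close>, hence zero. Either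
        \<open>g\<close> vanishes and \<open>f\<close> is the scalar \<open>r\<close>, or
        \<open>g\<close> is invertible by Schur's lemma and \<open>q\<close> annihilates
        \<open>f\<close>.\<close>
      define h where "h = (\<Sum>k\<le>N. scal C (coeff q k) (pw k))"
      have h: "h \<in> Hom C X X" unfolding h_def by (intro Hom_closed(5) Hom_closed(3)) simp_all
      have cp: "coeff p (Suc k) = coeff q k - r * coeff q (Suc k)" "coeff p 0 = - r * coeff q 0" for k
        by (simp_all add: q)
      have "0 = (\<Sum>k\<le>Suc N. scal C (coeff p k) (pw k))" using Suc.prems by simp
      also have "\<dots> = scal C (- r * coeff q 0) (pw 0)
          + (\<Sum>k\<le>N. scal C (coeff q k) (pw (Suc k)) - scal C (r * coeff q (Suc k)) (pw (Suc k)))"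
        by (subst sum.atMost_Suc_shift) (simp add: cp V.scale_left_diff_distrib)
      also have "\<dots> = (\<Sum>k\<le>N. scal C (coeff q k) (pw (Suc k)))
          - (scal C (r * coeff q 0) (pw 0) + (\<Sum>k\<le>N. scal C (r * coeff q (Suc k)) (pw (Suc k))))"
        by (simp add: sum_subtractf)
      also have "scal C (r * coeff q 0) (pw 0) + (\<Sum>k\<le>N. scal C (r * coeff q (Suc k)) (pw (Suc k)))
          = (\<Sum>k\<le>Suc N. scal C (r * coeff q k) (pw k))"
        by (subst sum.atMost_Suc_shift) simp
      also have "\<dots> = (\<Sum>k\<le>N. scal C (r * coeff q k) (pw k))"
        using dq by (simp add: coeff_eq_0)
      also have "\<dots> = scal C r h" by (simp add: h_def V.scale_sum_right)
      also have "(\<Sum>k\<le>N. scal C (coeff q k) (pw (Suc k))) = f \<cdot> h"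
        unfolding h_def pw_Suc using f
        by (subst Comp_sum(2)[of X X X f]) (auto intro: Hom_closed(3) simp: Comp_scal_right[of X X X])
      finally have eq: "f \<cdot> h - scal C r h = 0" by simp
      define g where "g = f - scal C r (Id C X)"
      have g: "g \<in> Hom C X X" unfolding g_def by (intro Hom_closed) (auto intro: f)
      have gh: "g \<cdot> h = 0"
        using Comp_add_left[of X X X h g "scal C r (Id C X)"] Comp_scal_left[of X X X h "Id C X" r]
          eq g h Hom_closed(3)[of X X "Id C X" r] by (simp add: g_def Id_Comp[of X X])
      show ?thesis
      proof (cases "g = 0")
        case True
        then show ?thesis by (auto simp: g_def)
      next
        case False
        then have "is_mono C X X g" using Schur[OF X X g] iso_is_mono by simp
        then have "h = 0" using is_mono_zero[of X X X g h] h gh by simp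
        then show ?thesis using Suc.IH[OF q0 dq] by (simp add: h_def)
      qed
    qed
  qed
  obtain B where B: "finite B" "Hom C X X = V.span B" using Hom_finite_dim[of X X] by auto
  let ?N = "card B"
  show ?thesis
  \<comment> \<open>There is one more power than spanning vectors: distinct powers form a dependent
    set, and coinciding ones give a difference of two monomials. Either way an annihilating
    polynomial of degree at most \<open>?N\<close> arises.\<close>
  proof (cases "inj_on pw {..?N}")
    case True
    have "card (pw ` {..?N}) = Suc ?N" using card_image[OF True] by simp
    moreover have "pw ` {..?N} \<subseteq> V.span B" unfolding B(2)[symmetric] by (rule image_subsetI) (rule pw)
    ultimately have "V.dependent (pw ` {..?N})"
      using V.independent_span_bound[OF B(1), of "pw ` {..?N}"] by auto
    then obtain u v where u: "v \<in> pw ` {..?N}" "u v \<noteq> 0" "(\<Sum>v\<in>pw ` {..?N}. scal C (u v) v) = 0"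
      using V.dependent_finite[of "pw ` {..?N}"] by auto
    define p where "p = (\<Sum>k\<le>?N. monom (u (pw k)) k)"
    have cp: "coeff p k = (if k \<le> ?N then u (pw k) else 0)" for k
      by (simp add: p_def coeff_sum)
    show ?thesis
    proof (rule step[of p ?N])
      show "p \<noteq> 0"
      proof
        assume "p = 0"
        moreover obtain k where "k \<le> ?N" "v = pw k" using u(1) by auto
        ultimately show False using cp[of k] u(2) by simp
      qed
      show "degree p \<le> ?N" by (rule degree_le) (simp add: cp)
      show "(\<Sum>k\<le>?N. scal C (coeff p k) (pw k)) = 0" using u(3) by (simp add: cp sum.reindex[OF True])
    qed
  next
    case False
    then obtain i j where ij: "i \<le> ?N" "j \<le> ?N" "pw i = pw j" "i \<noteq> j" by (auto simp: inj_on_def)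
    define p where "p = monom 1 i - monom (1::'k) j"
    have cp: "coeff p k = (if k = i then 1 else 0) - (if k = j then 1 else 0)" for k
      by (simp add: p_def)
    show ?thesis
    proof (rule step[of p ?N])
      show "p \<noteq> 0" using cp[of i] ij by auto
      show "degree p \<le> ?N" by (rule degree_le) (use ij in \<open>auto simp: cp\<close>)
      have "(\<Sum>k\<le>?N. scal C (coeff p k) (pw k)) = (\<Sum>k\<le>?N. (if k = i then pw i else 0) - (if k = j then pw j else 0))"
        by (rule sum.cong) (auto simp: cp V.scale_left_diff_distrib)
      then show "(\<Sum>k\<le>?N. scal C (coeff p k) (pw k)) = 0"
        using ij by (simp add: sum_subtractf)
    qed
  qed
qed

lemma isarr_End_simple:
  assumes "simple_ob C X" "isarr p" "src p = X" "tgt p = X"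
  shows "\<exists>a. p = smul a (ident X)"
proof -
  obtain a where "mid p = scal C a (Id C X)"
    using End_simple[of X "mid p"] assms by (auto simp: isarr_def)
  then show ?thesis using assms by (intro exI[of _ a] src_mid_tgt_eqI) simp_all
qed

lemma direct_sumE:
  assumes "is_direct_sum C n S X"
  obtains inj prj where "X \<in> Ob C" "\<And>i. i < n \<Longrightarrow> S i \<in> Ob C"
    "\<And>i. i < n \<Longrightarrow> inj i \<in> Hom C (S i) X" "\<And>i. i < n \<Longrightarrow> prj i \<in> Hom C X (S i)"
    "\<And>i j. i < n \<Longrightarrow> j < n \<Longrightarrow> prj i \<cdot> inj j = (if i = j then Id C (S i) else 0)"
    "(\<Sum>i<n. inj i \<cdot> prj i) = Id C X"
  using assms unfolding is_direct_sum_def by blast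

lemma Hom_simple:
  assumes "simple_ob C Z" "simple_ob C W" "g \<in> Hom C Z W" "h \<in> Hom C Z W" "is_iso C Z W h"
  shows "\<exists>a. g = scal C a h"
proof -
  have O: "Z \<in> Ob C" "W \<in> Ob C" using assms simple_Ob by auto
  obtain h' where h': "h' \<in> Hom C W Z" "h \<cdot> h' = Id C W" using assms(5) by (auto simp: is_iso_def)
  obtain a where a: "h' \<cdot> g = scal C a (Id C Z)"
    using End_simple[OF assms(1), of "h' \<cdot> g"] Comp_Hom[of Z W Z g h'] O assms h' by auto
  have "g = h \<cdot> (h' \<cdot> g)"
    using Comp_assoc[of Z W Z W g h' h] Id_Comp[of Z W g] O assms h' by simp
  also have "\<dots> = scal C a h"
    using a Comp_scal_right[of Z Z W "Id C Z" h a] Comp_Id[of Z W h] Id_Hom O assms by simp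
  finally show ?thesis by blast
qed

lemma Hom_simple_zero:
  assumes "simple_ob C Z" "simple_ob C W" "g \<in> Hom C Z W" "\<not> isomorphic C Z W"
  shows "g = 0"
  using Schur[OF assms(1,2,3)] assms(4) by (auto simp: isomorphic_def)

text \<open>Composing the injections with chosen isomorphisms from \<open>Z\<close> to the summands
  of its type gives a basis; components at all other summands vanish by Schur's lemma. The dual
  family uses the projections, and the common index set makes both Hom spaces equally large.\<close>

lemma coord_basis_Hom:
  assumes ds: "is_direct_sum C n S X" and S: "\<And>i. i < n \<Longrightarrow> simple_ob C (S i)" and Z: "simple_ob C Z"
  shows "\<exists>b. coord_basis {i. i < n \<and> isomorphic C (S i) Z} b (Hom C Z X)"
    "\<exists>b. coord_basis {i. i < n \<and> isomorphic C (S i) Z} b (Hom C X Z)"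
proof -
  let ?J = "{i. i < n \<and> isomorphic C (S i) Z}"
  obtain inj prj where X [simp]: "X \<in> Ob C" and SO [simp]: "\<And>i. i < n \<Longrightarrow> S i \<in> Ob C"
    and inj [simp]: "\<And>i. i < n \<Longrightarrow> inj i \<in> Hom C (S i) X" and prj [simp]: "\<And>i. i < n \<Longrightarrow> prj i \<in> Hom C X (S i)"
    and ortho: "\<And>i j. i < n \<Longrightarrow> j < n \<Longrightarrow> prj i \<cdot> inj j = (if i = j then Id C (S i) else 0)"
    and total: "(\<Sum>i<n. inj i \<cdot> prj i) = Id C X"
    using direct_sumE[OF ds] by blast
  have ZO [simp]: "Z \<in> Ob C" using Z by (rule simple_Ob)
  have IZ: "Id C Z \<noteq> 0" using Z by (simp add: simple_ob_def)
  have "\<forall>i. \<exists>h h'. i \<in> ?J \<longrightarrow> h \<in> Hom C Z (S i) \<and> h' \<in> Hom C (S i) Z \<and> h' \<cdot> h = Id C Z \<and> h \<cdot> h' = Id C (S i)"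
    by (auto simp: isomorphic_def is_iso_def)
  from choice[OF this] obtain h where "\<forall>i. \<exists>h'. i \<in> ?J \<longrightarrow> h i \<in> Hom C Z (S i) \<and> h' \<in> Hom C (S i) Z \<and> h' \<cdot> h i = Id C Z \<and> h i \<cdot> h' = Id C (S i)"
    by blast
  from choice[OF this] obtain h' where "\<forall>i. i \<in> ?J \<longrightarrow> h i \<in> Hom C Z (S i) \<and> h' i \<in> Hom C (S i) Z \<and> h' i \<cdot> h i = Id C Z \<and> h i \<cdot> h' i = Id C (S i)"
    by blast
  then have h: "\<And>i. i \<in> ?J \<Longrightarrow> h i \<in> Hom C Z (S i)" "\<And>i. i \<in> ?J \<Longrightarrow> h' i \<in> Hom C (S i) Z"
      "\<And>i. i \<in> ?J \<Longrightarrow> h' i \<cdot> h i = Id C Z" "\<And>i. i \<in> ?J \<Longrightarrow> h i \<cdot> h' i = Id C (S i)"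
    by blast+
  have iso: "is_iso C Z (S i) (h i)" "is_iso C (S i) Z (h' i)" if "i \<in> ?J" for i
    unfolding is_iso_def using h[OF that] by blast+
  have niso: "\<not> isomorphic C Z (S i)" "\<not> isomorphic C (S i) Z" if "i < n" "i \<notin> ?J" for i
    using that isomorphic_sym by auto
  have fin: "finite ?J" by simp
  have ip: "inj i \<cdot> prj i \<in> Hom C X X" if "i < n" for i using Comp_Hom[of X "S i" X] that by simp
  have b1: "coord_basis ?J (\<lambda>i. inj i \<cdot> h i) (Hom C Z X)" unfolding coord_basis_def
  proof (intro conjI fin allI impI ballI)
    have bH: "inj i \<cdot> h i \<in> Hom C Z X" if "i \<in> ?J" for i using Comp_Hom[of Z "S i" X] h that by auto
    show "Hom C Z X = range (\<lambda>c. \<Sum>i\<in>?J. scal C (c i) (inj i \<cdot> h i))"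
    proof (intro subset_antisym subsetI)
      fix g assume g: "g \<in> Hom C Z X"
      have pg: "prj i \<cdot> g \<in> Hom C Z (S i)" if "i < n" for i using Comp_Hom[of Z X "S i" g] g that by simp
      have "\<forall>i. \<exists>a. i \<in> ?J \<longrightarrow> prj i \<cdot> g = scal C a (h i)"
        using Hom_simple[OF Z S pg h(1) iso(1)] by auto
      from choice[OF this] obtain c where c: "\<And>i. i \<in> ?J \<Longrightarrow> prj i \<cdot> g = scal C (c i) (h i)" by blast
      have "g = (\<Sum>i<n. inj i \<cdot> prj i) \<cdot> g" using total Id_Comp[OF ZO X g] by simp
      also have "\<dots> = (\<Sum>i<n. (inj i \<cdot> prj i) \<cdot> g)"
        by (rule Comp_sum(1)[OF ZO X X g]) (simp add: ip)
      also have "\<dots> = (\<Sum>i<n. inj i \<cdot> (prj i \<cdot> g))"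
        by (intro sum.cong refl Comp_assoc[OF ZO X SO X g prj inj]) auto
      also have "\<dots> = (\<Sum>i<n. if i \<in> ?J then scal C (c i) (inj i \<cdot> h i) else 0)"
      proof (rule sum.cong[OF refl])
        fix i assume "i \<in> {..<n}"
        then have i: "i < n" by simp
        show "inj i \<cdot> (prj i \<cdot> g) = (if i \<in> ?J then scal C (c i) (inj i \<cdot> h i) else 0)"
        proof (cases "i \<in> ?J")
          case True
          then show ?thesis using c[OF True] Comp_scal_right[of Z "S i" X "h i" "inj i"] i h by simp
        next
          case False
          then have "prj i \<cdot> g = 0" using Hom_simple_zero[OF Z S[OF i] pg[OF i]] niso i by auto
          then show ?thesis using False Comp_zero(2)[of Z "S i" X "inj i"] i by simp
        qed
      qed
      also have "\<dots> = (\<Sum>i\<in>?J. scal C (c i) (inj i \<cdot> h i))"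
        by (simp add: sum.If_cases Int_def lessThan_def conj_commute)
      finally show "g \<in> range (\<lambda>c. \<Sum>i\<in>?J. scal C (c i) (inj i \<cdot> h i))" by blast
    qed (auto intro!: Hom_closed bH)
    fix c i assume 0: "(\<Sum>i\<in>?J. scal C (c i) (inj i \<cdot> h i)) = 0" and i: "i \<in> ?J"
    then have i': "i < n" by simp
    have pi: "prj i \<cdot> (inj j \<cdot> h j) = (if j = i then h i else 0)" if j: "j \<in> ?J" for j
    proof -
      have "prj i \<cdot> (inj j \<cdot> h j) = (prj i \<cdot> inj j) \<cdot> h j"
        using Comp_assoc[of Z "S j" X "S i" "h j" "inj j" "prj i"] h j i' by simp
      then show ?thesis
        using ortho[of i j] j i' h Id_Comp[of Z "S i" "h i"] Comp_zero(1)[of Z "S j" "S i" "h j"] i by auto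
    qed
    have "0 = prj i \<cdot> (\<Sum>j\<in>?J. scal C (c j) (inj j \<cdot> h j))"
      using 0 Comp_zero(2)[of Z X "S i" "prj i"] i' by simp
    also have "\<dots> = (\<Sum>j\<in>?J. prj i \<cdot> scal C (c j) (inj j \<cdot> h j))"
      using i' by (intro Comp_sum(2)[of Z X "S i"]) (auto intro!: Hom_closed bH)
    also have "\<dots> = (\<Sum>j\<in>?J. if j = i then scal C (c i) (h i) else 0)"
      using i' by (intro sum.cong refl) (auto simp: Comp_scal_right[of Z X "S i"] bH pi)
    also have "\<dots> = scal C (c i) (h i)" using i by simp
    finally have "scal C (c i) (h i) = 0" by simp
    moreover have "h i \<noteq> 0" using h[OF i] IZ Comp_zero(2)[of Z "S i" Z "h' i"] i' by auto
    ultimately show "c i = 0" using V.scale_eq_0_iff by blast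
  qed
  have b2: "coord_basis ?J (\<lambda>i. h' i \<cdot> prj i) (Hom C X Z)" unfolding coord_basis_def
  proof (intro conjI fin allI impI ballI)
    have bH: "h' i \<cdot> prj i \<in> Hom C X Z" if "i \<in> ?J" for i using Comp_Hom[of X "S i" Z] h that by auto
    show "Hom C X Z = range (\<lambda>c. \<Sum>i\<in>?J. scal C (c i) (h' i \<cdot> prj i))"
    proof (intro subset_antisym subsetI)
      fix g assume g: "g \<in> Hom C X Z"
      have pg: "g \<cdot> inj i \<in> Hom C (S i) Z" if "i < n" for i using Comp_Hom[of "S i" X Z _ g] g that by simp
      have "\<forall>i. \<exists>a. i \<in> ?J \<longrightarrow> g \<cdot> inj i = scal C a (h' i)"
        using Hom_simple[OF S Z pg h(2) iso(2)] by auto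
      from choice[OF this] obtain c where c: "\<And>i. i \<in> ?J \<Longrightarrow> g \<cdot> inj i = scal C (c i) (h' i)" by blast
      have "g = g \<cdot> (\<Sum>i<n. inj i \<cdot> prj i)" using total Comp_Id[OF X ZO g] by simp
      also have "\<dots> = (\<Sum>i<n. g \<cdot> (inj i \<cdot> prj i))"
        by (rule Comp_sum(2)[OF X X ZO g]) (simp add: ip)
      also have "\<dots> = (\<Sum>i<n. (g \<cdot> inj i) \<cdot> prj i)"
        by (intro sum.cong refl Comp_assoc[OF X SO X ZO prj inj g, symmetric]) auto
      also have "\<dots> = (\<Sum>i<n. if i \<in> ?J then scal C (c i) (h' i \<cdot> prj i) else 0)"
      proof (rule sum.cong[OF refl])
        fix i assume "i \<in> {..<n}"
        then have i: "i < n" by simp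
        show "(g \<cdot> inj i) \<cdot> prj i = (if i \<in> ?J then scal C (c i) (h' i \<cdot> prj i) else 0)"
        proof (cases "i \<in> ?J")
          case True
          then show ?thesis using c[OF True] Comp_scal_left[of X "S i" Z "prj i" "h' i"] i h by simp
        next
          case False
          then have "g \<cdot> inj i = 0" using Hom_simple_zero[OF S[OF i] Z pg[OF i]] niso i by auto
          then show ?thesis using False Comp_zero(1)[of X "S i" Z "prj i"] i by simp
        qed
      qed
      also have "\<dots> = (\<Sum>i\<in>?J. scal C (c i) (h' i \<cdot> prj i))"
        by (simp add: sum.If_cases Int_def lessThan_def conj_commute)
      finally show "g \<in> range (\<lambda>c. \<Sum>i\<in>?J. scal C (c i) (h' i \<cdot> prj i))" by blast
    qed (auto intro!: Hom_closed bH)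
    fix c i assume 0: "(\<Sum>i\<in>?J. scal C (c i) (h' i \<cdot> prj i)) = 0" and i: "i \<in> ?J"
    then have i': "i < n" by simp
    have pi: "(h' j \<cdot> prj j) \<cdot> inj i = (if j = i then h' i else 0)" if j: "j \<in> ?J" for j
    proof -
      have "(h' j \<cdot> prj j) \<cdot> inj i = h' j \<cdot> (prj j \<cdot> inj i)"
        using Comp_assoc[of "S i" X "S j" Z "inj i" "prj j" "h' j"] h j i' by simp
      then show ?thesis
        using ortho[of j i] j i' h Comp_Id[of "S i" Z "h' i"] Comp_zero(2)[of "S i" "S j" Z "h' j"] i by auto
    qed
    have "0 = (\<Sum>j\<in>?J. scal C (c j) (h' j \<cdot> prj j)) \<cdot> inj i"
      using 0 Comp_zero(1)[of "S i" X Z "inj i"] i' by simp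
    also have "\<dots> = (\<Sum>j\<in>?J. scal C (c j) (h' j \<cdot> prj j) \<cdot> inj i)"
      using i' by (intro Comp_sum(1)[of "S i" X Z]) (auto intro!: Hom_closed bH)
    also have "\<dots> = (\<Sum>j\<in>?J. if j = i then scal C (c i) (h' i) else 0)"
      using i' by (intro sum.cong refl) (auto simp: Comp_scal_left[of "S i" X Z] bH pi)
    also have "\<dots> = scal C (c i) (h' i)" using i by simp
    finally have "scal C (c i) (h' i) = 0" by simp
    moreover have "h' i \<noteq> 0" using h[OF i] IZ Comp_zero(1)[of Z "S i" Z "h i"] i' by auto
    ultimately show "c i = 0" using V.scale_eq_0_iff by blast
  qed
  show "\<exists>b. coord_basis ?J b (Hom C Z X)" "\<exists>b. coord_basis ?J b (Hom C X Z)" using b1 b2 by blast+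
qed

text \<open>Connects multiplicity, a dimension by definition, with counting summands in any
  decomposition.\<close>

lemma multiplicity_card:
  assumes ds: "is_direct_sum C n S X" and S: "\<And>i. i < n \<Longrightarrow> simple_ob C (S i)" and Z: "simple_ob C Z"
  shows "multiplicity C Z X = card {i. i < n \<and> isomorphic C (S i) Z}"
  using coord_basis_Hom(1)[OF ds S Z] coord_basis_dim unfolding multiplicity_def by blast

lemma multiplicity_pos:
  assumes X: "X \<in> Ob C" and Z: "simple_ob C Z"
  shows "multiplicity C Z X > 0 \<longleftrightarrow> (\<exists>f\<in>Hom C Z X. f \<noteq> 0)"
proof -
  obtain n S where S: "\<And>i. i < n \<Longrightarrow> simple_ob C (S i)" "is_direct_sum C n S X"
    using semisimple[OF X] by blast
  let ?J = "{i. i < n \<and> isomorphic C (S i) Z}"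
  obtain b where b: "coord_basis ?J b (Hom C Z X)"
    using coord_basis_Hom(1)[OF S(2,1) Z] by blast
  have "(\<exists>f\<in>Hom C Z X. f \<noteq> 0) \<longleftrightarrow> ?J \<noteq> {}"
  proof
    assume "?J \<noteq> {}"
    then obtain i where i: "i \<in> ?J" by blast
    have "(\<Sum>j\<in>?J. scal C 1 (b j)) \<noteq> 0" using b i unfolding coord_basis_def by fastforce
    moreover have "(\<Sum>j\<in>?J. scal C 1 (b j)) \<in> Hom C Z X" using b by (rule coord_basis_mem)
    ultimately show "\<exists>f\<in>Hom C Z X. f \<noteq> 0" by blast
  next
    assume "\<exists>f\<in>Hom C Z X. f \<noteq> 0"
    then obtain c where "(\<Sum>i\<in>?J. scal C (c i) (b i)) \<noteq> 0" using b by (auto simp: coord_basis_def)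
    then show "?J \<noteq> {}" by (metis sum.empty)
  qed
  then show ?thesis using multiplicity_card[OF S(2,1) Z] by (simp add: card_gt_0_iff)
qed

lemma multiplicity_subobject:
  assumes "X \<in> Ob C" "simple_ob C Z" "subobject C Y X" "multiplicity C Z Y > 0"
  shows "multiplicity C Z X > 0"
proof -
  have YO: "Y \<in> Ob C" and ZO: "Z \<in> Ob C" using assms simple_Ob by (auto simp: subobject_def)
  obtain m where m: "is_mono C Y X m" using assms by (auto simp: subobject_def)
  obtain f where f: "f \<in> Hom C Z Y" "f \<noteq> 0" using assms YO multiplicity_pos by blast
  have "m \<cdot> f \<noteq> 0" using is_mono_zero[OF YO assms(1) ZO m f(1)] f by blast
  moreover have "m \<cdot> f \<in> Hom C Z X"
    using Comp_Hom[OF ZO YO assms(1) f(1), of m] m by (simp add: is_mono_def)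
  ultimately show ?thesis using multiplicity_pos assms by blast
qed

lemma subobject_if_multiplicity:
  assumes "X \<in> Ob C" "simple_ob C Z" "multiplicity C Z X > 0"
  shows "subobject C Z X"
  using assms multiplicity_pos[of X Z] simple_nonzero_mono[of Z X] simple_Ob unfolding subobject_def by blast

lemma sum_multiplicity:
  fixes f :: "'o \<Rightarrow> 'r::comm_semiring_1"
  assumes ds: "is_direct_sum C n S X" and S: "\<And>i. i < n \<Longrightarrow> simple_ob C (S i)"
    and f: "\<And>Y Z. simple_ob C Y \<Longrightarrow> Z \<in> Irr C \<Longrightarrow> isomorphic C Y Z \<Longrightarrow> f Y = f Z"
  shows "(\<Sum>i<n. f (S i)) = (\<Sum>Z\<in>Irr C. of_nat (multiplicity C Z X) * f Z)"
proof -
  have "f (S i) = (\<Sum>Z\<in>Irr C. if isomorphic C (S i) Z then f Z else 0)" if i: "i < n" for i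
  proof -
    obtain Y where Y: "Y \<in> Irr C" "isomorphic C (S i) Y" "\<And>Z. Z \<in> Irr C \<Longrightarrow> isomorphic C (S i) Z \<Longrightarrow> Z = Y"
      using Irr_props(2)[OF S[OF i]] by blast
    have "(\<Sum>Z\<in>Irr C. if isomorphic C (S i) Z then f Z else 0) = (\<Sum>Z\<in>Irr C. if Z = Y then f Y else 0)"
    proof (rule sum.cong[OF refl])
      fix Z assume "Z \<in> Irr C"
      then have "isomorphic C (S i) Z \<longleftrightarrow> Z = Y" using Y by metis
      then show "(if isomorphic C (S i) Z then f Z else 0) = (if Z = Y then f Y else 0)" by simp
    qed
    then show ?thesis using f[OF S[OF i] Y(1,2)] Y(1) finite_Irr by simp
  qed
  then have "(\<Sum>i<n. f (S i)) = (\<Sum>i<n. \<Sum>Z\<in>Irr C. if isomorphic C (S i) Z then f Z else 0)"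
    by simp
  also have "\<dots> = (\<Sum>Z\<in>Irr C. \<Sum>i<n. if isomorphic C (S i) Z then f Z else 0)"
    by (rule sum.swap)
  also have "\<dots> = (\<Sum>Z\<in>Irr C. of_nat (multiplicity C Z X) * f Z)"
  proof (rule sum.cong[OF refl])
    fix Z assume Z: "Z \<in> Irr C"
    have "(\<Sum>i<n. if isomorphic C (S i) Z then f Z else 0) = (\<Sum>i\<in>{i. i < n \<and> isomorphic C (S i) Z}. f Z)"
      by (simp add: sum.If_cases Int_def lessThan_def)
    then show "(\<Sum>i<n. if isomorphic C (S i) Z then f Z else 0) = of_nat (multiplicity C Z X) * f Z"
      using multiplicity_card[OF ds S Irr_simple[OF Z]] by simp
  qed
  finally show ?thesis .
qed

text \<open>The case of one summand contains invariance under isomorphism, and the empty case forces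
  the value 0 on zero objects; such a function is determined by its values on simple
  objects.\<close>

definition additive_on_objects :: "('o \<Rightarrow> 'r::comm_semiring_1) \<Rightarrow> bool" where
  "additive_on_objects f \<longleftrightarrow> (\<forall>n S X. is_direct_sum C n S X \<longrightarrow> f X = (\<Sum>i<n. f (S i)))"

lemma additive_iso:
  assumes "additive_on_objects f" "X \<in> Ob C" "Y \<in> Ob C" "isomorphic C X Y"
  shows "f X = f Y"
  using assms(1) direct_sum_iso[OF assms(2-4)] unfolding additive_on_objects_def by fastforce

lemma additive_multiplicity:
  assumes f: "additive_on_objects f" and X: "X \<in> Ob C"
  shows "f X = (\<Sum>Z\<in>Irr C. of_nat (multiplicity C Z X) * f Z)"
proof -
  obtain n S where S: "\<And>i. i < n \<Longrightarrow> simple_ob C (S i)" "is_direct_sum C n S X"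
    using semisimple[OF X] by blast
  have "f X = (\<Sum>i<n. f (S i))" using f S by (simp add: additive_on_objects_def)
  then show ?thesis
    using sum_multiplicity[OF S(2,1), of f] additive_iso[OF f] simple_Ob Irr_Ob by auto
qed

lemma multiplicity_simple:
  assumes "simple_ob C X" "Z \<in> Irr C"
  shows "multiplicity C Z X = (if isomorphic C X Z then 1 else 0)"
proof -
  have "is_direct_sum C 1 (\<lambda>_. X) X"
    using assms simple_Ob isomorphic_refl direct_sum_iso by blast
  from multiplicity_card[OF this, of Z] show ?thesis using assms Irr_simple by auto
qed

text \<open>Bending one leg with \<^const>\<open>cup\<close> identifies \<open>Hom (X\<^sup>* \<otimes> Z) W\<close> with \<open>Hom Z (X \<otimes> W)\<close>.\<close>

lemma multiplicity_dual:
  assumes X [simp]: "X \<in> Ob C" and Z: "simple_ob C Z" and W: "simple_ob C W"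
  shows "multiplicity C Z (X \<boxtimes> W) = multiplicity C W (dual C X \<boxtimes> Z)"
proof -
  have O [simp]: "Z \<in> Ob C" "W \<in> Ob C" using Z W simple_Ob by auto
  let ?D = "dual C X"
  let ?k = "comp_at (cup X) Z" and ?e = "comp_at (cap X) W"
  note cup = dia_at[OF dia_cup[OF X]] and cap = dia_at[OF dia_cap[OF X]]
  note [simp] = cup(1-3) cap(1-3)
  \<comment> \<open>\<open>T\<close> bends the strand of \<open>X\<close> with \<open>cup\<close>
    and \<open>T'\<close> bends it back with \<open>cap\<close>; the components of the snake
    identities at \<open>W\<close> and at \<open>Z\<close> make them mutually inverse.\<close>
  define T where "T f = (Id C X \<boxdot> f) \<cdot> mid ?k" for f
  define T' where "T' g = mid ?e \<cdot> (Id C ?D \<boxdot> g)" for g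
  have kH: "mid ?k \<in> Hom C Z (X \<boxtimes> (?D \<boxtimes> Z))" and eH: "mid ?e \<in> Hom C (?D \<boxtimes> (X \<boxtimes> W)) W"
    using cup(1-3)[of Z] cap(1-3)[of W] by (simp_all add: isarr_def del: isarr_Ob cup(1) cap(1))
  have TH: "T f \<in> Hom C Z (X \<boxtimes> W)" if "f \<in> Hom C (?D \<boxtimes> Z) W" for f
    unfolding T_def using that kH
    by (intro Comp_Hom[of Z "X \<boxtimes> (?D \<boxtimes> Z)" "X \<boxtimes> W"] tensor_Hom Id_Hom) simp_all
  have T'H: "T' g \<in> Hom C (?D \<boxtimes> Z) W" if "g \<in> Hom C Z (X \<boxtimes> W)" for g
    unfolding T'_def using that eH
    by (intro Comp_Hom[of "?D \<boxtimes> Z" "?D \<boxtimes> (X \<boxtimes> W)" W] tensor_Hom Id_Hom) simp_all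
  have z1: "(ident X \<bowtie> ?e) \<star> comp_at (cup X) (X \<boxtimes> W) = ident (X \<boxtimes> W)"
  proof -
    have d: "dia (whisk [] (cup X) [X]) [X] [X, ?D, X]" "dia (whisk [X] (cap X) []) [X, ?D, X] [X]"
      by ((rule dia_intros dia_cup dia_cap | simp)+)
    show ?thesis
      using arg_cong[OF zigzag(1)[OF X], of "\<lambda>F. comp_at F W"]
      by (simp add: dcomp_Some(2)[OF d] whisk_Some(2)[OF dia_cup] whisk_Some(2)[OF dia_cap] did_Some(2))
  qed
  have z2: "comp_at (cap X) (?D \<boxtimes> Z) \<star> (ident ?D \<bowtie> ?k) = ident (?D \<boxtimes> Z)"
  proof -
    have d: "dia (whisk [?D] (cup X) []) [?D] [?D, X, ?D]" "dia (whisk [] (cap X) [?D]) [?D, X, ?D] [?D]"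
      by ((rule dia_intros dia_cup dia_cap | simp)+)
    show ?thesis
      using arg_cong[OF zigzag(2)[OF X], of "\<lambda>F. comp_at F Z"]
      by (simp add: dcomp_Some(2)[OF d] whisk_Some(2)[OF dia_cup] whisk_Some(2)[OF dia_cap] did_Some(2))
  qed
  have TT: "T (T' g) = g" if g: "g \<in> Hom C Z (X \<boxtimes> W)" for g
  proof -
    let ?g = "(Z, g, X \<boxtimes> W)"
    have [simp]: "isarr ?g" using g by (simp add: isarr_triple)
    have "(ident X \<bowtie> (?e \<star> (ident ?D \<bowtie> ?g))) \<star> ?k = (ident X \<bowtie> ?e) \<star> (ident X \<bowtie> ident ?D \<bowtie> ?g) \<star> ?k"
      by (simp add: tens_cmp_ident)
    also have "(ident X \<bowtie> ident ?D \<bowtie> ?g) \<star> ?k = comp_at (cup X) (X \<boxtimes> W) \<star> ?g"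
      using cup(4)[of ?g Z "X \<boxtimes> W"] by simp
    also have "(ident X \<bowtie> ?e) \<star> comp_at (cup X) (X \<boxtimes> W) \<star> ?g = ?g"
      by (subst cmp_reassoc[OF z1]) simp_all
    finally have "mid ((ident X \<bowtie> (?e \<star> (ident ?D \<bowtie> ?g))) \<star> ?k) = g" by simp
    then show ?thesis by (simp add: T_def T'_def)
  qed
  have T'T: "T' (T f) = f" if f: "f \<in> Hom C (?D \<boxtimes> Z) W" for f
  proof -
    let ?f = "(?D \<boxtimes> Z, f, W)"
    have [simp]: "isarr ?f" using f by (simp add: isarr_triple)
    have "?e \<star> (ident ?D \<bowtie> ((ident X \<bowtie> ?f) \<star> ?k)) = (?e \<star> (ident ?D \<bowtie> ident X \<bowtie> ?f)) \<star> (ident ?D \<bowtie> ?k)"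
      by (simp add: tens_cmp_ident)
    also have "?e \<star> (ident ?D \<bowtie> ident X \<bowtie> ?f) = ?f \<star> comp_at (cap X) (?D \<boxtimes> Z)"
      using cap(4)[of ?f "?D \<boxtimes> Z" W] by simp
    also have "(?f \<star> comp_at (cap X) (?D \<boxtimes> Z)) \<star> (ident ?D \<bowtie> ?k) = ?f"
      by (simp add: z2)
    finally have "mid (?e \<star> (ident ?D \<bowtie> ((ident X \<bowtie> ?f) \<star> ?k))) = f" by simp
    then show ?thesis by (simp add: T_def T'_def)
  qed
  have T_add: "T (f + g) = T f + T g" if "f \<in> Hom C (?D \<boxtimes> Z) W" "g \<in> Hom C (?D \<boxtimes> Z) W" for f g
    unfolding T_def using that kH tensor_add_right[of X X "?D \<boxtimes> Z" W "Id C X" f g] Id_Hom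
      Comp_add_left[of Z "X \<boxtimes> (?D \<boxtimes> Z)" "X \<boxtimes> W" "mid ?k" "Id C X \<boxdot> f" "Id C X \<boxdot> g"]
      tensor_Hom[of X X "?D \<boxtimes> Z" W] by simp
  have T_scal: "T (scal C a f) = scal C a (T f)" if "f \<in> Hom C (?D \<boxtimes> Z) W" for a f
    unfolding T_def using that kH tensor_scal_right[of X X "?D \<boxtimes> Z" W "Id C X" f a] Id_Hom
      Comp_scal_left[of Z "X \<boxtimes> (?D \<boxtimes> Z)" "X \<boxtimes> W" "mid ?k" "Id C X \<boxdot> f" a]
      tensor_Hom[of X X "?D \<boxtimes> Z" W] by simp
  have T0: "T 0 = 0" using T_add[of 0 0] Hom_closed(1)[of "?D \<boxtimes> Z" W] by simp
  have T_sum: "T (\<Sum>i\<in>J. scal C (c i) (b i)) = (\<Sum>i\<in>J. scal C (c i) (T (b i)))"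
    if "\<And>i. i \<in> J \<Longrightarrow> b i \<in> Hom C (?D \<boxtimes> Z) W" "finite J" for J and b :: "nat \<Rightarrow> 'm" and c
    using that(2,1)
  proof (induction J)
    case (insert i J)
    have "T (scal C (c i) (b i) + (\<Sum>i\<in>J. scal C (c i) (b i)))
       = T (scal C (c i) (b i)) + T (\<Sum>i\<in>J. scal C (c i) (b i))"
      by (intro T_add Hom_closed) (use insert in auto)
    then show ?case using insert T_scal by simp
  qed (simp add: T0)
  obtain n S where S: "\<And>i. i < n \<Longrightarrow> simple_ob C (S i)" "is_direct_sum C n S (?D \<boxtimes> Z)"
    using semisimple[of "?D \<boxtimes> Z"] by auto
  let ?J = "{i. i < n \<and> isomorphic C (S i) W}"
  \<comment> \<open>Bending produces maps into \<open>W\<close>, whereas the multiplicity of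
    \<open>W\<close> is defined by maps out of it. Semisimplicity, in the form of the common index
    set \<open>?J\<close>, makes up for this.\<close>
  obtain b where b: "coord_basis ?J b (Hom C (?D \<boxtimes> Z) W)"
    using coord_basis_Hom(2)[OF S(2,1) W] by blast
  have bH: "b i \<in> Hom C (?D \<boxtimes> Z) W" if i: "i \<in> ?J" for i
  proof -
    have "(\<Sum>j\<in>?J. scal C (if j = i then 1 else 0) (b j)) = (\<Sum>j\<in>?J. if j = i then b i else 0)"
      by (rule sum.cong) auto
    then have "b i = (\<Sum>j\<in>?J. scal C (if j = i then 1 else 0) (b j))" using i by simp
    then show ?thesis using coord_basis_mem[OF b] by metis
  qed
  have "coord_basis ?J (\<lambda>i. T (b i)) (Hom C Z (X \<boxtimes> W))"
  proof (rule coord_basis_map[OF b])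
    show "T (\<Sum>i\<in>?J. scal C (c i) (b i)) = (\<Sum>i\<in>?J. scal C (c i) (T (b i)))" for c
      by (rule T_sum) (use bH in auto)
    show "u = 0" if "u \<in> Hom C (?D \<boxtimes> Z) W" "T u = 0" for u
      using T'T[OF that(1)] T'T[of 0] Hom_closed(1)[of "?D \<boxtimes> Z" W] T0 that(2) by simp
    show "T ` Hom C (?D \<boxtimes> Z) W = Hom C Z (X \<boxtimes> W)"
      using TH T'H TT by force
  qed
  then show ?thesis
    using multiplicity_card[OF S(2,1) W] coord_basis_dim by (simp add: multiplicity_def)
qed

end

section \<open>Algebraic numbers\<close>

global_interpretation ratvec: vector_space "\<lambda>(r::rat) (x::'k::field_char_0). of_rat r * x"
  by unfold_locales (simp_all add: algebra_simps of_rat_add of_rat_mult)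

text \<open>The multiples of \<open>a\<close> by powers of \<open>x\<close> stay in a rational space
  of finite dimension, so some of them coincide or are linearly dependent. Cancelling the nonzero
  \<open>a\<close> leaves a rational polynomial with root \<open>x\<close>.\<close>

lemma algebraic_if_finite_invariant:
  fixes x :: "'k::field_char_0"
  assumes A: "finite A" "a \<in> A" "a \<noteq> 0" and x: "\<And>b. b \<in> A \<Longrightarrow> x * b \<in> ratvec.span A"
  shows "algebraic x"
proof -
  have step: "x * v \<in> ratvec.span A" if "v \<in> ratvec.span A" for v
    using that
  proof (induction rule: ratvec.span_induct_alt)
    case (step r b v)
    have "x * (of_rat r * b + v) = of_rat r * (x * b) + x * v" by (simp add: algebra_simps)
    then show ?case using x[OF step(1)] step(2) ratvec.span_add ratvec.span_scale by metis
  qed (simp add: ratvec.span_zero)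
  have pw: "x ^ n * a \<in> ratvec.span A" for n
    by (induction n) (use A step in \<open>auto simp: ratvec.span_base mult.assoc\<close>)
  let ?N = "card A" let ?v = "\<lambda>n. x ^ n * a"
  show ?thesis
  proof (cases "inj_on ?v {..?N}")
    case True
    have "card (?v ` {..?N}) = Suc ?N" using card_image[OF True] by simp
    moreover have "?v ` {..?N} \<subseteq> ratvec.span A" using pw by auto
    ultimately have "ratvec.dependent (?v ` {..?N})"
      using ratvec.independent_span_bound[OF A(1), of "?v ` {..?N}"] by auto
    then obtain u k where u: "k \<le> ?N" "u (?v k) \<noteq> 0" "(\<Sum>v\<in>?v ` {..?N}. of_rat (u v) * v) = 0"
      using ratvec.dependent_finite[of "?v ` {..?N}"] by auto
    define p where "p = (\<Sum>k\<le>?N. monom (of_rat (u (?v k))) k :: 'k poly)"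
    have cp: "coeff p k = (if k \<le> ?N then of_rat (u (?v k)) else 0)" for k
      by (simp add: p_def coeff_sum)
    have "poly p x * a = (\<Sum>k\<le>?N. of_rat (u (?v k)) * ?v k)"
      by (simp add: p_def poly_sum poly_monom sum_distrib_right mult.assoc)
    also have "\<dots> = 0" using u(3) by (simp add: sum.reindex[OF True])
    finally have "poly p x = 0" using A by simp
    moreover have "p \<noteq> 0" using cp[of k] u by auto
    ultimately show ?thesis by (intro algebraicI'[of p]) (auto simp: cp)
  next
    case False
    then obtain i j where ij: "i \<noteq> j" "x ^ i * a = x ^ j * a" by (auto simp: inj_on_def)
    define p where "p = monom 1 i - monom (1::'k) j"
    have "poly p x = 0" using ij A by (simp add: p_def poly_monom)
    moreover have "coeff p i \<noteq> 0" using ij by (simp add: p_def)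
    then have "p \<noteq> 0" by auto
    ultimately show ?thesis by (intro algebraicI'[of p]) (auto simp: p_def)
  qed
qed

text \<open>A rational polynomial relation solved for its top power. As \<open>n\<close> is
  positive, 1 is among the spanning powers.\<close>

lemma algebraic_power_reduction:
  assumes "algebraic (x::'k::field_char_0)"
  obtains n where "n > 0" "x ^ n \<in> ratvec.span ((\<lambda>i. x ^ i) ` {..<n})"
proof -
  obtain p where p: "\<And>i. coeff p i \<in> \<rat>" "p \<noteq> 0" "poly p x = 0"
    using assms unfolding algebraic_altdef by blast
  let ?n = "degree p"
  have n: "?n > 0"
  proof (rule ccontr)
    assume "\<not> ?n > 0"
    then obtain c where "p = [:c:]" using degree_eq_zeroE[of p] by auto
    then show False using p by auto
  qed
  have "\<forall>i. \<exists>r. coeff p i = of_rat r" using p(1) by (auto elim: Rats_cases)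
  from choice[OF this] obtain r where r: "\<And>i. coeff p i = of_rat (r i)" by blast
  have r0: "r ?n \<noteq> 0" using r[of ?n] p(2) by auto
  have "0 = (\<Sum>i\<le>?n. coeff p i * x ^ i)" using p(3) by (simp add: poly_altdef)
  also have "\<dots> = (\<Sum>i<?n. of_rat (r i) * x ^ i) + of_rat (r ?n) * x ^ ?n"
    by (simp add: r lessThan_Suc_atMost[symmetric])
  finally have "of_rat (r ?n) * x ^ ?n = - (\<Sum>i<?n. of_rat (r i) * x ^ i)"
    by (simp add: eq_neg_iff_add_eq_0 add.commute)
  moreover have "- (\<Sum>i<?n. of_rat (r i) * x ^ i) \<in> ratvec.span ((\<lambda>i. x ^ i) ` {..<?n})"
    by (intro ratvec.span_neg ratvec.span_sum ratvec.span_scale ratvec.span_base) auto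
  ultimately have "of_rat (inverse (r ?n)) * (of_rat (r ?n) * x ^ ?n) \<in> ratvec.span ((\<lambda>i. x ^ i) ` {..<?n})"
    by (metis ratvec.span_scale)
  also have "of_rat (inverse (r ?n)) * (of_rat (r ?n) * x ^ ?n) = x ^ ?n"
    using r0 by (simp add: of_rat_inverse)
  finally show ?thesis using n that by blast
qed

text \<open>The monomials in \<open>x\<close> and \<open>y\<close> with exponents below
  \<open>n\<close> and \<open>m\<close> span a space stable under multiplication by both, since the
  top powers reduce to lower ones; it contains the nonzero element 1.\<close>

lemma algebraic_add_mult:
  assumes "algebraic (x::'k::field_char_0)" "algebraic y"
  shows "algebraic (x + y)" "algebraic (x * y)"
proof -
  obtain n where n: "n > 0" "x ^ n \<in> ratvec.span ((\<lambda>i. x ^ i) ` {..<n})"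
    using algebraic_power_reduction[OF assms(1)] by blast
  obtain m where m: "m > 0" "y ^ m \<in> ratvec.span ((\<lambda>i. y ^ i) ` {..<m})"
    using algebraic_power_reduction[OF assms(2)] by blast
  define A where "A = (\<lambda>(i, j). x ^ i * y ^ j) ` ({..<n} \<times> {..<m})"
  have A: "finite A" "1 \<in> A" using n m by (auto simp: A_def image_iff intro!: bexI[of _ 0])
  have memA: "x ^ i * y ^ j \<in> A" if "i < n" "j < m" for i j using that by (auto simp: A_def)
  have X: "x * b \<in> ratvec.span A" if b: "b \<in> A" for b
  proof -
    obtain i j where ij: "i < n" "j < m" "b = x ^ i * y ^ j" using b by (auto simp: A_def)
    show ?thesis
    proof (cases "Suc i < n")
      case True
      then have "x ^ Suc i * y ^ j \<in> A" using ij memA by blast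
      then show ?thesis using ij ratvec.span_base by (simp add: mult.assoc)
    next
      case False
      then have "Suc i = n" using ij by simp
      then have eq: "x * b = x ^ n * y ^ j" using ij by (simp add: mult.assoc[symmetric] power_Suc[symmetric] del: power_Suc)
      have "v * y ^ j \<in> ratvec.span A" if "v \<in> ratvec.span ((\<lambda>i. x ^ i) ` {..<n})" for v
        using that
      proof (induction rule: ratvec.span_induct_alt)
        case (step r b v)
        then obtain i where i: "i < n" "b = x ^ i" by auto
        have "(of_rat r * b + v) * y ^ j = of_rat r * (x ^ i * y ^ j) + v * y ^ j"
          by (simp add: i algebra_simps)
        then show ?case using step(2) memA[OF i(1) ij(2)] ratvec.span_add ratvec.span_scale ratvec.span_base by metis
      qed (simp add: ratvec.span_zero)
      then show ?thesis using eq n by simp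
    qed
  qed
  have Y: "y * b \<in> ratvec.span A" if b: "b \<in> A" for b
  proof -
    obtain i j where ij: "i < n" "j < m" "b = x ^ i * y ^ j" using b by (auto simp: A_def)
    show ?thesis
    proof (cases "Suc j < m")
      case True
      then have "x ^ i * y ^ Suc j \<in> A" using ij memA by blast
      then show ?thesis using ij ratvec.span_base by (simp add: mult.left_commute)
    next
      case False
      then have "Suc j = m" using ij by simp
      then have eq: "y * b = x ^ i * y ^ m" using ij by (simp add: mult.left_commute power_Suc[symmetric] del: power_Suc)
      have "x ^ i * v \<in> ratvec.span A" if "v \<in> ratvec.span ((\<lambda>j. y ^ j) ` {..<m})" for v
        using that
      proof (induction rule: ratvec.span_induct_alt)
        case (step r b v)
        then obtain j where j: "j < m" "b = y ^ j" by auto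
        have "x ^ i * (of_rat r * b + v) = of_rat r * (x ^ i * y ^ j) + x ^ i * v"
          by (simp add: j algebra_simps)
        then show ?case using step(2) memA[OF ij(1) j(1)] ratvec.span_add ratvec.span_scale ratvec.span_base by metis
      qed (simp add: ratvec.span_zero)
      then show ?thesis using eq m by simp
    qed
  qed
  have Xs: "x * v \<in> ratvec.span A" if "v \<in> ratvec.span A" for v
    using that
  proof (induction rule: ratvec.span_induct_alt)
    case (step r b v)
    have "x * (of_rat r * b + v) = of_rat r * (x * b) + x * v" by (simp add: algebra_simps)
    then show ?case using X[OF step(1)] step(2) ratvec.span_add ratvec.span_scale by metis
  qed (simp add: ratvec.span_zero)
  show "algebraic (x + y)"
    by (rule algebraic_if_finite_invariant[OF A]) (auto simp: distrib_right X Y intro: ratvec.span_add)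
  show "algebraic (x * y)"
    by (rule algebraic_if_finite_invariant[OF A]) (auto simp: mult.assoc Xs Y)
qed

lemma algebraic_sum: "(\<And>i. i \<in> I \<Longrightarrow> algebraic (f i :: 'k::field_char_0)) \<Longrightarrow> algebraic (sum f I)"
  by (induction I rule: infinite_finite_induct) (auto intro: algebraic_add_mult)

lemma algebraic_embedding_simps:
  assumes "algebraic_embedding \<iota>"
  shows "\<iota> 0 = 0" "\<iota> 1 = 1" "\<lbrakk>algebraic x; algebraic y\<rbrakk> \<Longrightarrow> \<iota> (x + y) = \<iota> x + \<iota> y"
    "\<lbrakk>algebraic x; algebraic y\<rbrakk> \<Longrightarrow> \<iota> (x * y) = \<iota> x * \<iota> y"
    "(\<And>i. i \<in> I \<Longrightarrow> algebraic (f i)) \<Longrightarrow> \<iota> (sum f I) = (\<Sum>i\<in>I. \<iota> (f i))"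
    "\<lbrakk>algebraic x; algebraic y; \<iota> x = \<iota> y\<rbrakk> \<Longrightarrow> x = y"
proof -
  have one: "\<iota> 1 = 1" and add: "\<And>x y. \<lbrakk>algebraic x; algebraic y\<rbrakk> \<Longrightarrow> \<iota> (x + y) = \<iota> x + \<iota> y"
    and mult: "\<And>x y. \<lbrakk>algebraic x; algebraic y\<rbrakk> \<Longrightarrow> \<iota> (x * y) = \<iota> x * \<iota> y"
    using assms by (auto simp: algebraic_embedding_def)
  have zero: "\<iota> 0 = 0" using add[of 0 0] by simp
  show "\<iota> 0 = 0" "\<iota> 1 = 1" by (rule zero one)+
  show "\<lbrakk>algebraic x; algebraic y\<rbrakk> \<Longrightarrow> \<iota> (x + y) = \<iota> x + \<iota> y" "\<lbrakk>algebraic x; algebraic y\<rbrakk> \<Longrightarrow> \<iota> (x * y) = \<iota> x * \<iota> y"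
    by (rule add mult; assumption)+
  show "(\<And>i. i \<in> I \<Longrightarrow> algebraic (f i)) \<Longrightarrow> \<iota> (sum f I) = (\<Sum>i\<in>I. \<iota> (f i))"
    by (induction I rule: infinite_finite_induct) (auto simp: zero add algebraic_sum)
  show "x = y" if xy: "algebraic x" "algebraic y" "\<iota> x = \<iota> y"
  proof (rule ccontr)
    assume ne: "x \<noteq> y"
    \<comment> \<open>The inverse of a nonzero algebraic element is algebraic, so its image is an
      inverse of the image of \<open>x - y\<close>, which therefore cannot be 0.\<close>
    have a: "algebraic (x - y)" "algebraic (inverse (x - y))"
      using algebraic_add_mult(1)[of x "- y"] xy by auto
    have "\<iota> x = \<iota> y + \<iota> (x - y)" using add[of y "x - y"] a xy by simp
    then have "\<iota> (x - y) = 0" using xy by simp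
    then show False using mult[OF a] ne one by simp
  qed
qed

section \<open>Characters and Frobenius-Perron dimensions\<close>

context fusion_category
begin

text \<open>Characters of the Grothendieck ring, as functions on objects.\<close>

definition character :: "('o \<Rightarrow> 'r::comm_semiring_1) \<Rightarrow> bool" where
  "character f \<longleftrightarrow> additive_on_objects f \<and> (\<forall>X\<in>Ob C. \<forall>Y\<in>Ob C. f (X \<boxtimes> Y) = f X * f Y) \<and> f (Unit C) = 1"

lemma characterD:
  assumes "character f"
  shows "additive_on_objects f" "\<lbrakk>X \<in> Ob C; Y \<in> Ob C\<rbrakk> \<Longrightarrow> f (X \<boxtimes> Y) = f X * f Y" "f (Unit C) = 1"
    "X \<in> Ob C \<Longrightarrow> f X = (\<Sum>Z\<in>Irr C. of_nat (multiplicity C Z X) * f Z)"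
  using assms additive_multiplicity[of f X] by (auto simp: character_def)

text \<open>The rational span of the values on simple objects is stable under multiplication by
  \<open>f X\<close>, with multiplicities as coefficients. Some of these values is nonzero because
  \<open>f (Unit C)\<close> is 1.\<close>

lemma character_algebraic:
  fixes f :: "'o \<Rightarrow> 'r::field_char_0"
  assumes f: "character f" and X: "X \<in> Ob C"
  shows "algebraic (f X)"
proof -
  obtain Z where Z: "Z \<in> Irr C" "f Z \<noteq> 0"
    using characterD(4)[OF f Unit_Ob] characterD(3)[OF f] by (metis (no_types, lifting) mult_zero_right sum.neutral zero_neq_one)
  show ?thesis
  proof (rule algebraic_if_finite_invariant[of "f ` Irr C" "f Z"])
    fix b assume "b \<in> f ` Irr C"
    then obtain Y where Y: "Y \<in> Irr C" "b = f Y" by auto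
    have "f X * b = (\<Sum>W\<in>Irr C. of_rat (of_nat (multiplicity C W (X \<boxtimes> Y))) * f W)"
      using characterD(2)[OF f X, of Y] characterD(4)[OF f, of "X \<boxtimes> Y"] X Y by simp
    also have "\<dots> \<in> ratvec.span (f ` Irr C)"
      by (intro ratvec.span_sum ratvec.span_scale ratvec.span_base) auto
    finally show "f X * b \<in> ratvec.span (f ` Irr C)" .
  qed (use Z finite_Irr in auto)
qed

text \<open>The embedding respects sums and products of algebraic elements only, so algebraicity of
  the values has to be known beforehand.\<close>

lemma character_embedding:
  assumes \<iota>: "algebraic_embedding \<iota>" and f: "character f"
  shows "character (\<lambda>X. \<iota> (f X))"
  unfolding character_def additive_on_objects_def
proof (intro conjI allI impI ballI)
  note e = algebraic_embedding_simps[OF \<iota>]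
  show "\<iota> (f X) = (\<Sum>i<n. \<iota> (f (S i)))" if ds: "is_direct_sum C n S X" for n S X
  proof -
    have "f X = (\<Sum>i<n. f (S i))" using characterD(1)[OF f] ds by (simp add: additive_on_objects_def)
    moreover have "algebraic (f (S i))" if "i < n" for i
      using character_algebraic[OF f] ds that by (auto simp: is_direct_sum_def)
    ultimately show ?thesis using e(5)[of "{..<n}" "\<lambda>i. f (S i)"] by simp
  qed
  show "\<iota> (f (X \<boxtimes> Y)) = \<iota> (f X) * \<iota> (f Y)" if "X \<in> Ob C" "Y \<in> Ob C" for X Y
    using that characterD(2)[OF f] e(4) character_algebraic[OF f] by simp
  show "\<iota> (f (Unit C)) = 1" using characterD(3)[OF f] e(2) by simp
qed

text \<open>Evaluate at a simple object that maximizes \<open>norm (f Z) / p Z\<close>.\<close>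

lemma fusion_bound:
  fixes f :: "'o \<Rightarrow> complex" and p :: "'o \<Rightarrow> real"
  assumes f: "\<And>X Y. \<lbrakk>X \<in> Irr C; Y \<in> Irr C\<rbrakk> \<Longrightarrow> f X * f Y = (\<Sum>Z\<in>Irr C. of_nat (multiplicity C Z (X \<boxtimes> Y)) * f Z)"
    and p: "\<And>X Y. \<lbrakk>X \<in> Irr C; Y \<in> Irr C\<rbrakk> \<Longrightarrow> p X * p Y = (\<Sum>Z\<in>Irr C. of_nat (multiplicity C Z (X \<boxtimes> Y)) * p Z)"
    and pos: "\<And>X. X \<in> Irr C \<Longrightarrow> p X > 0" and X: "X \<in> Irr C"
  shows "norm (f X) \<le> p X"
proof -
  define q where "q Z = norm (f Z) / p Z" for Z
  have "finite (q ` Irr C)" "q ` Irr C \<noteq> {}" using finite_Irr X by auto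
  then have "Max (q ` Irr C) \<in> q ` Irr C" by (rule Max_in)
  then obtain Z where Z: "Z \<in> Irr C" "\<And>W. W \<in> Irr C \<Longrightarrow> q W \<le> q Z"
    using finite_Irr by (metis (no_types, lifting) Max_ge finite_imageI imageE image_eqI)
  have le: "norm (f W) \<le> q Z * p W" if "W \<in> Irr C" for W
    using Z(2)[OF that] pos[OF that] by (simp add: q_def[of W] field_simps)
  show ?thesis
  proof (cases "f Z = 0")
    case True
    then show ?thesis using le[OF X] pos[OF X] by (simp add: q_def)
  next
    case False
    have "norm (f X) * norm (f Z) = norm (\<Sum>W\<in>Irr C. of_nat (multiplicity C W (X \<boxtimes> Z)) * f W)"
      using f[OF X Z(1)] by (simp flip: norm_mult)
    also have "\<dots> \<le> (\<Sum>W\<in>Irr C. norm (of_nat (multiplicity C W (X \<boxtimes> Z)) * f W))" by (rule norm_sum)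
    also have "\<dots> \<le> (\<Sum>W\<in>Irr C. of_nat (multiplicity C W (X \<boxtimes> Z)) * (q Z * p W))"
      by (intro sum_mono) (auto simp: norm_mult intro!: mult_left_mono le)
    also have "\<dots> = q Z * (p X * p Z)"
      by (simp add: p[OF X Z(1)] sum_distrib_left mult.left_commute)
    also have "\<dots> = p X * norm (f Z)" using pos[OF Z(1)] by (simp add: q_def)
    finally show ?thesis using False by simp
  qed
qed

text \<open>The values on simple objects form a common eigenvector for tensoring with
  \<open>X\<close> and with \<open>dual C X\<close>, with eigenvalues \<open>f X\<close> and
  \<open>f (dual C X)\<close>. By \<open>multiplicity_dual\<close> these operators are adjoint, so
  pairing the vector with itself equates one eigenvalue with the conjugate of the other; the norm
  \<open>s\<close> is positive.\<close>

lemma character_conj: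
  fixes f :: "'o \<Rightarrow> complex"
  assumes f: "character f" and X: "X \<in> Ob C"
  shows "f (dual C X) = cnj (f X)"
proof -
  let ?m = "\<lambda>Z Y. of_nat (multiplicity C Z Y) :: complex"
  define s where "s = (\<Sum>Z\<in>Irr C. (cmod (f Z))\<^sup>2)"
  have s: "of_real s = (\<Sum>Z\<in>Irr C. f Z * cnj (f Z))"
    by (simp only: s_def of_real_sum complex_norm_square)
  obtain Z0 where Z0: "Z0 \<in> Irr C" "f Z0 \<noteq> 0"
    using characterD(4)[OF f Unit_Ob] characterD(3)[OF f] by (metis (no_types, lifting) mult_zero_right sum.neutral zero_neq_one)
  have "s > 0" unfolding s_def using finite_Irr Z0 by (intro sum_pos2[of _ Z0]) auto
  have "f (dual C X) * of_real s = (\<Sum>Z\<in>Irr C. cnj (f Z) * f (dual C X \<boxtimes> Z))"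
    using X by (simp add: s sum_distrib_left characterD(2)[OF f] mult.assoc mult.left_commute mult.commute)
  also have "\<dots> = (\<Sum>Z\<in>Irr C. \<Sum>W\<in>Irr C. cnj (f Z) * (?m W (dual C X \<boxtimes> Z) * f W))"
    using X by (intro sum.cong refl) (subst characterD(4)[OF f], simp_all add: sum_distrib_left)
  also have "\<dots> = (\<Sum>Z\<in>Irr C. \<Sum>W\<in>Irr C. cnj (f Z) * (?m Z (X \<boxtimes> W) * f W))"
    using X by (intro sum.cong refl) (simp add: multiplicity_dual Irr_simple)
  also have "\<dots> = (\<Sum>W\<in>Irr C. \<Sum>Z\<in>Irr C. cnj (f Z) * (?m Z (X \<boxtimes> W) * f W))"
    by (rule sum.swap)
  also have "\<dots> = (\<Sum>W\<in>Irr C. f W * cnj (f (X \<boxtimes> W)))"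
    using X by (intro sum.cong refl) (subst characterD(4)[OF f, of "X \<boxtimes> _"], simp_all add: sum_distrib_left mult.commute mult.left_commute)
  also have "\<dots> = cnj (f X) * of_real s"
    using X by (simp add: s sum_distrib_left characterD(2)[OF f] mult.left_commute)
  finally show ?thesis using \<open>s > 0\<close> by simp
qed


section \<open>Uniqueness and positivity of Frobenius-Perron dimensions\<close>

definition FP_hom :: "(('o \<Rightarrow> int) \<Rightarrow> real) \<Rightarrow> bool" where
  "FP_hom \<phi> \<longleftrightarrow> \<phi> \<in> ring_hom (K0 C) real_ring \<and> (\<forall>Y. simple_ob C Y \<longrightarrow> \<phi> (K0_class C Y) > 0)"

lemma FPdim_altdef: "FPdim C X = (THE r. \<exists>\<phi>. FP_hom \<phi> \<and> r = \<phi> (K0_class C X))"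
proof -
  have "(\<exists>\<phi>\<in>ring_hom (K0 C) real_ring. (\<forall>Y. simple_ob C Y \<longrightarrow> \<phi> (K0_class C Y) > 0) \<and> r = \<phi> (K0_class C X))
    \<longleftrightarrow> (\<exists>\<phi>. FP_hom \<phi> \<and> r = \<phi> (K0_class C X))" for r
    by (auto simp: FP_hom_def)
  then show ?thesis unfolding FPdim_def by presburger
qed

lemma K0_class_simple:
  assumes Y: "simple_ob C Y"
  shows "\<exists>Z\<in>Irr C. isomorphic C Y Z \<and> K0_class C Y = (\<lambda>W. if W = Z then 1 else 0)"
proof -
  obtain Z where Z: "Z \<in> Irr C" "isomorphic C Y Z" and uni: "\<And>W. W \<in> Irr C \<Longrightarrow> isomorphic C Y W \<Longrightarrow> W = Z"
    using Irr_props(2)[OF Y] by blast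
  have "K0_class C Y W = (if W = Z then 1 else 0)" for W
  proof (cases "W \<in> Irr C")
    case True
    then have "isomorphic C Y W \<longleftrightarrow> W = Z" using uni Z by blast
    then show ?thesis using multiplicity_simple[OF Y True] True by (simp add: K0_class_def)
  qed (use Z in \<open>auto simp: K0_class_def\<close>)
  then show ?thesis using Z by blast
qed

text \<open>Elements of \<open>ring_hom\<close> are additive but not given as linear maps; counting
  up from 0 covers the nonnegative combinations that occur as classes of objects.\<close>

lemma FP_hom_sum:
  assumes \<phi>: "FP_hom \<phi>" and F: "finite F" "F \<subseteq> Irr C"
  shows "\<phi> (\<lambda>Z. if Z \<in> F then int (n Z) else 0) = (\<Sum>Z\<in>F. real (n Z) * \<phi> (\<lambda>W. if W = Z then 1 else 0))"
proof -
  have add: "\<phi> (\<lambda>Z. a Z + b Z) = \<phi> a + \<phi> b"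
    if "\<And>Z. Z \<notin> Irr C \<Longrightarrow> a Z = 0" "\<And>Z. Z \<notin> Irr C \<Longrightarrow> b Z = 0" for a b
    using \<phi> that by (auto simp: FP_hom_def ring_hom_def K0_def real_ring_def)
  have zero: "\<phi> (\<lambda>_. 0) = 0" using add[of "\<lambda>_. 0" "\<lambda>_. 0"] by simp
  have single: "\<phi> (\<lambda>W. if W = Z then int m else 0) = real m * \<phi> (\<lambda>W. if W = Z then 1 else 0)" if Z: "Z \<in> Irr C" for m Z
  proof (induction m)
    case (Suc m)
    have eq: "(\<lambda>W. if W = Z then int (Suc m) else 0) = (\<lambda>W. (if W = Z then int m else 0) + (if W = Z then 1 else 0))"
      by auto
    have "\<phi> (\<lambda>W. (if W = Z then int m else 0) + (if W = Z then 1 else 0))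
        = \<phi> (\<lambda>W. if W = Z then int m else 0) + \<phi> (\<lambda>W. if W = Z then 1 else 0)"
      by (rule add) (use Z in auto)
    then show ?case unfolding eq Suc by (simp add: algebra_simps)
  qed (simp add: zero cong: if_cong)
  show ?thesis using F
  proof (induction F)
    case (insert Z F)
    have "(\<lambda>W. if W \<in> insert Z F then int (n W) else 0)
        = (\<lambda>W. (if W = Z then int (n Z) else 0) + (if W \<in> F then int (n W) else 0))"
      using insert by auto
    moreover have "\<phi> (\<lambda>W. (if W = Z then int (n Z) else 0) + (if W \<in> F then int (n W) else 0))
        = \<phi> (\<lambda>W. if W = Z then int (n Z) else 0) + \<phi> (\<lambda>W. if W \<in> F then int (n W) else 0)"
      by (rule add) (use insert in auto)
    ultimately show ?case using insert single[of Z "n Z"] by simp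
  qed (simp add: zero)
qed

lemma FP_hom_fusion:
  assumes \<phi>: "FP_hom \<phi>" and "X \<in> Irr C" "Y \<in> Irr C"
  defines "p \<equiv> \<lambda>Z. \<phi> (\<lambda>W. if W = Z then 1 else 0)"
  shows "p X * p Y = (\<Sum>Z\<in>Irr C. of_nat (multiplicity C Z (X \<boxtimes> Y)) * p Z)" "p X > 0"
proof -
  let ?d = "\<lambda>Z W. if W = Z then 1 else (0::int)"
  have "?d X \<in> carrier (K0 C)" "?d Y \<in> carrier (K0 C)" using assms by (auto simp: K0_def)
  then have "\<phi> (?d X \<otimes>\<^bsub>K0 C\<^esub> ?d Y) = p X * p Y"
    using \<phi> by (auto simp: FP_hom_def ring_hom_def real_ring_def p_def)
  moreover have "?d X \<otimes>\<^bsub>K0 C\<^esub> ?d Y = (\<lambda>Z. if Z \<in> Irr C then int (multiplicity C Z (X \<boxtimes> Y)) else 0)"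
  proof
    fix Z
    have "(\<Sum>X'\<in>Irr C. \<Sum>Y'\<in>Irr C. ?d X X' * ?d Y Y' * int (multiplicity C Z (X' \<boxtimes> Y')))
      = (\<Sum>X'\<in>Irr C. if X' = X then (\<Sum>Y'\<in>Irr C. if Y' = Y then int (multiplicity C Z (X \<boxtimes> Y)) else 0) else 0)"
      by (intro sum.cong refl) (auto intro!: sum.cong sum.neutral)
    also have "\<dots> = int (multiplicity C Z (X \<boxtimes> Y))" using finite_Irr assms by simp
    finally show "(?d X \<otimes>\<^bsub>K0 C\<^esub> ?d Y) Z = (if Z \<in> Irr C then int (multiplicity C Z (X \<boxtimes> Y)) else 0)"
      by (simp add: K0_def)
  qed
  ultimately show "p X * p Y = (\<Sum>Z\<in>Irr C. of_nat (multiplicity C Z (X \<boxtimes> Y)) * p Z)"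
    using FP_hom_sum[OF \<phi> finite_Irr, of "\<lambda>Z. multiplicity C Z (X \<boxtimes> Y)"] by (simp add: p_def)
  obtain Z where "Z \<in> Irr C" "isomorphic C X Z" "K0_class C X = ?d Z"
    using K0_class_simple[OF Irr_simple] assms by blast
  moreover from this have "Z = X"
    using Irr_props(2)[of X] Irr_simple isomorphic_refl assms Irr_Ob by metis
  ultimately show "p X > 0" using \<phi> Irr_simple[of X] assms by (auto simp: FP_hom_def p_def)
qed

text \<open>Two positive homomorphisms bound each other on simple objects by
  \<open>fusion_bound\<close>, so the definite description has a unique solution as soon as one
  homomorphism exists.\<close>

lemma FPdim_simple:
  assumes \<phi>: "FP_hom \<phi>" and Y: "simple_ob C Y"
  shows "FPdim C Y = \<phi> (K0_class C Y)"
  unfolding FPdim_altdef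
proof (rule the_equality)
  show "\<exists>\<phi>'. FP_hom \<phi>' \<and> \<phi> (K0_class C Y) = \<phi>' (K0_class C Y)" using \<phi> by blast
  fix r assume "\<exists>\<phi>'. FP_hom \<phi>' \<and> r = \<phi>' (K0_class C Y)"
  then obtain \<psi> where \<psi>: "FP_hom \<psi>" "r = \<psi> (K0_class C Y)" by blast
  obtain Z where Z: "Z \<in> Irr C" "K0_class C Y = (\<lambda>W. if W = Z then 1 else 0)"
    using K0_class_simple[OF Y] by blast
  have le: "\<phi> (\<lambda>W. if W = Z then 1 else 0) \<le> \<psi> (\<lambda>W. if W = Z then 1 else 0)"
    if "FP_hom \<phi>" "FP_hom \<psi>" for \<phi> \<psi>
  proof -
    define p q where "p Z = \<phi> (\<lambda>W. if W = Z then 1 else 0)" and "q Z = \<psi> (\<lambda>W. if W = Z then 1 else 0)" for Z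
    have p: "p X * p Y = (\<Sum>Z\<in>Irr C. of_nat (multiplicity C Z (X \<boxtimes> Y)) * p Z)" "p X > 0"
      if "X \<in> Irr C" "Y \<in> Irr C" for X Y
      using FP_hom_fusion[OF \<open>FP_hom \<phi>\<close> that] by (simp_all add: p_def)
    have q: "q X * q Y = (\<Sum>Z\<in>Irr C. of_nat (multiplicity C Z (X \<boxtimes> Y)) * q Z)" "q X > 0"
      if "X \<in> Irr C" "Y \<in> Irr C" for X Y
      using FP_hom_fusion[OF \<open>FP_hom \<psi>\<close> that] by (simp_all add: q_def)
    have "norm (complex_of_real (p Z)) \<le> q Z"
    proof (rule fusion_bound[where f = "\<lambda>Z. of_real (p Z)"])
      show "complex_of_real (p X) * of_real (p Y) = (\<Sum>Z\<in>Irr C. of_nat (multiplicity C Z (X \<boxtimes> Y)) * of_real (p Z))"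
        if "X \<in> Irr C" "Y \<in> Irr C" for X Y
        using arg_cong[OF p(1)[OF that], of complex_of_real] by simp
    qed (use q Z in auto)
    then show ?thesis using p(2)[OF Z(1) Z(1)] by (simp add: p_def q_def)
  qed
  show "r = \<phi> (K0_class C Y)"
    using le[OF \<phi> \<psi>(1)] le[OF \<psi>(1) \<phi>] \<psi>(2) Z(2) by simp
qed

text \<open>If the Grothendieck ring had no positive character, the definite description in
  \<^const>\<open>FPdim\<close> would be a constant; a character with this constant value on simple objects
  is positive.\<close>

lemma FPdim_pos:
  assumes f: "character (f :: 'o \<Rightarrow> complex)" and FP: "\<And>X. simple_ob C X \<Longrightarrow> f X = of_real (FPdim C X)"
    and X: "simple_ob C X"
  shows "FPdim C X > 0"
proof (cases "\<exists>\<phi>. FP_hom \<phi>")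
  case True
  then show ?thesis using FPdim_simple X by (auto simp: FP_hom_def)
next
  case False
  then have "FPdim C Y = (THE r. False)" for Y by (simp add: FPdim_altdef)
  then have const: "FPdim C Y = FPdim C (Unit C)" for Y by simp
  have one: "FPdim C Y = 1" for Y
    using const[of Y] FP[OF Unit_simple] characterD(3)[OF f] by simp
  have f1: "f Z = 1" if "simple_ob C Z" for Z using FP[OF that] one by simp
  have total: "f Y = of_nat (\<Sum>Z\<in>Irr C. multiplicity C Z Y)" if "Y \<in> Ob C" for Y
    using characterD(4)[OF f that] f1 Irr_simple by simp
  have sum1: "(\<Sum>Z\<in>Irr C. multiplicity C Z Y) = 1" if "Y \<in> Ob C" "f Y = 1" for Y
    using total[OF that(1)] that(2) by (metis of_nat_1 of_nat_eq_iff)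
  \<comment> \<open>The common dimension is 1, so a product of two simple objects has total
    multiplicity 1. Summing coordinates is therefore multiplicative.\<close>
  define \<phi> where "\<phi> a = (\<Sum>Z\<in>Irr C. real_of_int (a Z))" for a :: "'o \<Rightarrow> int"
  have "FP_hom \<phi>" unfolding FP_hom_def
  proof (intro conjI allI impI)
    show "\<phi> \<in> ring_hom (K0 C) real_ring"
    proof (rule ring_hom_memI)
      fix a b assume "a \<in> carrier (K0 C)" "b \<in> carrier (K0 C)"
      show "\<phi> (a \<oplus>\<^bsub>K0 C\<^esub> b) = \<phi> a \<oplus>\<^bsub>real_ring\<^esub> \<phi> b"
        by (simp add: \<phi>_def K0_def real_ring_def sum.distrib)
      have "\<phi> (a \<otimes>\<^bsub>K0 C\<^esub> b)
        = (\<Sum>Z\<in>Irr C. \<Sum>X\<in>Irr C. \<Sum>Y\<in>Irr C. real_of_int (a X) * real_of_int (b Y) * real (multiplicity C Z (X \<boxtimes> Y)))"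
        by (simp add: \<phi>_def K0_def)
      also have "\<dots> = (\<Sum>X\<in>Irr C. \<Sum>Z\<in>Irr C. \<Sum>Y\<in>Irr C. real_of_int (a X) * real_of_int (b Y) * real (multiplicity C Z (X \<boxtimes> Y)))"
        by (rule sum.swap)
      also have "\<dots> = (\<Sum>X\<in>Irr C. \<Sum>Y\<in>Irr C. \<Sum>Z\<in>Irr C. real_of_int (a X) * real_of_int (b Y) * real (multiplicity C Z (X \<boxtimes> Y)))"
        by (intro sum.cong refl sum.swap)
      also have "\<dots> = (\<Sum>X\<in>Irr C. \<Sum>Y\<in>Irr C. real_of_int (a X) * real_of_int (b Y))"
      proof (intro sum.cong refl)
        fix X Y assume XY: "X \<in> Irr C" "Y \<in> Irr C"
        then have "f (X \<boxtimes> Y) = 1" using characterD(2)[OF f, of X Y] f1 Irr_simple by simp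
        then have "real (\<Sum>Z\<in>Irr C. multiplicity C Z (X \<boxtimes> Y)) = 1" using sum1[of "X \<boxtimes> Y"] XY by simp
        then show "(\<Sum>Z\<in>Irr C. real_of_int (a X) * real_of_int (b Y) * real (multiplicity C Z (X \<boxtimes> Y)))
          = real_of_int (a X) * real_of_int (b Y)"
          by (simp flip: sum_distrib_left)
      qed
      finally show "\<phi> (a \<otimes>\<^bsub>K0 C\<^esub> b) = \<phi> a \<otimes>\<^bsub>real_ring\<^esub> \<phi> b"
        by (simp add: \<phi>_def real_ring_def sum_product)
    next
      have "real (\<Sum>Z\<in>Irr C. multiplicity C Z (Unit C)) = 1"
        using sum1[OF Unit_Ob characterD(3)[OF f]] by simp
      then show "\<phi> \<one>\<^bsub>K0 C\<^esub> = \<one>\<^bsub>real_ring\<^esub>"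
        by (simp add: \<phi>_def K0_def real_ring_def)
    qed (simp add: real_ring_def)
    fix Y assume "simple_ob C Y"
    then obtain Z where "Z \<in> Irr C" "K0_class C Y = (\<lambda>W. if W = Z then 1 else 0)"
      using K0_class_simple by blast
    then show "\<phi> (K0_class C Y) > 0"
      using finite_Irr by (simp add: \<phi>_def of_int_sum[symmetric] del: of_int_sum)
  qed
  then show ?thesis using False by blast
qed

end

section \<open>The S-matrix\<close>

context ribbon_fusion_category
begin

lemma mid_braid_arr [simp]: "mid (braid_arr X Y) = braiding C X Y"
  by (simp add: braid_arr_def)

lemma dscale_dscale:
  assumes F: "dia F A B"
  shows "dscale a (dscale b F) = dscale (a * b) F"
proof (rule dia_eqI[OF dscale_Some(1)[OF dscale_Some(1)[OF F]] dscale_Some(1)[OF F]])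
  fix V assume V: "V \<in> Ob C"
  show "comp_at (dscale a (dscale b F)) V = comp_at (dscale (a * b) F) V"
    using V by (simp add: dscale_Some(2)[OF F] dscale_Some(2)[OF dscale_Some(1)[OF F]] smul_def)
qed

text \<open>Closed diagrams are multiples of the empty one, and since the identity of the unit
  object is nonzero the factor can be read off.\<close>

lemma dscale_did_inject:
  assumes "dscale a (did []) = dscale b (did [])"
  shows "a = b"
proof -
  have "comp_at (dscale a (did [])) (Unit C) = comp_at (dscale b (did [])) (Unit C)" using assms by simp
  then have "scal C a (Id C (Unit C)) = scal C b (Id C (Unit C))"
    by (simp add: dscale_Some(2)[OF did_Some(1)] did_Some(2) smul_def)
  then show ?thesis using Unit_simple V.scale_right_imp_eq unfolding simple_ob_def by blast
qed

lemma dia_ptr: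
  assumes "X \<in> Ob C" "dia G (X # V) (X # V)"
  shows "dia (ptr X V G) V V"
proof -
  have V: "set V \<subseteq> Ob C" using dia_list[OF assms(2)] by auto
  have 1: "dia (whisk [] (rcup X) V) V (dual C X # X # V)"
    by (rule dia_intros(2)[OF dia_rcup]) (use assms V in auto)
  have 2: "dia (whisk [dual C X] G []) (dual C X # X # V) (dual C X # X # V)"
    by (rule dia_intros(2)[OF assms(2)]) (use assms V in auto)
  have 3: "dia (whisk [] (cap X) V) (dual C X # X # V) V"
    by (rule dia_intros(2)[OF dia_cap]) (use assms V in auto)
  show ?thesis unfolding ptr_def by (rule dcomp_Some(1)[OF dcomp_Some(1)[OF 1 2] 3])
qed

text \<open>A loop around \<open>Y\<close> is an endomorphism of \<open>Y\<close>: fullness brings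
  it back to \<open>C\<close>, where Schur's lemma makes it a scalar.\<close>

lemma ptr_encircle_simple:
  assumes X: "X \<in> Ob C" and Y: "simple_ob C Y"
  shows "\<exists>a. ptr X [Y] (encircle X Y) = dscale a (did [Y])"
proof -
  have YO: "Y \<in> Ob C" using Y by (rule simple_Ob)
  obtain p where p: "isarr p" "src p = Y" "tgt p = Y" "ptr X [Y] (encircle X Y) = mor p"
    using mor_full[OF dia_ptr[OF X dia_encircle[OF X YO]]] by blast
  obtain a where "p = smul a (ident Y)" using isarr_End_simple[OF Y p(1-3)] by blast
  then show ?thesis using p YO by (auto simp: mor_smul mor_ident)
qed

lemma trace_arr_typing [simp]:
  "\<lbrakk>isarr f; src f = X; tgt f = X\<rbrakk> \<Longrightarrow> isarr (trace_arr X f)" "src (trace_arr X f) = Unit C" "tgt (trace_arr X f) = Unit C"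
  using isarr_Ob[of f] by (auto simp: trace_arr_def)

text \<open>The definite description in \<open>quantum_trace\<close> has exactly one solution,
  because the endomorphisms of the unit object are scalars and its identity is nonzero.\<close>

lemma trace_arr_eq:
  assumes f: "isarr f" "src f = X" "tgt f = X"
  shows "trace_arr X f = smul (quantum_trace C X (mid f)) (ident (Unit C))"
proof -
  obtain a where a: "trace_arr X f = smul a (ident (Unit C))"
    using isarr_End_simple[OF Unit_simple, of "trace_arr X f"] f by auto
  have "quantum_trace C X (mid f) = a" unfolding quantum_trace_def
  proof (rule the_equality)
    have "mid (trace_arr X f) = scal C a (Id C (Unit C))" using a by simp
    then show *: "scal C a (Id C (Unit C))
        = ev C X \<cdot> braiding C X (dual C X) \<cdot> ((twist C X \<cdot> mid f) \<boxdot> Id C (dual C X)) \<cdot> coev C X"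
      by (simp add: trace_arr_def ev_arr_def coev_arr_def braid_arr_def twist_arr_def)
    fix b assume "scal C b (Id C (Unit C))
        = ev C X \<cdot> braiding C X (dual C X) \<cdot> ((twist C X \<cdot> mid f) \<boxdot> Id C (dual C X)) \<cdot> coev C X"
    with * have "scal C b (Id C (Unit C)) = scal C a (Id C (Unit C))" by simp
    then show "b = a" using Unit_simple V.scale_right_imp_eq unfolding simple_ob_def by blast
  qed
  then show ?thesis using a by simp
qed

lemma ptr_trace:
  assumes "isarr f" "src f = X" "tgt f = X"
  shows "ptr X [] (mor f) = dscale (quantum_trace C X (mid f)) (did [])"
  using dcomp_did(2)[OF ins_Some(1)]
  by (simp add: ptr_mor[OF assms] trace_arr_eq[OF assms] mor_smul mor_ident dscale_laws del_ins)

lemma ptr_did: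
  assumes [simp]: "X \<in> Ob C"
  shows "ptr X [] (did [X]) = dscale (cat_dim C X) (did [])"
  using ptr_trace[of "ident X" X] by (simp add: mor_ident cat_dim_def)

lemma quantum_trace_cyclic:
  assumes "X \<in> Ob C" "Y \<in> Ob C" "f \<in> Hom C X Y" "g \<in> Hom C Y X"
  shows "quantum_trace C X (g \<cdot> f) = quantum_trace C Y (f \<cdot> g)"
proof -
  let ?f = "(X, f, Y)" and ?g = "(Y, g, X)"
  have [simp]: "isarr ?f" "isarr ?g" using assms by (simp_all add: isarr_triple)
  have "ptr X [] (mor ?g \<bullet> whisk [] (mor ?f) []) = ptr Y [] (whisk [] (mor ?f) [] \<bullet> mor ?g)"
    by (rule ptr_cyclic) (simp_all add: dia_mor)
  then have "ptr X [] (mor (?g \<star> ?f)) = ptr Y [] (mor (?f \<star> ?g))"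
    by (simp add: mor_cmp)
  then show ?thesis
    by (intro dscale_did_inject) (simp add: ptr_trace)
qed

lemma quantum_trace_sum:
  assumes X [simp]: "X \<in> Ob C" and f: "\<And>i. i \<in> I \<Longrightarrow> f i \<in> Hom C X X"
  shows "quantum_trace C X (sum f I) = (\<Sum>i\<in>I. quantum_trace C X (f i))"
proof -
  have eq: "scal C (quantum_trace C X h) (Id C (Unit C))
      = ev C X \<cdot> braiding C X (dual C X) \<cdot> ((twist C X \<cdot> h) \<boxdot> Id C (dual C X)) \<cdot> coev C X"
    if "h \<in> Hom C X X" for h
    using arg_cong[OF trace_arr_eq[of "(X, h, X)" X], of mid] that
    by (simp add: isarr_triple trace_arr_def ev_arr_def coev_arr_def braid_arr_def twist_arr_def)
  have H: "ev C X \<in> Hom C (dual C X \<boxtimes> X) (Unit C)" "coev C X \<in> Hom C (Unit C) (X \<boxtimes> dual C X)"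
    "braiding C X (dual C X) \<in> Hom C (X \<boxtimes> dual C X) (dual C X \<boxtimes> X)" "twist C X \<in> Hom C X X"
    "Id C (dual C X) \<in> Hom C (dual C X) (dual C X)"
    using left_dual[OF X] braiding_iso[of X "dual C X"] twist_iso[OF X]
    by (auto simp: is_left_dual_def is_iso_def Id_Hom)
  have add: "quantum_trace C X (g + h) = quantum_trace C X g + quantum_trace C X h"
    if g: "g \<in> Hom C X X" and h: "h \<in> Hom C X X" for g h
  proof -
    have t: "twist C X \<cdot> g \<in> Hom C X X" "twist C X \<cdot> h \<in> Hom C X X" using Comp_Hom H g h X by blast+
    let ?D = "dual C X"
    let ?u = "\<lambda>g. (twist C X \<cdot> g) \<boxdot> Id C ?D"
    have u: "?u g \<in> Hom C (X \<boxtimes> ?D) (X \<boxtimes> ?D)" "?u h \<in> Hom C (X \<boxtimes> ?D) (X \<boxtimes> ?D)"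
      using t H by (auto intro!: tensor_Hom)
    have uc: "?u g \<cdot> coev C X \<in> Hom C (Unit C) (X \<boxtimes> ?D)" "?u h \<cdot> coev C X \<in> Hom C (Unit C) (X \<boxtimes> ?D)"
      using Comp_Hom[of "Unit C" "X \<boxtimes> ?D" "X \<boxtimes> ?D"] u H by simp_all
    have buc: "braiding C X ?D \<cdot> ?u g \<cdot> coev C X \<in> Hom C (Unit C) (?D \<boxtimes> X)"
      "braiding C X ?D \<cdot> ?u h \<cdot> coev C X \<in> Hom C (Unit C) (?D \<boxtimes> X)"
      using Comp_Hom[of "Unit C" "X \<boxtimes> ?D" "?D \<boxtimes> X"] uc H by simp_all
    have "?u (g + h) = ?u g + ?u h"
      using Comp_add_right[of X X X g h "twist C X"] tensor_add_left[of X X ?D ?D] g h t H by simp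
    then have "?u (g + h) \<cdot> coev C X = ?u g \<cdot> coev C X + ?u h \<cdot> coev C X"
      using Comp_add_left[of "Unit C" "X \<boxtimes> ?D" "X \<boxtimes> ?D" "coev C X" "?u g" "?u h"] u H by simp
    then have "braiding C X ?D \<cdot> ?u (g + h) \<cdot> coev C X
        = braiding C X ?D \<cdot> ?u g \<cdot> coev C X + braiding C X ?D \<cdot> ?u h \<cdot> coev C X"
      using Comp_add_right[of "Unit C" "X \<boxtimes> ?D" "?D \<boxtimes> X"] uc H by simp
    then have "ev C X \<cdot> braiding C X ?D \<cdot> ?u (g + h) \<cdot> coev C X
        = ev C X \<cdot> braiding C X ?D \<cdot> ?u g \<cdot> coev C X + ev C X \<cdot> braiding C X ?D \<cdot> ?u h \<cdot> coev C X"
      using Comp_add_right[of "Unit C" "?D \<boxtimes> X" "Unit C"] buc H by simp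
    then have "scal C (quantum_trace C X (g + h)) (Id C (Unit C))
        = scal C (quantum_trace C X g + quantum_trace C X h) (Id C (Unit C))"
      using eq[OF g] eq[OF h] eq[OF Hom_closed(2)[OF X X g h]] by (simp add: V.scale_left_distrib)
    then show ?thesis using Unit_simple V.scale_right_imp_eq unfolding simple_ob_def by blast
  qed
  have zero: "quantum_trace C X 0 = 0" using add[of 0 0] Hom_closed(1)[OF X X] by simp
  show ?thesis using f
  proof (induction I rule: infinite_finite_induct)
    case (insert i I)
    then show ?case using add[of "f i" "sum f I"] Hom_closed(5)[OF X X, of I f] by simp
  qed (simp_all add: zero)
qed

text \<open>The identity of \<open>X\<close> is a sum of idempotents, and cyclicity turns the trace
  of each into the dimension of its summand.\<close>

lemma cat_dim_additive: "additive_on_objects (cat_dim C)"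
  unfolding additive_on_objects_def
proof (intro allI impI)
  fix n S X assume ds: "is_direct_sum C n S X"
  obtain inj prj where X: "X \<in> Ob C" and S: "\<And>i. i < n \<Longrightarrow> S i \<in> Ob C"
    and inj: "\<And>i. i < n \<Longrightarrow> inj i \<in> Hom C (S i) X" and prj: "\<And>i. i < n \<Longrightarrow> prj i \<in> Hom C X (S i)"
    and ortho: "\<And>i j. i < n \<Longrightarrow> j < n \<Longrightarrow> prj i \<cdot> inj j = (if i = j then Id C (S i) else 0)"
    and total: "(\<Sum>i<n. inj i \<cdot> prj i) = Id C X"
    using direct_sumE[OF ds] by blast
  have "cat_dim C X = (\<Sum>i<n. quantum_trace C X (inj i \<cdot> prj i))"
    unfolding cat_dim_def total[symmetric]
    by (rule quantum_trace_sum[OF X]) (use Comp_Hom[OF X S X] inj prj in auto)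
  also have "\<dots> = (\<Sum>i<n. cat_dim C (S i))"
  proof (rule sum.cong[OF refl])
    fix i assume "i \<in> {..<n}"
    then have i: "i < n" by simp
    show "quantum_trace C X (inj i \<cdot> prj i) = cat_dim C (S i)"
      using quantum_trace_cyclic[OF X S[OF i] prj[OF i] inj[OF i]] ortho[OF i i] by (simp add: cat_dim_def)
  qed
  finally show "cat_dim C X = (\<Sum>i<n. cat_dim C (S i))" .
qed

text \<open>The trace of the identity over a product is two nested loops; the inner one carries no
  link with the other strand and is a scalar.\<close>

lemma cat_dim_tensor:
  assumes [simp]: "X \<in> Ob C" "Z \<in> Ob C"
  shows "cat_dim C (X \<boxtimes> Z) = cat_dim C X * cat_dim C Z"
proof -
  have d: "dia (did [X, Z]) [X, Z] [X, Z]" "dia (did ([] :: 'a list)) [] []" by (simp_all add: did_Some(1))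
  have s: "dia (split X Z) [X \<boxtimes> Z] [X, Z]" by (simp add: split_Some)
  have "did [X \<boxtimes> Z] = whisk [] (fuse X Z) [] \<bullet> did [X, Z] \<bullet> whisk [] (split X Z) []"
    using dcomp_did(2)[OF s] by (simp add: split_fuse)
  then have "ptr (X \<boxtimes> Z) [] (did [X \<boxtimes> Z]) = ptr Z [] (ptr X [Z] (did [X, Z]))"
    using ptr_tensor[of X Z "did [X, Z]" "[]"] d by simp
  also have "did [X, Z] = whisk [] (did [X]) [Z]" by (simp add: whisk_did)
  also have "ptr X [Z] (whisk [] (did [X]) [Z]) = dscale (cat_dim C X) (did [Z])"
    using ptr_whisk[of X "[]" "[Z]" "did [X]"] by (simp add: ptr_did whisk_dscale whisk_did)
  finally show ?thesis
    by (intro dscale_did_inject) (simp add: ptr_dscale ptr_did dscale_dscale[OF d(2)])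
qed

lemma S_entry_sym:
  assumes "X \<in> Ob C" "Y \<in> Ob C"
  shows "S_entry C X Y = S_entry C Y X"
  using quantum_trace_cyclic[of "Y \<boxtimes> X" "X \<boxtimes> Y" "braiding C Y X" "braiding C X Y"] assms
    braiding_iso[of X Y] braiding_iso[of Y X]
  by (simp add: S_entry_def is_iso_def)

text \<open>\<open>X\<close> is the left factor in the trace defining \<open>S_entry C Y X\<close>,
  so its loop is closed before that of \<open>Y\<close>: the scalar comes out, and what remains is
  the dimension of \<open>Y\<close>.\<close>

lemma S_entry_encircle:
  assumes X: "X \<in> Ob C" and Y: "simple_ob C Y" and a: "ptr X [Y] (encircle X Y) = dscale a (did [Y])"
  shows "S_entry C Y X = a * cat_dim C Y"
proof -
  have [simp]: "X \<in> Ob C" "Y \<in> Ob C" using X Y simple_Ob by auto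
  have "ptr (X \<boxtimes> Y) [] (mor (braid_arr Y X \<star> braid_arr X Y)) = dscale a (dscale (cat_dim C Y) (did []))"
    by (simp add: ptr_braiding_square a ptr_dscale ptr_did)
  moreover have "ptr (X \<boxtimes> Y) [] (mor (braid_arr Y X \<star> braid_arr X Y)) = dscale (S_entry C Y X) (did [])"
    using ptr_trace[of "braid_arr Y X \<star> braid_arr X Y" "X \<boxtimes> Y"] by (simp add: S_entry_def)
  moreover have "dia (did ([] :: 'a list)) [] []" by (simp add: did_Some(1))
  ultimately show ?thesis by (intro dscale_did_inject) (simp add: dscale_dscale)
qed

text \<open>Multiplicativity of the normalized row, with the denominators cleared: nonvanishing of
  the dimensions will come from nondegeneracy of the S-matrix.\<close>

lemma S_entry_tensor:
  assumes X: "X \<in> Ob C" and Y: "simple_ob C Y" and Z: "Z \<in> Ob C"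
  shows "S_entry C Y (X \<boxtimes> Z) * cat_dim C Y = S_entry C Y X * S_entry C Y Z"
proof -
  have YO: "Y \<in> Ob C" using Y by (rule simple_Ob)
  obtain a where a: "ptr X [Y] (encircle X Y) = dscale a (did [Y])" using ptr_encircle_simple[OF X Y] by blast
  obtain b where b: "ptr Z [Y] (encircle Z Y) = dscale b (did [Y])" using ptr_encircle_simple[OF Z Y] by blast
  have "ptr (X \<boxtimes> Z) [Y] (encircle (X \<boxtimes> Z) Y) = dscale (a * b) (did [Y])"
    using ptr_encircle_tensor[OF X YO Z a b] dscale_dscale[OF did_Some(1)[of "[Y]"]] YO by simp
  then show ?thesis
    using S_entry_encircle[OF _ Y] X Z a b by simp
qed

text \<open>The decomposition of \<open>X\<close> is tensored with \<open>Y\<close>; the double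
  braiding is natural, so cyclicity of the trace moves each term to the corresponding
  summand.\<close>

lemma S_entry_additive:
  assumes Y [simp]: "Y \<in> Ob C"
  shows "additive_on_objects (S_entry C Y)"
  unfolding additive_on_objects_def
proof (intro allI impI)
  fix n S X assume ds: "is_direct_sum C n S X"
  obtain inj prj where X [simp]: "X \<in> Ob C" and S [simp]: "\<And>i. i < n \<Longrightarrow> S i \<in> Ob C"
    and inj: "\<And>i. i < n \<Longrightarrow> inj i \<in> Hom C (S i) X" and prj: "\<And>i. i < n \<Longrightarrow> prj i \<in> Hom C X (S i)"
    and ortho: "\<And>i j. i < n \<Longrightarrow> j < n \<Longrightarrow> prj i \<cdot> inj j = (if i = j then Id C (S i) else 0)"
    and total: "(\<Sum>i<n. inj i \<cdot> prj i) = Id C X"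
    using direct_sumE[OF ds] by blast
  let ?b = "\<lambda>X. braid_arr Y X \<star> braid_arr X Y"
  define j where "j i = (S i, inj i, X)" for i
  define p where "p i = (X, prj i, S i)" for i
  have j [simp]: "isarr (j i)" "src (j i) = S i" "tgt (j i) = X"
    and p [simp]: "isarr (p i)" "src (p i) = X" "tgt (p i) = S i" if "i < n" for i
    using that inj prj by (auto simp: j_def p_def isarr_triple)
  have pj: "p i \<star> j i = ident (S i)" if "i < n" for i
    using ortho[OF that that] by (intro src_mid_tgt_eqI) (simp_all add: p_def j_def)
  \<comment> \<open>\<open>?w i\<close> is the idempotent on \<open>X \<boxtimes> Y\<close> that
    projects onto the summand \<open>S i \<boxtimes> Y\<close>.\<close>
  let ?w = "\<lambda>i. (j i \<bowtie> ident Y) \<star> (p i \<bowtie> ident Y)"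
  have w: "mid (?b X \<star> ?w i) \<in> Hom C (X \<boxtimes> Y) (X \<boxtimes> Y)" if "i < n" for i
  proof -
    have "isarr (?b X \<star> ?w i)" using that by simp
    then show ?thesis using that by (simp add: isarr_def del: isarr_Ob)
  qed
  have IdXY: "Id C (X \<boxtimes> Y) = (\<Sum>i<n. mid (?w i))"
  proof -
    have IY: "Id C Y \<in> Hom C Y Y" by (simp add: Id_Hom)
    have ip: "inj i \<cdot> prj i \<in> Hom C X X" if "i < n" for i
      using Comp_Hom[OF X S X prj inj] that by blast
    have "(\<Sum>i\<in>J. inj i \<cdot> prj i) \<boxdot> Id C Y = (\<Sum>i\<in>J. (inj i \<cdot> prj i) \<boxdot> Id C Y)" if "J \<subseteq> {..<n}" for J
      using finite_subset[OF that finite_lessThan] that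
    proof (induction J)
      case empty
      show ?case using tensor_add_left[of X X Y Y 0 0 "Id C Y"] IY Hom_closed(1)[OF X X] by simp
    next
      case (insert i J)
      then show ?case
        using tensor_add_left[of X X Y Y "inj i \<cdot> prj i" "\<Sum>i\<in>J. inj i \<cdot> prj i" "Id C Y"] IY ip
          Hom_closed(5)[OF X X, of J "\<lambda>i. inj i \<cdot> prj i"] by auto
    qed
    from this[of "{..<n}"] have "Id C (X \<boxtimes> Y) = (\<Sum>i<n. (inj i \<cdot> prj i) \<boxdot> Id C Y)"
      using total tensor_Id[of X Y] by simp
    also have "\<dots> = (\<Sum>i<n. mid (?w i))"
    proof (rule sum.cong[OF refl])
      fix i assume "i \<in> {..<n}"
      then have "i < n" by simp
      then have "?w i = (j i \<star> p i) \<bowtie> ident Y" by (simp add: tens_cmp_ident)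
      from arg_cong[OF this, of mid] show "(inj i \<cdot> prj i) \<boxdot> Id C Y = mid (?w i)"
        by (simp add: j_def p_def)
    qed
    finally show ?thesis .
  qed
  have bH: "mid (?b X) \<in> Hom C (X \<boxtimes> Y) (X \<boxtimes> Y)"
  proof -
    have "isarr (?b X)" by simp
    then show ?thesis by (simp add: isarr_def del: isarr_Ob)
  qed
  have S_eq: "S_entry C Y Z = quantum_trace C (Z \<boxtimes> Y) (mid (?b Z))" for Z
    by (simp add: S_entry_def)
  have "mid (?b X) = mid (?b X) \<cdot> (\<Sum>i<n. mid (?w i))"
    by (subst IdXY[symmetric], subst Comp_Id[OF _ _ bH]) simp_all
  also have "\<dots> = (\<Sum>i<n. mid (?b X) \<cdot> mid (?w i))"
  proof (rule Comp_sum(2)[OF _ _ _ bH])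
    fix i assume "i \<in> {..<n}"
    then have "isarr (?w i)" "src (?w i) = X \<boxtimes> Y" "tgt (?w i) = X \<boxtimes> Y" by simp_all
    then show "mid (?w i) \<in> Hom C (X \<boxtimes> Y) (X \<boxtimes> Y)" by (simp add: isarr_def del: isarr_Ob cmp_simps)
  qed simp_all
  finally have b_sum: "mid (?b X) = (\<Sum>i<n. mid (?b X) \<cdot> mid (?w i))" .
  have "S_entry C Y X = quantum_trace C (X \<boxtimes> Y) (\<Sum>i<n. mid (?b X \<star> ?w i))"
    unfolding S_eq by (subst b_sum) (simp only: cmp_simps)
  also have "\<dots> = (\<Sum>i<n. quantum_trace C (X \<boxtimes> Y) (mid (?b X \<star> ?w i)))"
    by (rule quantum_trace_sum) (use w in auto)
  also have "\<dots> = (\<Sum>i<n. S_entry C Y (S i))"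
  proof (rule sum.cong[OF refl])
    fix i assume "i \<in> {..<n}"
    then have i [simp]: "i < n" by simp
    have nat: "?b X \<star> (j i \<bowtie> ident Y) = (j i \<bowtie> ident Y) \<star> ?b (S i)"
    proof -
      have "?b X \<star> (j i \<bowtie> ident Y) = braid_arr Y X \<star> (ident Y \<bowtie> j i) \<star> braid_arr (S i) Y"
        using braid_arr_nat[of "j i" "ident Y" "S i" X Y Y] by simp
      also have "\<dots> = ((j i \<bowtie> ident Y) \<star> braid_arr Y (S i)) \<star> braid_arr (S i) Y"
        by (subst cmp_reassoc[OF braid_arr_nat[of "ident Y" "j i" Y Y "S i" X]]) simp_all
      finally show ?thesis by simp
    qed
    have "?b X \<star> ?w i = ((j i \<bowtie> ident Y) \<star> ?b (S i)) \<star> (p i \<bowtie> ident Y)"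
      by (subst cmp_reassoc[OF nat]) simp_all
    then have eq: "?b X \<star> ?w i = ((j i \<bowtie> ident Y) \<star> ?b (S i)) \<star> (p i \<bowtie> ident Y)" .
    let ?g = "(j i \<bowtie> ident Y) \<star> ?b (S i)" and ?f = "p i \<bowtie> ident Y"
    have H: "mid ?f \<in> Hom C (X \<boxtimes> Y) (S i \<boxtimes> Y)" "mid ?g \<in> Hom C (S i \<boxtimes> Y) (X \<boxtimes> Y)"
    proof -
      have "isarr ?f" "isarr ?g" by simp_all
      then show "mid ?f \<in> Hom C (X \<boxtimes> Y) (S i \<boxtimes> Y)" "mid ?g \<in> Hom C (S i \<boxtimes> Y) (X \<boxtimes> Y)"
        by (simp_all add: isarr_def del: isarr_Ob)
    qed
    have "quantum_trace C (X \<boxtimes> Y) (mid (?b X \<star> ?w i)) = quantum_trace C (X \<boxtimes> Y) (mid ?g \<cdot> mid ?f)"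
      by (simp only: eq cmp_simps)
    also have "\<dots> = quantum_trace C (S i \<boxtimes> Y) (mid (?f \<star> ?g))"
      using quantum_trace_cyclic[OF _ _ H] by simp
    also have "?f \<star> ?g = (?f \<star> (j i \<bowtie> ident Y)) \<star> ?b (S i)" by simp
    also have "\<dots> = ?b (S i)" by (simp add: tens_cmp pj del: cmp_assoc)
    finally show "quantum_trace C (X \<boxtimes> Y) (mid (?b X \<star> ?w i)) = S_entry C Y (S i)"
      by (simp add: S_eq)
  qed
  finally show "S_entry C Y X = (\<Sum>i<n. S_entry C Y (S i))" .
qed

end

section \<open>Consequences of nondegeneracy\<close>

context modular_category
begin

text \<open>A matrix with a right inverse has no zero row. Symmetry and additivity carry the row of
  \<open>Y\<close> over to that of its representative.\<close>

lemma S_entry_row_nonzero: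
  assumes Y: "simple_ob C Y"
  shows "\<exists>X\<in>Irr C. S_entry C Y X \<noteq> 0"
proof (rule ccontr)
  assume "\<not> ?thesis"
  then have zero: "S_entry C Y X = 0" if "X \<in> Irr C" for X using that by blast
  obtain Y' where Y': "Y' \<in> Irr C" "isomorphic C Y Y'" using Irr_props(2)[OF Y] by blast
  have O: "Y \<in> Ob C" "Y' \<in> Ob C" using Y Y' simple_Ob by auto
  have "S_entry C Y' X = 0" if "X \<in> Irr C" for X
    using additive_iso[OF S_entry_additive[of X] O Y'(2)] S_entry_sym[of X] O zero[OF that] that by simp
  moreover obtain T where "\<forall>X\<in>Irr C. \<forall>Y\<in>Irr C. (\<Sum>Z\<in>Irr C. S_entry C X Z * T Z Y) = (if X = Y then 1 else 0)"
    using S_nondegenerate by blast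
  ultimately have "(0::'c) = 1" using Y'(1) by fastforce
  then show False by simp
qed

lemma S_entry_multiple:
  assumes X: "X \<in> Ob C" and Y: "simple_ob C Y"
  shows "\<exists>a. S_entry C Y X = a * cat_dim C Y"
  using ptr_encircle_simple[OF X Y] S_entry_encircle[OF X Y] by blast

text \<open>All entries in the row of \<open>Y\<close> are multiples of its dimension, which hence
  cannot vanish.\<close>

lemma cat_dim_nonzero: "simple_ob C Y \<Longrightarrow> cat_dim C Y \<noteq> 0"
  using S_entry_row_nonzero[of Y] S_entry_multiple[of _ Y] Irr_Ob by (metis mult_zero_right)

lemma Unit_tens_iso: "X \<in> Ob C \<Longrightarrow> isomorphic C (Unit C \<boxtimes> X) X"
  using lunitor_iso unfolding isomorphic_def by blast

text \<open>Multiplicativity determines the value at the unit object up to an idempotent, and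
  nondegeneracy of the S-matrix excludes \<open>0\<close>.\<close>

lemma characterI:
  fixes f :: "'a \<Rightarrow> 'c"
  assumes f: "additive_on_objects f" and m: "\<And>X Y. \<lbrakk>X \<in> Ob C; Y \<in> Ob C\<rbrakk> \<Longrightarrow> f (X \<boxtimes> Y) = f X * f Y"
    and nz: "X \<in> Ob C" "f X \<noteq> 0"
  shows "character f"
proof -
  have "f X = f (Unit C) * f X"
    using additive_iso[OF f _ _ Unit_tens_iso[OF nz(1)]] m[of "Unit C" X] nz by simp
  then show ?thesis using f m nz by (auto simp: character_def)
qed

lemma cat_dim_character: "character (cat_dim C)"
  by (rule characterI[of _ "Unit C"]) (auto simp: cat_dim_additive cat_dim_tensor cat_dim_nonzero Unit_simple)

definition chi :: "'a \<Rightarrow> 'a \<Rightarrow> 'c" where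
  "chi Y X = S_entry C Y X / cat_dim C Y"

lemma chi_character:
  assumes Y: "simple_ob C Y"
  shows "character (chi Y)"
proof -
  have YO: "Y \<in> Ob C" using Y by (rule simple_Ob)
  obtain X where "X \<in> Irr C" "S_entry C Y X \<noteq> 0" using S_entry_row_nonzero[OF Y] by blast
  then have X: "X \<in> Ob C" "chi Y X \<noteq> 0" using cat_dim_nonzero[OF Y] by (auto simp: chi_def)
  show ?thesis
  proof (rule characterI[where f = "chi Y", OF _ _ X])
    show "additive_on_objects (chi Y)"
      using S_entry_additive[OF YO] by (simp add: additive_on_objects_def chi_def sum_divide_distrib)
    show "chi Y (X \<boxtimes> Z) = chi Y X * chi Y Z" if "X \<in> Ob C" "Z \<in> Ob C" for X Z
      using S_entry_tensor[OF that(1) Y that(2)] cat_dim_nonzero[OF Y] by (simp add: chi_def field_simps)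
  qed
qed

lemma chi_Unit_row:
  assumes X: "simple_ob C X"
  shows "S_entry C X (Unit C) = cat_dim C X"
  using characterD(3)[OF chi_character[OF X]] cat_dim_nonzero[OF X] by (simp add: chi_def)

text \<open>The hypothesis makes the row of \<open>X\<close> a multiple of the row of the unit
  object. Distinct rows of an invertible matrix are not proportional, so both have the same
  representative.\<close>

lemma simple_iso_Unit:
  assumes X: "simple_ob C X" and eq: "\<And>Y. simple_ob C Y \<Longrightarrow> S_entry C X Y = cat_dim C X * cat_dim C Y"
  shows "isomorphic C X (Unit C)"
proof -
  obtain X' where X': "X' \<in> Irr C" "isomorphic C X X'" using Irr_props(2)[OF X] by blast
  obtain I where I: "I \<in> Irr C" "isomorphic C (Unit C) I" using Irr_props(2)[OF Unit_simple] by blast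
  have O: "X \<in> Ob C" "X' \<in> Ob C" "I \<in> Ob C" using X simple_Ob X' I by auto
  have row: "S_entry C X' Y = cat_dim C X * S_entry C I Y" if Y: "Y \<in> Irr C" for Y
  proof -
    have "S_entry C X' Y = S_entry C X Y"
      using additive_iso[OF S_entry_additive[of Y] O(1,2) X'(2)] S_entry_sym[of Y] O Y by simp
    moreover have "S_entry C I Y = cat_dim C Y"
      using additive_iso[OF S_entry_additive[of Y] _ O(3) I(2)] S_entry_sym[of Y] O Y chi_Unit_row[OF Irr_simple[OF Y]] by simp
    ultimately show ?thesis using eq[OF Irr_simple[OF Y]] by simp
  qed
  obtain T where T: "\<And>X Y. X \<in> Irr C \<Longrightarrow> Y \<in> Irr C \<Longrightarrow> (\<Sum>Z\<in>Irr C. S_entry C X Z * T Z Y) = (if X = Y then 1 else 0)"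
    using S_nondegenerate by blast
  have "X' = I"
  proof (rule ccontr)
    assume ne: "X' \<noteq> I"
    have "1 = (\<Sum>Z\<in>Irr C. S_entry C X' Z * T Z X')" using T[OF X'(1) X'(1)] by simp
    also have "\<dots> = cat_dim C X * (\<Sum>Z\<in>Irr C. S_entry C I Z * T Z X')"
      unfolding sum_distrib_left by (intro sum.cong refl) (simp add: row mult.assoc)
    also have "\<dots> = 0" using T[OF I(1) X'(1)] ne by simp
    finally show False by simp
  qed
  then show ?thesis using isomorphic_trans[of X X' "Unit C"] isomorphic_sym[OF I(2)] X'(2) O by simp
qed

end

section \<open>Centralizers\<close>

context fusion_category
begin

lemma fusion_subcategory_Ob: "fusion_subcategory C (Ob C)"
  by (auto simp: fusion_subcategory_def is_direct_sum_def subobject_def)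

lemma fusion_subcategoryD:
  assumes "fusion_subcategory C K"
  shows "Unit C \<in> K" "\<lbrakk>X \<in> K; subobject C Z X\<rbrakk> \<Longrightarrow> Z \<in> K"
  using assms unfolding fusion_subcategory_def by blast+

lemma fusion_subcategory_Inter:
  assumes "F \<noteq> {}" and "\<And>K. K \<in> F \<Longrightarrow> fusion_subcategory C K"
  shows "fusion_subcategory C (\<Inter> F)"
proof -
  have "K \<subseteq> Ob C \<and> Unit C \<in> K \<and> (\<forall>X\<in>K. \<forall>Y\<in>K. X \<boxtimes> Y \<in> K) \<and> (\<forall>X\<in>K. dual C X \<in> K) \<and>
     (\<forall>n S X. (\<forall>i<n. S i \<in> K) \<and> is_direct_sum C n S X \<longrightarrow> X \<in> K) \<and>
     (\<forall>X\<in>K. \<forall>Z. subobject C Z X \<longrightarrow> Z \<in> K)" if "K \<in> F" for K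
    using assms(2)[OF that] unfolding fusion_subcategory_def .
  then show ?thesis unfolding fusion_subcategory_def
    using assms(1) by (intro conjI ballI allI impI) (blast | meson InterE InterI)+
qed

lemma generated_subcategory_props:
  assumes "S \<subseteq> Ob C"
  shows "fusion_subcategory C (generated_subcategory C S)" "S \<subseteq> generated_subcategory C S"
    "generated_subcategory C S \<subseteq> Ob C"
  unfolding generated_subcategory_def using fusion_subcategory_Ob assms
  by (auto intro!: fusion_subcategory_Inter)

lemma generated_subcategory_least:
  "\<lbrakk>fusion_subcategory C K; S \<subseteq> K\<rbrakk> \<Longrightarrow> generated_subcategory C S \<subseteq> K"
  unfolding generated_subcategory_def by blast

text \<open>Closure under subobjects passes membership to the constituents, and closure under direct
  sums passes it back. Thus inclusions need only be checked on simple objects.\<close>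

lemma fusion_subcategory_Irr:
  assumes K: "fusion_subcategory C K" and X: "X \<in> Ob C"
  shows "X \<in> K \<longleftrightarrow> (\<forall>Z\<in>Irr C. multiplicity C Z X > 0 \<longrightarrow> Z \<in> K)"
proof
  have sub: "\<And>X Z. X \<in> K \<Longrightarrow> subobject C Z X \<Longrightarrow> Z \<in> K"
    and ds: "\<And>n S X. (\<forall>i<n. S i \<in> K) \<Longrightarrow> is_direct_sum C n S X \<Longrightarrow> X \<in> K"
    using K unfolding fusion_subcategory_def by blast+
  show "\<forall>Z\<in>Irr C. multiplicity C Z X > 0 \<longrightarrow> Z \<in> K" if "X \<in> K"
    using sub[OF that] subobject_if_multiplicity[OF X] Irr_simple by blast
  assume *: "\<forall>Z\<in>Irr C. multiplicity C Z X > 0 \<longrightarrow> Z \<in> K"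
  obtain n S where S: "\<And>i. i < n \<Longrightarrow> simple_ob C (S i)" "is_direct_sum C n S X"
    using semisimple[OF X] by blast
  have "S i \<in> K" if i: "i < n" for i
  proof -
    obtain Z where Z: "Z \<in> Irr C" "isomorphic C (S i) Z" using Irr_props(2)[OF S(1)[OF i]] by blast
    have "i \<in> {j. j < n \<and> isomorphic C (S j) Z}" using i Z by simp
    then have "multiplicity C Z X > 0"
      using multiplicity_card[OF S(2,1) Irr_simple[OF Z(1)]] by (auto simp: card_gt_0_iff)
    then have "Z \<in> K" using * Z by blast
    then show ?thesis using sub subobject_iso[of "S i" Z] Z S(1)[OF i] simple_Ob Irr_Ob by blast
  qed
  then show "X \<in> K" using ds S(2) by blast
qed

end

section \<open>Characters after the embedding, and centralizers of simple objects\<close>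

context pseudounitary_modular_category
begin

definition dimc :: "'o \<Rightarrow> complex" where "dimc X = \<iota> (cat_dim C X)"
definition chic :: "'o \<Rightarrow> 'o \<Rightarrow> complex" where "chic Y X = \<iota> (chi Y X)"
definition dimr :: "'o \<Rightarrow> real" where "dimr X = Re (dimc X)"

lemma dimc_character: "character dimc"
  using character_embedding[OF embedding cat_dim_character] by (simp add: dimc_def[abs_def])

lemma chic_character: "simple_ob C Y \<Longrightarrow> character (chic Y)"
  using character_embedding[OF embedding chi_character] by (simp add: chic_def[abs_def])

text \<open>\<open>canonical_spherical\<close> identifies embedded dimensions with values of
  \<open>FPdim\<close>, which are real; positivity is \<open>FPdim_pos\<close>.\<close>

lemma dimc_simple: "simple_ob C X \<Longrightarrow> dimc X = of_real (dimr X)" "simple_ob C X \<Longrightarrow> dimr X > 0"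
  using canonical_spherical[of X] FPdim_pos[OF dimc_character, of X] canonical_spherical
  by (simp_all add: dimc_def dimr_def)

lemma dimr_sum: "X \<in> Ob C \<Longrightarrow> dimr X = (\<Sum>Z\<in>Irr C. of_nat (multiplicity C Z X) * dimr Z)"
  using arg_cong[OF characterD(4)[OF dimc_character, of X], of Re] by (simp add: dimr_def)

lemma dimc_eq: "X \<in> Ob C \<Longrightarrow> dimc X = of_real (dimr X)"
  by (subst characterD(4)[OF dimc_character], assumption, subst dimr_sum, assumption)
    (simp add: dimc_simple(1) Irr_simple)

lemma dimr_tensor: "\<lbrakk>X \<in> Ob C; Y \<in> Ob C\<rbrakk> \<Longrightarrow> dimr (X \<boxtimes> Y) = dimr X * dimr Y"
  using characterD(2)[OF dimc_character, of X Y] dimc_eq[of X] dimc_eq[of Y] dimc_eq[of "X \<boxtimes> Y"]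
  by (metis of_real_eq_iff of_real_mult tensor_Ob)

lemma chic_bound_Irr:
  assumes Y: "simple_ob C Y" and Z: "Z \<in> Irr C"
  shows "cmod (chic Y Z) \<le> dimr Z"
proof (rule fusion_bound[OF _ _ _ Z])
  show "chic Y X * chic Y Z = (\<Sum>W\<in>Irr C. of_nat (multiplicity C W (X \<boxtimes> Z)) * chic Y W)"
    if "X \<in> Irr C" "Z \<in> Irr C" for X Z
    using characterD(2)[OF chic_character[OF Y], of X Z] characterD(4)[OF chic_character[OF Y], of "X \<boxtimes> Z"] that by simp
  show "dimr X * dimr Z = (\<Sum>W\<in>Irr C. of_nat (multiplicity C W (X \<boxtimes> Z)) * dimr W)"
    if "X \<in> Irr C" "Z \<in> Irr C" for X Z
    using dimr_tensor[of X Z] dimr_sum[of "X \<boxtimes> Z"] that by simp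
qed (use dimc_simple(2) Irr_simple in auto)

lemma chic_bound_le:
  assumes Y: "simple_ob C Y" and X: "X \<in> Ob C"
  shows "cmod (chic Y X) \<le> (\<Sum>Z\<in>Irr C. of_nat (multiplicity C Z X) * cmod (chic Y Z))"
  using norm_sum[of "\<lambda>Z. of_nat (multiplicity C Z X) * chic Y Z" "Irr C"]
    characterD(4)[OF chic_character[OF Y] X] by (simp add: norm_mult)

lemma chic_bound:
  assumes Y: "simple_ob C Y" and X: "X \<in> Ob C"
  shows "cmod (chic Y X) \<le> dimr X"
proof -
  have "(\<Sum>Z\<in>Irr C. of_nat (multiplicity C Z X) * cmod (chic Y Z)) \<le> dimr X"
    unfolding dimr_sum[OF X] by (intro sum_mono mult_left_mono chic_bound_Irr[OF Y]) auto
  then show ?thesis using chic_bound_le[OF Y X] by linarith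
qed

text \<open>Summing the bounds over the constituents reaches \<open>dimr X\<close>, so equality at
  \<open>X\<close> leaves no slack in a term with positive multiplicity.\<close>

lemma chic_norm_eq_constituent:
  assumes Y: "simple_ob C Y" and X: "X \<in> Ob C" and eq: "cmod (chic Y X) = dimr X"
    and Z: "Z \<in> Irr C" "multiplicity C Z X > 0"
  shows "cmod (chic Y Z) = dimr Z"
proof -
  have "(\<Sum>Z\<in>Irr C. of_nat (multiplicity C Z X) * (dimr Z - cmod (chic Y Z))) \<le> 0"
    using chic_bound_le[OF Y X] dimr_sum[OF X] eq by (simp add: right_diff_distrib sum_subtractf)
  moreover have nn: "\<forall>Z\<in>Irr C. 0 \<le> of_nat (multiplicity C Z X) * (dimr Z - cmod (chic Y Z))"
    using chic_bound_Irr[OF Y] by simp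
  ultimately have "(\<Sum>Z\<in>Irr C. of_nat (multiplicity C Z X) * (dimr Z - cmod (chic Y Z))) = 0"
    using sum_nonneg[of "Irr C" "\<lambda>Z. of_nat (multiplicity C Z X) * (dimr Z - cmod (chic Y Z))"] by force
  then have "of_nat (multiplicity C Z X) * (dimr Z - cmod (chic Y Z)) = 0"
    using sum_nonneg_eq_0_iff[OF finite_Irr, of "\<lambda>Z. of_nat (multiplicity C Z X) * (dimr Z - cmod (chic Y Z))"] nn Z by blast
  then show ?thesis using Z by simp
qed

text \<open>The argument on slack, now for real parts. Once the real part is \<open>dimr Z\<close>,
  the bound on the modulus leaves no room for an imaginary part.\<close>

lemma chic_eq_constituent:
  assumes Y: "simple_ob C Y" and X: "X \<in> Ob C" and eq: "chic Y X = dimc X"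
    and Z: "Z \<in> Irr C" "multiplicity C Z X > 0"
  shows "chic Y Z = dimc Z"
proof -
  have nn: "0 \<le> of_nat (multiplicity C Z X) * (dimr Z - Re (chic Y Z))" if "Z \<in> Irr C" for Z
    using order_trans[OF complex_Re_le_cmod chic_bound_Irr[OF Y that]] by simp
  have "Re (chic Y X) = (\<Sum>Z\<in>Irr C. of_nat (multiplicity C Z X) * Re (chic Y Z))"
    using arg_cong[OF characterD(4)[OF chic_character[OF Y] X], of Re] by simp
  then have "(\<Sum>Z\<in>Irr C. of_nat (multiplicity C Z X) * (dimr Z - Re (chic Y Z))) = 0"
    using dimr_sum[OF X] eq by (simp add: right_diff_distrib sum_subtractf dimr_def)
  then have "of_nat (multiplicity C Z X) * (dimr Z - Re (chic Y Z)) = 0"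
    using sum_nonneg_eq_0_iff[OF finite_Irr, of "\<lambda>Z. of_nat (multiplicity C Z X) * (dimr Z - Re (chic Y Z))"] nn Z by blast
  then have re: "Re (chic Y Z) = dimr Z" using Z by simp
  then have "(Im (chic Y Z))\<^sup>2 \<le> 0"
    using power_mono[OF chic_bound_Irr[OF Y Z(1)], of 2] by (simp add: cmod_power2)
  then have "chic Y Z = of_real (dimr Z)" using re by (simp add: complex_eq_iff)
  then show ?thesis using dimc_eq Z by simp
qed

text \<open>Both values are algebraic and \<open>\<iota>\<close> is injective on algebraic elements,
  so equalities can be carried back from the complex numbers to \<open>k\<close>.\<close>

lemma chi_eq_iff:
  assumes Y: "simple_ob C Y" and X: "X \<in> Ob C"
  shows "chi Y X = cat_dim C X \<longleftrightarrow> chic Y X = dimc X"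
  using algebraic_embedding_simps(6)[OF embedding] character_algebraic[OF chi_character[OF Y] X]
    character_algebraic[OF cat_dim_character X]
  by (auto simp: chic_def dimc_def)

text \<open>For simple \<open>Y\<close> this is the centralizer of \<open>Y\<close>, given by a
  condition on all objects instead of by simple generators; it is the kernel of \<open>chi Y\<close>
  in the sense of group characters.\<close>

definition kern :: "'o \<Rightarrow> 'o set" where
  "kern Y = {X \<in> Ob C. chi Y X = cat_dim C X}"

lemma kern_iff: "simple_ob C Y \<Longrightarrow> X \<in> kern Y \<longleftrightarrow> X \<in> Ob C \<and> chic Y X = dimc X"
  using chi_eq_iff by (auto simp: kern_def)

text \<open>Both characters turn duals into complex conjugates, which gives closure under duals;
  closure under subobjects is \<open>chic_eq_constituent\<close>.\<close>

lemma fusion_subcategory_kern: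
  assumes Y: "simple_ob C Y"
  shows "fusion_subcategory C (kern Y)"
  unfolding fusion_subcategory_def
proof (intro conjI ballI allI impI)
  note c = chic_character[OF Y] and d = dimc_character
  show "kern Y \<subseteq> Ob C" by (auto simp: kern_def)
  show "Unit C \<in> kern Y" using characterD(3)[OF c] characterD(3)[OF d] by (simp add: kern_iff[OF Y])
  show "X \<boxtimes> X' \<in> kern Y" if "X \<in> kern Y" "X' \<in> kern Y" for X X'
    using that characterD(2)[OF c] characterD(2)[OF d] by (simp add: kern_iff[OF Y])
  show "dual C X \<in> kern Y" if "X \<in> kern Y" for X
    using that character_conj[OF c] character_conj[OF d] by (simp add: kern_iff[OF Y])
  show "X \<in> kern Y" if "(\<forall>i<n. S i \<in> kern Y) \<and> is_direct_sum C n S X" for n S X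
  proof -
    have "chic Y X = (\<Sum>i<n. chic Y (S i))" "dimc X = (\<Sum>i<n. dimc (S i))" "X \<in> Ob C"
      using characterD(1)[OF c] characterD(1)[OF d] that by (auto simp: additive_on_objects_def is_direct_sum_def)
    then show ?thesis using that by (simp add: kern_iff[OF Y])
  qed
  show "Z \<in> kern Y" if X: "X \<in> kern Y" and Z: "subobject C Z X" for X Z
  proof -
    have O: "X \<in> Ob C" "Z \<in> Ob C" using X Z by (auto simp: kern_def subobject_def)
    have "of_nat (multiplicity C W Z) * chic Y W = of_nat (multiplicity C W Z) * dimc W" if W: "W \<in> Irr C" for W
    proof (cases "multiplicity C W Z > 0")
      case True
      then have "multiplicity C W X > 0" using multiplicity_subobject[OF O(1) Irr_simple[OF W] Z] by blast
      then show ?thesis using chic_eq_constituent[OF Y O(1) _ W] X by (simp add: kern_iff[OF Y])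
    qed simp
    then have "chic Y Z = dimc Z"
      unfolding characterD(4)[OF c O(2)] characterD(4)[OF d O(2)] by (rule sum.cong[OF refl])
    then show ?thesis using O by (simp add: kern_iff[OF Y])
  qed
qed

text \<open>The values at \<open>X\<^sup>*\<close> and \<open>X\<close> are complex conjugate, so that \<open>X \<otimes> X\<^sup>*\<close> is centralized by \<open>Y\<close> iff
  the bound \<open>cmod (chic Y X) \<le> dimr X\<close> is attained.\<close>

lemma tensor_dual_kern:
  assumes Y: "simple_ob C Y" and X: "X \<in> Ob C"
  shows "X \<boxtimes> dual C X \<in> kern Y \<longleftrightarrow> cmod (chic Y X) = dimr X"
proof -
  have "chic Y (X \<boxtimes> dual C X) = of_real ((cmod (chic Y X))\<^sup>2)"
    using X characterD(2)[OF chic_character[OF Y]] character_conj[OF chic_character[OF Y]]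
    by (simp only: dual_Ob complex_norm_square)
  moreover have "dimc (X \<boxtimes> dual C X) = of_real ((cmod (dimc X))\<^sup>2)"
    using X characterD(2)[OF dimc_character] character_conj[OF dimc_character]
    by (simp only: dual_Ob complex_norm_square)
  moreover have "dimr X \<ge> 0" using chic_bound[OF Y X] norm_ge_zero order_trans by blast
  then have "cmod (dimc X) = dimr X" by (simp add: dimc_eq[OF X])
  ultimately have "X \<boxtimes> dual C X \<in> kern Y \<longleftrightarrow> (cmod (chic Y X))\<^sup>2 = (dimr X)\<^sup>2"
    using X by (simp only: kern_iff[OF Y] of_real_eq_iff tensor_Ob dual_Ob simp_thms)
  then show ?thesis using \<open>dimr X \<ge> 0\<close> by (simp add: power2_eq_iff_nonneg)
qed

text \<open>Multiplied by the positive dimensions, both equations say that the common modulus of the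
  embedded entries at \<open>X\<close>, \<open>Y\<close> and \<open>Y\<close>, \<open>X\<close> is
  \<open>dimr X * dimr Y\<close>.\<close>

lemma chic_norm_sym:
  assumes X: "simple_ob C X" and Y: "simple_ob C Y"
  shows "cmod (chic X Y) = dimr Y \<longleftrightarrow> cmod (chic Y X) = dimr X"
proof -
  have O: "X \<in> Ob C" "Y \<in> Ob C" using X Y simple_Ob by auto
  have "chi X Y * cat_dim C X = chi Y X * cat_dim C Y"
    using S_entry_sym[OF O] cat_dim_nonzero[OF X] cat_dim_nonzero[OF Y] by (simp add: chi_def)
  then have "chic X Y * dimc X = chic Y X * dimc Y"
    using algebraic_embedding_simps(4)[OF embedding] O
      character_algebraic[OF chi_character[OF X]] character_algebraic[OF chi_character[OF Y]]
      character_algebraic[OF cat_dim_character]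
    unfolding chic_def dimc_def by metis
  then have "cmod (chic X Y) * dimr X = cmod (chic Y X) * dimr Y"
    using arg_cong[of "chic X Y * dimc X" _ cmod] dimc_simple[OF X] dimc_simple[OF Y]
    by (metis abs_of_pos norm_mult norm_of_real)
  then show ?thesis using dimc_simple(2)[OF X] dimc_simple(2)[OF Y] by (metis mult.commute mult_right_cancel less_irrefl)
qed

lemma S_entry_iff_kern:
  assumes X: "simple_ob C X" and Y: "simple_ob C Y"
  shows "S_entry C X Y = cat_dim C X * cat_dim C Y \<longleftrightarrow> X \<in> kern Y"
    "S_entry C X Y = cat_dim C X * cat_dim C Y \<longleftrightarrow> Y \<in> kern X"
proof -
  have O: "X \<in> Ob C" "Y \<in> Ob C" using X Y simple_Ob by auto
  show "S_entry C X Y = cat_dim C X * cat_dim C Y \<longleftrightarrow> Y \<in> kern X"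
    using cat_dim_nonzero[OF X] O by (auto simp: kern_def chi_def field_simps)
  show "S_entry C X Y = cat_dim C X * cat_dim C Y \<longleftrightarrow> X \<in> kern Y"
    using cat_dim_nonzero[OF Y] O S_entry_sym[OF O] by (auto simp: kern_def chi_def field_simps)
qed

text \<open>An intersection of fusion subcategories is one, so generation adds no simple objects
  beyond those satisfying the defining condition.\<close>

lemma centralizer_eq:
  "centralizer C K = Ob C \<inter> (\<Inter>Y\<in>{Y \<in> K. simple_ob C Y}. kern Y)"
proof -
  let ?R = "Ob C \<inter> (\<Inter>Y\<in>{Y \<in> K. simple_ob C Y}. kern Y)"
  let ?G = "{X. simple_ob C X \<and> (\<forall>Y\<in>K. simple_ob C Y \<longrightarrow> S_entry C X Y = cat_dim C X * cat_dim C Y)}"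
  have R: "fusion_subcategory C ?R"
    using fusion_subcategory_Inter[of "insert (Ob C) (kern ` {Y \<in> K. simple_ob C Y})"]
      fusion_subcategory_Ob fusion_subcategory_kern by auto
  have G: "?G \<subseteq> Ob C" "?G \<subseteq> ?R" using simple_Ob S_entry_iff_kern(1) by auto
  have GR: "Z \<in> ?G" if "simple_ob C Z" "Z \<in> ?R" for Z using that S_entry_iff_kern(1) by auto
  show ?thesis unfolding centralizer_def
  proof (rule subset_antisym[OF generated_subcategory_least[OF R G(2)]], rule subsetI)
    fix X assume X: "X \<in> ?R"
    then have XO: "X \<in> Ob C" by simp
    have "Z \<in> generated_subcategory C ?G" if Z: "Z \<in> Irr C" "multiplicity C Z X > 0" for Z
    proof -
      have "Z \<in> ?R" using iffD1[OF fusion_subcategory_Irr[OF R XO] X] Z by simp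
      then have "Z \<in> ?G" by (rule GR[OF Irr_simple[OF Z(1)]])
      then show ?thesis by (rule subsetD[OF generated_subcategory_props(2)[OF G(1)]])
    qed
    then show "X \<in> generated_subcategory C ?G"
      by (intro iffD2[OF fusion_subcategory_Irr[OF generated_subcategory_props(1)[OF G(1)] XO]] ballI impI)
  qed
qed

section \<open>Exchanging adjoint and commutator subcategories\<close>

lemma adjoint_subcategory_props:
  assumes "K \<subseteq> Ob C"
  shows "fusion_subcategory C (adjoint_subcategory C K)" "adjoint_subcategory C K \<subseteq> Ob C"
proof -
  have "{Z. \<exists>X\<in>K. simple_ob C X \<and> subobject C Z (X \<boxtimes> dual C X)} \<subseteq> Ob C"
    by (auto simp: subobject_def)
  then show "fusion_subcategory C (adjoint_subcategory C K)" "adjoint_subcategory C K \<subseteq> Ob C"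
    unfolding adjoint_subcategory_def using generated_subcategory_props by auto
qed

text \<open>\<open>kern X\<close> is a fusion subcategory, so only the generators matter. Among them
  is each \<open>Y \<boxtimes> dual C Y\<close>, as a subobject of itself, and all others are
  subobjects of such products.\<close>

lemma adjoint_subset_kern_iff:
  assumes K: "K \<subseteq> Ob C" and X: "simple_ob C X"
  shows "(\<forall>Y\<in>adjoint_subcategory C K. simple_ob C Y \<longrightarrow> Y \<in> kern X)
    \<longleftrightarrow> (\<forall>Y\<in>K. simple_ob C Y \<longrightarrow> Y \<boxtimes> dual C Y \<in> kern X)"
proof -
  let ?A = "adjoint_subcategory C K" let ?G = "{Z. \<exists>X\<in>K. simple_ob C X \<and> subobject C Z (X \<boxtimes> dual C X)}"
  note A = adjoint_subcategory_props[OF K] and kX = fusion_subcategory_kern[OF X]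
  have G: "?G \<subseteq> Ob C" by (auto simp: subobject_def)
  have "?A \<subseteq> kern X" if "\<forall>Y\<in>?A. simple_ob C Y \<longrightarrow> Y \<in> kern X"
  proof
    fix Y assume Y: "Y \<in> ?A"
    then have YO: "Y \<in> Ob C" using A(2) by blast
    show "Y \<in> kern X"
      using fusion_subcategory_Irr[OF kX YO] fusion_subcategory_Irr[OF A(1) YO] Y that Irr_simple by blast
  qed
  then have "(\<forall>Y\<in>?A. simple_ob C Y \<longrightarrow> Y \<in> kern X) \<longleftrightarrow> ?A \<subseteq> kern X" by blast
  also have "\<dots> \<longleftrightarrow> ?G \<subseteq> kern X"
    unfolding adjoint_subcategory_def
    using generated_subcategory_least[OF kX] generated_subcategory_props(2)[OF G] by blast
  also have "\<dots> \<longleftrightarrow> (\<forall>Y\<in>K. simple_ob C Y \<longrightarrow> Y \<boxtimes> dual C Y \<in> kern X)"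
  proof
    assume L: "?G \<subseteq> kern X"
    show "\<forall>Y\<in>K. simple_ob C Y \<longrightarrow> Y \<boxtimes> dual C Y \<in> kern X"
    proof (intro ballI impI)
      fix Y assume Y: "Y \<in> K" "simple_ob C Y"
      then have "Y \<boxtimes> dual C Y \<in> Ob C" using K by auto
      then have "subobject C (Y \<boxtimes> dual C Y) (Y \<boxtimes> dual C Y)" using subobject_iso isomorphic_refl by blast
      then show "Y \<boxtimes> dual C Y \<in> kern X" using L Y by blast
    qed
  next
    assume "\<forall>Y\<in>K. simple_ob C Y \<longrightarrow> Y \<boxtimes> dual C Y \<in> kern X"
    then show "?G \<subseteq> kern X" using fusion_subcategoryD(2)[OF kX] by blast
  qed
  finally show ?thesis .
qed

text \<open>Both sides are generated by sets of simple objects, and these sets coincide: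
  \<open>Y \<boxtimes> dual C Y \<in> kern X\<close> and
  \<open>X \<boxtimes> dual C X \<in> kern Y\<close> are equivalent by
  \<open>chic_norm_sym\<close>.\<close>

lemma centralizer_adjoint:
  assumes K: "K \<subseteq> Ob C"
  shows "centralizer C (adjoint_subcategory C K) = commutator_subcategory C (centralizer C K)"
proof -
  have "(\<forall>Y\<in>adjoint_subcategory C K. simple_ob C Y \<longrightarrow> S_entry C X Y = cat_dim C X * cat_dim C Y)
    \<longleftrightarrow> X \<boxtimes> dual C X \<in> centralizer C K" if X: "simple_ob C X" for X
  proof -
    have XO: "X \<in> Ob C" using X by (rule simple_Ob)
    have "(\<forall>Y\<in>adjoint_subcategory C K. simple_ob C Y \<longrightarrow> S_entry C X Y = cat_dim C X * cat_dim C Y)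
      \<longleftrightarrow> (\<forall>Y\<in>adjoint_subcategory C K. simple_ob C Y \<longrightarrow> Y \<in> kern X)"
      using S_entry_iff_kern(2)[OF X] by blast
    also have "\<dots> \<longleftrightarrow> (\<forall>Y\<in>K. simple_ob C Y \<longrightarrow> Y \<boxtimes> dual C Y \<in> kern X)"
      by (rule adjoint_subset_kern_iff[OF K X])
    also have "\<dots> \<longleftrightarrow> (\<forall>Y\<in>K. simple_ob C Y \<longrightarrow> X \<boxtimes> dual C X \<in> kern Y)"
      using tensor_dual_kern[OF X] tensor_dual_kern[OF _ XO] chic_norm_sym[OF X] simple_Ob by blast
    also have "\<dots> \<longleftrightarrow> X \<boxtimes> dual C X \<in> centralizer C K"
      using XO by (auto simp: centralizer_eq)
    finally show ?thesis .
  qed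
  then have "{X. simple_ob C X \<and> (\<forall>Y\<in>adjoint_subcategory C K. simple_ob C Y \<longrightarrow> S_entry C X Y = cat_dim C X * cat_dim C Y)}
    = {X. simple_ob C X \<and> X \<boxtimes> dual C X \<in> centralizer C K}" by blast
  then show ?thesis by (simp add: centralizer_def[of C "adjoint_subcategory C K"] commutator_subcategory_def)
qed

lemma centralizer_Ob_simple: "\<lbrakk>simple_ob C Z; Z \<in> centralizer C (Ob C)\<rbrakk> \<Longrightarrow> isomorphic C Z (Unit C)"
  using simple_iso_Unit[of Z] S_entry_iff_kern(1)[of Z] simple_Ob by (auto simp: centralizer_eq)

text \<open>Nondegeneracy leaves only the unit object among the simple constituents of an object
  that centralizes everything.\<close>

lemma centralizer_Ob: "centralizer C (Ob C) = Vec_subcategory C"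
proof
  have V: "fusion_subcategory C (Vec_subcategory C)" "Unit C \<in> Vec_subcategory C"
    unfolding Vec_subcategory_def using generated_subcategory_props[of "{Unit C}"] by auto
  have cF: "fusion_subcategory C (centralizer C (Ob C))"
    unfolding centralizer_def by (rule generated_subcategory_props) (auto simp: simple_Ob)
  then show "Vec_subcategory C \<subseteq> centralizer C (Ob C)"
    unfolding Vec_subcategory_def
    using fusion_subcategoryD(1)[OF cF] by (intro generated_subcategory_least) simp_all
  show "centralizer C (Ob C) \<subseteq> Vec_subcategory C"
  proof
    fix X assume X: "X \<in> centralizer C (Ob C)"
    then have XO: "X \<in> Ob C" by (simp add: centralizer_eq)
    have "Z \<in> Vec_subcategory C" if Z: "Z \<in> Irr C" "multiplicity C Z X > 0" for Z
    proof -
      have "Z \<in> centralizer C (Ob C)" using fusion_subcategory_Irr[OF cF XO] X Z by blast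
      then have "isomorphic C Z (Unit C)" using centralizer_Ob_simple Irr_simple Z by blast
      then have "subobject C Z (Unit C)" using subobject_iso[of Z "Unit C"] Z by simp
      then show ?thesis by (rule fusion_subcategoryD(2)[OF V])
    qed
    then show "X \<in> Vec_subcategory C" using fusion_subcategory_Irr[OF V(1) XO] by blast
  qed
qed

text \<open>Needed because the lower series defines its term of index 1 by invertible objects. A
  simple \<open>Y\<close> is invertible if its product with its dual is a multiple of the unit
  object, since reciprocity allows only one copy. Conversely, constituents of an invertible object
  attain the bound for every row, so their products with their duals centralize everything.\<close>

lemma commutator_Vec: "commutator_subcategory C (Vec_subcategory C) = pointed_subcategory C"
proof -
  let ?V = "Vec_subcategory C"
  have V: "fusion_subcategory C ?V"
    unfolding Vec_subcategory_def using generated_subcategory_props[of "{Unit C}"] by auto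
  have V_simple: "isomorphic C Z (Unit C)" if "simple_ob C Z" "Z \<in> ?V" for Z
    using centralizer_Ob_simple that by (simp add: centralizer_Ob)
  have inv: "invertible_ob C Y" if Y: "simple_ob C Y" and YV: "Y \<boxtimes> dual C Y \<in> ?V" for Y
  proof -
    let ?D = "dual C Y"
    have YO [simp]: "Y \<in> Ob C" using Y by (rule simple_Ob)
    \<comment> \<open>The factors are exchanged because reciprocity counts the unit object in
      \<open>?D \<boxtimes> Y\<close>.\<close>
    have br: "isomorphic C (?D \<boxtimes> Y) (Y \<boxtimes> ?D)" using braiding_iso[of ?D Y] by (auto simp: isomorphic_def)
    have DV: "?D \<boxtimes> Y \<in> ?V" using fusion_subcategoryD(2)[OF V YV subobject_iso[OF _ _ br]] by simp
    obtain n S where S: "\<And>i. i < n \<Longrightarrow> simple_ob C (S i)" "is_direct_sum C n S (?D \<boxtimes> Y)"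
      using semisimple[of "?D \<boxtimes> Y"] by auto
    have SU: "isomorphic C (S i) (Unit C)" if i: "i < n" for i
    proof -
      have "i \<in> {j. j < n \<and> isomorphic C (S j) (S i)}" using i S(1) simple_Ob isomorphic_refl by auto
      then have "multiplicity C (S i) (?D \<boxtimes> Y) > 0"
        using multiplicity_card[OF S(2,1) S(1)[OF i]] by (auto simp: card_gt_0_iff)
      then have "subobject C (S i) (?D \<boxtimes> Y)" using subobject_if_multiplicity S(1)[OF i] by simp
      then have "S i \<in> ?V" by (rule fusion_subcategoryD(2)[OF V DV])
      then show ?thesis using V_simple S(1)[OF i] by blast
    qed
    then have "{i. i < n \<and> isomorphic C (S i) (Unit C)} = {..<n}" by auto
    then have "multiplicity C (Unit C) (?D \<boxtimes> Y) = n"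
      using multiplicity_card[OF S(2,1) Unit_simple] by simp
    \<comment> \<open>Reciprocity identifies the number \<open>n\<close> of unit summands with the
      multiplicity of \<open>Y\<close> in itself.\<close>
    moreover have "multiplicity C Y (Y \<boxtimes> Unit C) = multiplicity C (Unit C) (?D \<boxtimes> Y)"
      by (rule multiplicity_dual[OF YO Y Unit_simple])
    moreover have "multiplicity C Y (Y \<boxtimes> Unit C) = 1"
    proof -
      have "isomorphic C (Y \<boxtimes> Unit C) Y" using runitor_iso[OF YO] by (auto simp: isomorphic_def)
      then have "is_direct_sum C 1 (\<lambda>_. Y) (Y \<boxtimes> Unit C)" by (intro direct_sum_iso) simp_all
      from multiplicity_card[OF this Y Y] show ?thesis using isomorphic_refl[OF YO] by simp
    qed
    ultimately have n: "n = Suc 0" by simp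
    then have DU: "isomorphic C (?D \<boxtimes> Y) (Unit C)"
      using direct_sum_single[of S "?D \<boxtimes> Y"] S SU[of 0] isomorphic_trans[of "?D \<boxtimes> Y" "S 0" "Unit C"] simple_Ob by simp
    moreover have "isomorphic C (Y \<boxtimes> ?D) (Unit C)"
      using isomorphic_trans[of "Y \<boxtimes> ?D" "?D \<boxtimes> Y" "Unit C"] isomorphic_sym[OF br] DU by simp
    ultimately show ?thesis unfolding invertible_ob_def using YO dual_Ob by blast
  qed
  let ?G = "{Y. simple_ob C Y \<and> Y \<boxtimes> dual C Y \<in> ?V}"
  have G: "?G \<subseteq> Ob C" using simple_Ob by auto
  have P: "{X. invertible_ob C X} \<subseteq> Ob C" by (auto simp: invertible_ob_def)
  have "Y \<in> generated_subcategory C ?G" if Y: "invertible_ob C Y" for Y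
  proof -
    obtain Z where O: "Y \<in> Ob C" "Z \<in> Ob C" and YZ: "isomorphic C (Y \<boxtimes> Z) (Unit C)"
      using Y by (auto simp: invertible_ob_def)
    have one: "f Y * f Z = 1" if "character f" for f :: "'o \<Rightarrow> complex"
      using additive_iso[OF characterD(1)[OF that] _ _ YZ] characterD(2,3)[OF that] O by simp
    \<comment> \<open>The two moduli and their two bounds both multiply to 1, so neither inequality
      can be strict.\<close>
    have ne: "cmod (chic W Y) = dimr Y" if W: "simple_ob C W" for W
    proof -
      have "cmod (chic W Y) * cmod (chic W Z) = 1"
        using one[OF chic_character[OF W]] by (metis norm_mult norm_one)
      moreover have "dimr Y * dimr Z = 1"
        using one[OF dimc_character] dimc_eq[OF O(1)] dimc_eq[OF O(2)] by (metis of_real_eq_1_iff of_real_mult)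
      moreover note chic_bound[OF W O(1)] chic_bound[OF W O(2)]
      ultimately show ?thesis
        by (smt (verit, ccfv_SIG) mult_left_mono mult_right_mono mult_strict_right_mono norm_ge_zero zero_less_mult_pos)
    qed
    have "Z \<in> ?G" if Z: "Z \<in> Irr C" "multiplicity C Z Y > 0" for Z
    proof -
      have "Z \<boxtimes> dual C Z \<in> kern W" if W: "simple_ob C W" for W
        using tensor_dual_kern[OF W, of Z] chic_norm_eq_constituent[OF W O(1) ne[OF W] Z] Z by simp
      then show ?thesis using Z Irr_simple by (simp add: centralizer_Ob[symmetric] centralizer_eq)
    qed
    then show ?thesis
      using fusion_subcategory_Irr[OF generated_subcategory_props(1)[OF G] O(1)] generated_subcategory_props(2)[OF G] by blast
  qed
  then have "generated_subcategory C {X. invertible_ob C X} \<subseteq> generated_subcategory C ?G"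
    by (intro generated_subcategory_least generated_subcategory_props(1)[OF G]) auto
  moreover have "generated_subcategory C ?G \<subseteq> generated_subcategory C {X. invertible_ob C X}"
    using inv generated_subcategory_props[OF P] by (intro generated_subcategory_least) auto
  ultimately show ?thesis by (simp add: commutator_subcategory_def pointed_subcategory_def)
qed

section \<open>The central series\<close>

lemma upper_central_series_Ob: "upper_central_series C n \<subseteq> Ob C"
  by (induction n) (simp_all add: adjoint_subcategory_props)

text \<open>The cases follow the recursion of the lower series. At index 1 the commutator of Vec
  appears and is replaced by the pointed subcategory by \<open>commutator_Vec\<close>.\<close>

lemma centralizer_upper_central_series: "centralizer C (upper_central_series C n) = lower_central_series C n"
proof (induction n rule: lower_central_series.induct)
  case 1
  show ?case by (simp add: centralizer_Ob)
next
  case 2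
  show ?case using centralizer_adjoint[of "Ob C"] by (simp add: centralizer_Ob commutator_Vec)
next
  case (3 n)
  then show ?case using centralizer_adjoint[OF upper_central_series_Ob[of "Suc n"]] by simp
qed

end

theorem theorem6p8:
  fixes C :: "('o, 'm::ab_group_add, 'k::{alg_closed_field,field_char_0}) ribbon_cat"
    and \<iota> :: "'k \<Rightarrow> complex"
  assumes "pseudounitary_modular_category C \<iota>"
  shows "\<forall>n. centralizer C (upper_central_series C n) = lower_central_series C n"
  using pseudounitary_modular_category.centralizer_upper_central_series[OF assms] by blast

end
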